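(* Consider the quantile regression model $Y_i=\mu(X_i)+\sigma(X_i)\epsilon_i$, $i=1,\dots,n$, as set up in the context, with $\mu\in\mathcal U$, $\sigma\in\Sigma$, covariate density $h\in\mathcal H$, where the error $\epsilon_i$ has known density $f$ equal to one of the following: (a) asymmetric Laplace: $f(y)=\tau(1-\tau)\exp[-\rho_\tau(y)]$, with $0<\tau<1$; (b) asymmetric connected double truncated gamma: $f(y)=\frac{\tau(1-\tau)}{\Gamma(a+1,a)}[a+\rho_\tau(y)]^a\exp\{-[a+\rho_\tau(y)]\}$, with $0<\tau<1$ and $a\ge0$; (c) connected normal-Laplace: $f(y)=\frac{2\tau}{\sqrt{2\pi}}e^{-y^2/2}I(y\le0)+\frac{1-\tau}{\beta}e^{-y/\beta}I(y>0)$, with $0<\tau<1$, $\beta>0$ and $\frac{1-\tau}{\beta}=\frac{2\tau}{\sqrt{2\pi}}$; (d) Cauchy: $f(y)=\frac{1}{\pi(1+y^2)}$. Assume that there exist a density $h_0\in\mathcal H$ and a constant $C<\infty$ such that $\sup_{x\in\mathcal X}h(x)/h_0(x)\le C$ for all $h\in\mathcal H$, and that $M_{h_0}(\varepsilon;\mathcal U)$ is rich and order regular with $M_{h_0}(\varepsilon;\Sigma)=O(M_{h_0}(\varepsilon;\mathcal U))$ as $\varepsilon\to0$. Then the minimax rate of convergence for estimating the quantile regression function $\mu\in\mathcal U$ under the squared $L_2$ distance is $$\inf_{\hat\mu}\ \sup_{\mu\in\mathcal U,\ \sigma\in\Sigma,\ h\in\mathcal H}\mathbb E\|\mu-\hat\mu\|_{2,h}^2\asymp\varepsilon_n^2,$$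 where $\varepsilon_n$ is determined by $M_{h_0}(\varepsilon_n;\mathcal U)=n\varepsilon_n^2$, and the infimum is over all estimators based on $(X_i,Y_i)_{i=1}^n$.
   Context: Model and standing assumptions. The observations $(X_i,Y_i)_{i=1}^n$ are i.i.d. with $Y_i=\mu(X_i)+\sigma(X_i)\epsilon_i$; $X_i$ takes values in $\mathcal X$ and has density $h$ (with respect to a fixed dominating measure written $dx$) belonging to a class $\mathcal H$ of densities; $\epsilon_i$ is independent of $X_i$ and has known density $f$ with respect to Lebesgue measure on $\mathbb R$. The regression function $\mu$ belongs to a class $\mathcal U$ of real functions on $\mathcal X$ with $\sup_{\mu\in\mathcal U}\|\mu\|_\infty<\infty$, which is totally bounded in the $L_2(h_0)$ distance. The scale function $\sigma$ belongs to a class $\Sigma$ of functions on $\mathcal X$ for which there is a fixed $\overline\sigma>1$ with $\overline\sigma^{-1}\le\sigma(x)\le\overline\sigma$ for all $x\in\mathcal X$ and $\sigma\in\Sigma$. In cases (a)-(c) the $\tau$-th quantile of $\epsilon$ is $0$, so $\mu(x)$ is the conditional $\tau$-th quantile of $Y$ given $X=x$; in case (d) $\mu(x)$ is the conditional median. Notation. $\rho_\tau(y)=y(\tau-I(y<0))$; $\Gamma(t,k)=\int_k^\infty x^{t-1}e^{-x}\,dx$ is the upper incomplete gamma function. $\|\mu-\upsilon\|_{2,h}^2=\int(\mu(x)-\upsilon(x))^2h(x)\,dx$. For nonnegative sequences, $k_n\asymp s_n$ means $k_n=O(s_n)$ and $s_n=O(k_n)$; similarly for functions of $\varepsilon\to0$.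 Metric entropy. For a function class $\mathcal G$, a finite $N_\varepsilon\subset\mathcal G$ is an $\varepsilon$-packing set under $L_2(h_0)$ if $\|g-g'\|_{2,h_0}>\varepsilon$ for all distinct $g,g'\in N_\varepsilon$. $M_{h_0}(\varepsilon;\mathcal G)$ denotes the logarithm of the maximum cardinality of $\varepsilon$-packing sets of $\mathcal G$ under $L_2(h_0)$. As is customary, $M_{h_0}(\varepsilon;\mathcal U)$ is identified with a presumed known order $M(\varepsilon)$ of it (so $M_{h_0}(\varepsilon;\mathcal U)\asymp M(\varepsilon)$ as $\varepsilon\to0$) in the following definitions and in the equation determining $\varepsilon_n$. Rich: for some $0<\alpha<1$, $\liminf_{\varepsilon\to0}M(\alpha\varepsilon)/M(\varepsilon)>1$. Order regular: for every constant $c>0$, $M(\varepsilon)\asymp M(c\varepsilon)$ as $\varepsilon\to0$. *)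

theory Defs
  imports "HOL-Probability.Probability"
begin

text \<open>
  Both metric entropies and minimax risks take values in \<open>[0, \<infinity>]\<close>, where the
  Landau symbols of the library are not available.  The constant is real, so
  \<^term>\<open>f x = \<infinity>\<close> cannot be dominated by a finite \<^term>\<open>g x\<close>.
\<close>

definition ennreal_bigo :: "'b filter \<Rightarrow> ('b \<Rightarrow> ennreal) \<Rightarrow> ('b \<Rightarrow> ennreal) \<Rightarrow> bool" where
  "ennreal_bigo F f g \<longleftrightarrow> (\<exists>K::real. \<forall>\<^sub>F x in F. f x \<le> ennreal K * g x)"

definition same_order :: "'b filter \<Rightarrow> ('b \<Rightarrow> ennreal) \<Rightarrow> ('b \<Rightarrow> ennreal) \<Rightarrow> bool" where
  "same_order F f g \<longleftrightarrow> ennreal_bigo F f g \<and> ennreal_bigo F g f"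

definition check_loss :: "real \<Rightarrow> real \<Rightarrow> real" where
  "check_loss \<tau> y = y * (\<tau> - of_bool (y < 0))"

definition upper_Gamma :: "real \<Rightarrow> real \<Rightarrow> real" where
  "upper_Gamma t k = (LBINT x:{k..}. x powr (t - 1) * exp (- x))"

definition asymmetric_laplace_density :: "real \<Rightarrow> real \<Rightarrow> real" where
  "asymmetric_laplace_density \<tau> y = \<tau> * (1 - \<tau>) * exp (- check_loss \<tau> y)"

text \<open>For \<open>a = 0\<close> the convention \<open>0 powr 0 = 0\<close> affects the value at \<open>y = 0\<close> only.\<close>

definition truncated_gamma_density :: "real \<Rightarrow> real \<Rightarrow> real \<Rightarrow> real" where
  "truncated_gamma_density \<tau> a y =
     \<tau> * (1 - \<tau>) / upper_Gamma (a + 1) a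
       * (a + check_loss \<tau> y) powr a * exp (- (a + check_loss \<tau> y))"

definition normal_laplace_density :: "real \<Rightarrow> real \<Rightarrow> real \<Rightarrow> real" where
  "normal_laplace_density \<tau> \<beta> y =
     2 * \<tau> / sqrt (2 * pi) * exp (- (y\<^sup>2 / 2)) * of_bool (y \<le> 0)
       + (1 - \<tau>) / \<beta> * exp (- (y / \<beta>)) * of_bool (0 < y)"

definition cauchy_density :: "real \<Rightarrow> real" where
  "cauchy_density y = 1 / (pi * (1 + y\<^sup>2))"

text \<open>
  The covariate space is \<^term>\<open>space D\<close>, where \<^term>\<open>D\<close> is the dominating measure.  The
  distance is kept in squared form, with values in \<open>[0, \<infinity>]\<close>, since an estimate
  need not be square integrable.
\<close>

definition prob_densities :: "'a measure \<Rightarrow> ('a \<Rightarrow> real) set" where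
  "prob_densities D =
     {h \<in> borel_measurable D. (\<forall>x\<in>space D. 0 \<le> h x) \<and> (\<integral>\<^sup>+x. ennreal (h x) \<partial>D) = 1}"

definition sq_L2_dist :: "'a measure \<Rightarrow> ('a \<Rightarrow> real) \<Rightarrow> ('a \<Rightarrow> real) \<Rightarrow> ('a \<Rightarrow> real) \<Rightarrow> ennreal" where
  "sq_L2_dist D h \<mu> \<nu> = (\<integral>\<^sup>+x. ennreal ((\<mu> x - \<nu> x)\<^sup>2 * h x) \<partial>D)"

definition L2_totally_bounded :: "'a measure \<Rightarrow> ('a \<Rightarrow> real) \<Rightarrow> ('a \<Rightarrow> real) set \<Rightarrow> bool" where
  "L2_totally_bounded D h G \<longleftrightarrow>
     (\<forall>\<epsilon>>0. \<exists>N. finite N \<and> N \<subseteq> G \<and> (\<forall>g\<in>G. \<exists>g'\<in>N. sq_L2_dist D h g g' \<le> ennreal (\<epsilon>\<^sup>2)))"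

definition packing_set ::
    "'a measure \<Rightarrow> ('a \<Rightarrow> real) \<Rightarrow> ('a \<Rightarrow> real) set \<Rightarrow> real \<Rightarrow> ('a \<Rightarrow> real) set \<Rightarrow> bool" where
  "packing_set D h G \<epsilon> N \<longleftrightarrow>
     finite N \<and> N \<subseteq> G \<and> (\<forall>g\<in>N. \<forall>g'\<in>N. g \<noteq> g' \<longrightarrow> ennreal (\<epsilon>\<^sup>2) < sq_L2_dist D h g g')"

text \<open>The entropy is infinite if the cardinalities of the packing sets are unbounded.\<close>

definition metric_entropy ::
    "'a measure \<Rightarrow> ('a \<Rightarrow> real) \<Rightarrow> ('a \<Rightarrow> real) set \<Rightarrow> real \<Rightarrow> ennreal" where
  "metric_entropy D h G \<epsilon> = (SUP N \<in> {N. packing_set D h G \<epsilon> N}. ennreal (ln (real (card N))))"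

definition rich :: "(real \<Rightarrow> real) \<Rightarrow> bool" where
  "rich M \<longleftrightarrow> (\<exists>\<alpha>. 0 < \<alpha> \<and> \<alpha> < 1 \<and>
     1 < Liminf (at_right 0) (\<lambda>\<epsilon>. ereal (M (\<alpha> * \<epsilon>) / M \<epsilon>)))"

definition order_regular :: "(real \<Rightarrow> real) \<Rightarrow> bool" where
  "order_regular M \<longleftrightarrow> (\<forall>c>0. M \<in> \<Theta>[at_right 0](\<lambda>\<epsilon>. M (c * \<epsilon>)))"

text \<open>
  An order \<^term>\<open>M\<close> of the entropy is only meaningful near \<open>0\<close>, so the critical radius is
  the solution of the entropy equation in that range.  For nonincreasing \<^term>\<open>M\<close> every
  sequence of positive solutions tends to \<open>0\<close>, see below.
\<close>

definition critical_radius :: "(real \<Rightarrow> real) \<Rightarrow> (nat \<Rightarrow> real) \<Rightarrow> bool" where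
  "critical_radius M e \<longleftrightarrow>
     (\<forall>\<^sub>F n in sequentially. 0 < e n \<and> M (e n) = real n * (e n)\<^sup>2) \<and> e \<longlonglongrightarrow> 0"

lemma critical_radius_antimono:
  fixes M :: "real \<Rightarrow> real" and e :: "nat \<Rightarrow> real"
  assumes antimono: "\<And>x y. 0 < x \<Longrightarrow> x \<le> y \<Longrightarrow> M y \<le> M x"
    and sol: "\<forall>\<^sub>F n in sequentially. 0 < e n \<and> M (e n) = real n * (e n)\<^sup>2"
  shows "critical_radius M e"
proof -
  have "\<forall>\<^sub>F n in sequentially. dist (e n) 0 < \<delta>" if \<delta>: "0 < \<delta>" for \<delta> :: real
  proof -
    have "\<forall>\<^sub>F n in sequentially. M \<delta> / \<delta>\<^sup>2 < real n"
      using filterlim_real_sequentially by (simp add: filterlim_at_top_dense)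
    with sol show ?thesis
    proof eventually_elim
      case (elim n)
      have "e n < \<delta>"
      proof (rule ccontr)
        assume "\<not> e n < \<delta>"
        then have le: "\<delta> \<le> e n" by simp
        have "real n * \<delta>\<^sup>2 \<le> real n * (e n)\<^sup>2"
          using le \<delta> by (intro mult_left_mono power_mono) auto
        also have "\<dots> \<le> M \<delta>" using antimono[OF \<delta> le] elim by simp
        also have "\<dots> < real n * \<delta>\<^sup>2" using elim \<delta> by (simp add: divide_less_eq)
        finally show False by simp
      qed
      then show ?case using elim by simp
    qed
  qed
  then have "e \<longlonglongrightarrow> 0" by (simp add: tendsto_iff)
  with sol show ?thesis by (simp add: critical_radius_def)
qed

definition observation_law ::
    "'a measure \<Rightarrow> (real \<Rightarrow> real) \<Rightarrow> ('a \<Rightarrow> real) \<Rightarrow> ('a \<Rightarrow> real) \<Rightarrow> ('a \<Rightarrow> real) \<Rightarrow> ('a \<times> real) measure"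
  where
  "observation_law D f \<mu> \<sigma> h =
     distr (density D (\<lambda>x. ennreal (h x)) \<Otimes>\<^sub>M density lborel (\<lambda>y. ennreal (f y)))
       (D \<Otimes>\<^sub>M borel) (\<lambda>(x, e). (x, \<mu> x + \<sigma> x * e))"

definition sample_law ::
    "'a measure \<Rightarrow> (real \<Rightarrow> real) \<Rightarrow> nat \<Rightarrow> ('a \<Rightarrow> real) \<Rightarrow> ('a \<Rightarrow> real) \<Rightarrow> ('a \<Rightarrow> real)
      \<Rightarrow> (nat \<Rightarrow> 'a \<times> real) measure" where
  "sample_law D f n \<mu> \<sigma> h = (\<Pi>\<^sub>M i\<in>{..<n}. observation_law D f \<mu> \<sigma> h)"

definition estimators :: "'a measure \<Rightarrow> nat \<Rightarrow> ((nat \<Rightarrow> 'a \<times> real) \<Rightarrow> 'a \<Rightarrow> real) set" where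
  "estimators D n =
     {m. (\<lambda>(z, x). m z x) \<in> borel_measurable ((\<Pi>\<^sub>M i\<in>{..<n}. D \<Otimes>\<^sub>M borel) \<Otimes>\<^sub>M D)}"

definition risk ::
    "'a measure \<Rightarrow> (real \<Rightarrow> real) \<Rightarrow> nat \<Rightarrow> ('a \<Rightarrow> real) \<Rightarrow> ('a \<Rightarrow> real) \<Rightarrow> ('a \<Rightarrow> real)
      \<Rightarrow> ((nat \<Rightarrow> 'a \<times> real) \<Rightarrow> 'a \<Rightarrow> real) \<Rightarrow> ennreal" where
  "risk D f n \<mu> \<sigma> h m = (\<integral>\<^sup>+z. sq_L2_dist D h \<mu> (m z) \<partial>sample_law D f n \<mu> \<sigma> h)"

definition minimax_risk ::
    "'a measure \<Rightarrow> (real \<Rightarrow> real) \<Rightarrow> ('a \<Rightarrow> real) set \<Rightarrow> ('a \<Rightarrow> real) set \<Rightarrow> ('a \<Rightarrow> real) set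
      \<Rightarrow> nat \<Rightarrow> ennreal" where
  "minimax_risk D f U S H n =
     (INF m\<in>estimators D n. SUP \<mu>\<in>U. SUP \<sigma>\<in>S. SUP h\<in>H. risk D f n \<mu> \<sigma> h m)"

end

theory Submission
  imports Defs "HOL-Real_Asymp.Real_Asymp"
begin

text \<open>
  Upper bound: the estimator maximizes the likelihood over the product of \<open>\<epsilon>\<^sub>n\<close>-covers of \<open>U\<close> and
  \<open>S\<close> in \<open>L\<^sub>2(h\<^sub>0)\<close>; the covariate density cancels in the likelihood ratios, so it need not be
  known.  By the argument of Li and Barron, the expected squared Hellinger distance to the truth is at
  most the Kullback-Leibler distance of the truth to the cover plus \<open>2 / n\<close> times the logarithm of the
  size of the cover.  The former is at most of order \<open>\<epsilon>\<^sub>n\<^sup>2\<close>, since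
  \<open>ln f\<close> is Lipschitz in a weighted sense.  The squared Hellinger distance in turn dominates
  \<open>\<parallel>\<mu> - \<mu>'\<parallel>\<^sup>2\<close>, by comparing the conditional probabilities of \<open>Y \<le> \<mu>(X)\<close>.

  Lower bound: fix \<open>h\<^sub>0\<close> and one \<open>\<sigma>\<close>.  A packing of \<open>U\<close> at scale \<open>\<alpha>\<^sup>j \<epsilon>\<^sub>n\<close> has, by richness, an
  entropy that is a large multiple of \<open>n \<epsilon>\<^sub>n\<^sup>2\<close>.  Every law of the packing is within Kullback-Leibler
  divergence of order \<open>n \<epsilon>\<^sub>n\<^sup>2\<close> of one of the few laws of an \<open>\<epsilon>\<^sub>n\<close>-cover.  An estimator that identified
  the elements of the packing would give disjoint events of substantial probability under the laws
  of the packing, and hence more mass under the laws of the cover than is available.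
\<close>

section \<open>Likelihood ratios of product measures\<close>

text \<open>The two bounds meet because Kullback-Leibler divergence is at most of the order of the
  squared distances of both \<mu> and \<sigma>, while squared Hellinger distance is at least of the
  order of that of \<mu> alone. The unknown \<sigma> does not spoil the latter: given X, the
  probability of Y \<le> \<mu>(X) under the law with location \<mu> is the same for every scale. The
  obstacle for the former is that the log-densities have kinks, so they cannot be expanded to second
  order, and that the Cauchy law has no moments. It is overcome by bounding the second moment of the
  log-likelihood ratio under both laws, from which the divergence follows by an elementary
  inequality for \<open>exp\<close>. In the lower bound, Markov's inequality takes the place of
  Fano's. Passing to a law of the cover at threshold \<open>t\<close> costs the factor
  \<open>exp t\<close>, with \<open>t\<close> of the order of n times the squared radius. The
  packing must therefore have logarithmic size beyond that of the cover plus \<open>t\<close>.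
  Richness achieves this with a number \<open>j\<close> of refinements that does not depend on n, so
  only a constant factor is lost in the rate.\<close>

lemma (in finite_measure) integrable_sqrt:
  fixes r :: "'a \<Rightarrow> real"
  assumes r: "integrable M r" and nonneg: "\<And>x. x \<in> space M \<Longrightarrow> 0 \<le> r x"
  shows "integrable M (\<lambda>x. sqrt (r x))"
proof (rule Bochner_Integration.integrable_bound[where f="\<lambda>x. 1 + r x"])
  show "AE x in M. norm (sqrt (r x)) \<le> norm (1 + r x)"
  proof (intro AE_I2)
    fix x assume "x \<in> space M"
    then have "0 \<le> r x" by (rule nonneg)
    moreover from this have "sqrt (r x) \<le> 1 + r x"
      by (intro real_le_lsqrt) (auto simp: power2_eq_square algebra_simps)
    ultimately show "norm (sqrt (r x)) \<le> norm (1 + r x)" by simp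
  qed
qed (use r in auto)

section \<open>Integrals and densities on products of a single law\<close>

lemma integrable_PiM_component:
  fixes g :: "'b \<Rightarrow> real"
  assumes P: "prob_space P" and i: "i \<in> I" and g: "integrable P g"
  shows "integrable (PiM I (\<lambda>_. P)) (\<lambda>z. g (z i))"
    and "(\<integral>z. g (z i) \<partial>PiM I (\<lambda>_. P)) = (\<integral>x. g x \<partial>P)"
proof -
  have d: "distr (PiM I (\<lambda>_. P)) P (\<lambda>z. z i) = P"
    using distr_PiM_component[of I "\<lambda>_. P" i] P i by simp
  have m: "(\<lambda>z. z i) \<in> measurable (PiM I (\<lambda>_. P)) P"
    using i by measurable
  have gm: "g \<in> borel_measurable P" using g by simp
  show "integrable (PiM I (\<lambda>_. P)) (\<lambda>z. g (z i))"
    using integrable_distr_eq[OF m gm] g by (simp add: d)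
  show "(\<integral>z. g (z i) \<partial>PiM I (\<lambda>_. P)) = (\<integral>x. g x \<partial>P)"
    using integral_distr[OF m gm] by (simp add: d)
qed

lemma integral_sum_PiM:
  fixes g :: "'b \<Rightarrow> real"
  assumes P: "prob_space P" and g: "integrable P g"
  shows "integrable (PiM I (\<lambda>_. P)) (\<lambda>z. \<Sum>i\<in>I. g (z i))"
    and "(\<integral>z. (\<Sum>i\<in>I. g (z i)) \<partial>PiM I (\<lambda>_. P)) = real (card I) * (\<integral>x. g x \<partial>P)"
proof -
  note c = integrable_PiM_component[where I=I, OF P _ g]
  show "integrable (PiM I (\<lambda>_. P)) (\<lambda>z. \<Sum>i\<in>I. g (z i))"
    using c by (intro Bochner_Integration.integrable_sum)
  show "(\<integral>z. (\<Sum>i\<in>I. g (z i)) \<partial>PiM I (\<lambda>_. P)) = real (card I) * (\<integral>x. g x \<partial>P)"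
    using c by (subst Bochner_Integration.integral_sum) auto
qed

lemma integral_prod_PiM:
  fixes g :: "'b \<Rightarrow> real"
  assumes P: "prob_space P" and g: "integrable P g" and I: "finite I"
  shows "integrable (PiM I (\<lambda>_. P)) (\<lambda>z. \<Prod>i\<in>I. g (z i))"
    and "(\<integral>z. (\<Prod>i\<in>I. g (z i)) \<partial>PiM I (\<lambda>_. P)) = (\<integral>x. g x \<partial>P) ^ card I"
proof -
  interpret prob_space P by fact
  interpret product_sigma_finite "\<lambda>_. P" by standard
  show "integrable (PiM I (\<lambda>_. P)) (\<lambda>z. \<Prod>i\<in>I. g (z i))"
    using product_integrable_prod[of I "\<lambda>_. g"] I g by simp
  show "(\<integral>z. (\<Prod>i\<in>I. g (z i)) \<partial>PiM I (\<lambda>_. P)) = (\<integral>x. g x \<partial>P) ^ card I"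
    using product_integral_prod[of I "\<lambda>_. g"] I g by simp
qed

text \<open>A product measure is determined by its values on rectangles once the factors are
  sigma-finite, which both laws are as probability measures; on rectangles the integral
  factorizes.\<close>

lemma PiM_density:
  fixes r :: "'b \<Rightarrow> real"
  assumes P: "prob_space P" and Q: "prob_space (density P r)" and I: "finite I"
    and r: "r \<in> borel_measurable P"
  shows "PiM I (\<lambda>_. density P r) = density (PiM I (\<lambda>_. P)) (\<lambda>z. \<Prod>i\<in>I. ennreal (r (z i)))"
proof -
  interpret P: prob_space P by fact
  interpret Q: prob_space "density P r" by fact
  interpret PP: product_sigma_finite "\<lambda>_. P" by standard
  interpret QQ: product_sigma_finite "\<lambda>_. density P r" by standard
  note r[measurable]
  have "density (PiM I (\<lambda>_. P)) (\<lambda>z. \<Prod>i\<in>I. ennreal (r (z i))) = PiM I (\<lambda>_. density P r)"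
  proof (rule QQ.PiM_eqI[OF I])
    show "sets (density (PiM I (\<lambda>_. P)) (\<lambda>z. \<Prod>i\<in>I. ennreal (r (z i)))) = sets (PiM I (\<lambda>_. density P r))"
      by (simp cong: sets_PiM_cong)
    fix A assume A: "\<And>i. i \<in> I \<Longrightarrow> A i \<in> sets (density P r)"
    then have A': "\<And>i. i \<in> I \<Longrightarrow> A i \<in> sets P" by simp
    have "emeasure (density (PiM I (\<lambda>_. P)) (\<lambda>z. \<Prod>i\<in>I. ennreal (r (z i)))) (Pi\<^sub>E I A)
        = (\<integral>\<^sup>+z. (\<Prod>i\<in>I. ennreal (r (z i))) * indicator (Pi\<^sub>E I A) z \<partial>PiM I (\<lambda>_. P))"
      using I A' by (subst emeasure_density) (auto intro!: sets_PiM_I_finite)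
    also have "\<dots> = (\<integral>\<^sup>+z. (\<Prod>i\<in>I. ennreal (r (z i)) * indicator (A i) (z i)) \<partial>PiM I (\<lambda>_. P))"
    proof (rule nn_integral_cong)
      fix z assume z: "z \<in> space (PiM I (\<lambda>_. P))"
      have "indicator (Pi\<^sub>E I A) z = (\<Prod>i\<in>I. indicator (A i) (z i) :: ennreal)"
      proof (cases "\<forall>i\<in>I. z i \<in> A i")
        case True
        then have "z \<in> Pi\<^sub>E I A" using z by (auto simp: space_PiM PiE_def)
        then show ?thesis using True by (simp add: prod.neutral)
      next
        case False
        then obtain i where i: "i \<in> I" "z i \<notin> A i" by auto
        then have "z \<notin> Pi\<^sub>E I A" by auto
        moreover have "(\<Prod>i\<in>I. indicator (A i) (z i) :: ennreal) = 0"
          using i I by (auto intro!: prod_zero bexI[of _ i])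
        ultimately show ?thesis by simp
      qed
      then show "(\<Prod>i\<in>I. ennreal (r (z i))) * indicator (Pi\<^sub>E I A) z
        = (\<Prod>i\<in>I. ennreal (r (z i)) * indicator (A i) (z i))"
        by (simp add: prod.distrib)
    qed
    also have "\<dots> = (\<Prod>i\<in>I. \<integral>\<^sup>+x. ennreal (r x) * indicator (A i) x \<partial>P)"
      using A' by (intro PP.product_nn_integral_prod[OF I]) auto
    also have "\<dots> = (\<Prod>i\<in>I. emeasure (density P r) (A i))"
      using A' by (intro prod.cong) (auto simp: emeasure_density)
    finally show "emeasure (density (PiM I (\<lambda>_. P)) (\<lambda>z. \<Prod>i\<in>I. ennreal (r (z i)))) (Pi\<^sub>E I A)
      = (\<Prod>i\<in>I. emeasure (density P r) (A i))" .
  qed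
  then show ?thesis by simp
qed

lemma integral_density_prob:
  fixes r :: "'b \<Rightarrow> real"
  assumes "prob_space (density P r)" "r \<in> borel_measurable P" "\<And>x. x \<in> space P \<Longrightarrow> 0 \<le> r x"
  shows "integrable P r" and "(\<integral>x. r x \<partial>P) = 1"
proof -
  have "(\<integral>\<^sup>+x. ennreal (r x) \<partial>P) = emeasure (density P r) (space P)"
    using assms(2) by (subst emeasure_density) (auto cong: nn_integral_cong)
  also have "\<dots> = 1" using prob_space.emeasure_space_1[OF assms(1)] by simp
  finally have n: "(\<integral>\<^sup>+x. ennreal (r x) \<partial>P) = 1" .
  show i: "integrable P r"
    using n assms by (intro integrableI_nn_integral_finite[where x=1]) auto
  have "ennreal (\<integral>x. r x \<partial>P) = 1"
    using n nn_integral_eq_integral[OF i] assms(3) by (simp add: AE_I2)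
  then show "(\<integral>x. r x \<partial>P) = 1" by simp
qed

text \<open>Markov's inequality is applied to the positive part of the log-likelihood ratio \<open>L\<close>,
  which is at most \<open>L + exp (- L)\<close>.\<close>

lemma change_of_measure_bound:
  fixes r :: "'b \<Rightarrow> real"
  assumes P: "prob_space P" and Q: "prob_space (density P r)" and I: "finite I"
    and r: "r \<in> borel_measurable P" and r_pos: "\<And>x. x \<in> space P \<Longrightarrow> 0 < r x"
    and ln_int: "integrable P (\<lambda>x. ln (r x))" and KL: "- (\<integral>x. ln (r x) \<partial>P) \<le> \<kappa>"
    and A: "A \<in> sets (PiM I (\<lambda>_. P))" and t: "0 < t"
  shows "measure (PiM I (\<lambda>_. P)) A
    \<le> (real (card I) * \<kappa> + 1) / t + exp t * measure (PiM I (\<lambda>_. density P r)) A"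
proof -
  note r[measurable] A[measurable]
  let ?P = "PiM I (\<lambda>_. P)"
  let ?Q = "PiM I (\<lambda>_. density P r)"
  interpret PP: prob_space ?P using P by (intro prob_space_PiM) auto
  interpret QQ: prob_space ?Q using Q by (intro prob_space_PiM) auto
  define R where "R = (\<lambda>z. \<Prod>i\<in>I. r (z i))"
  define L where "L = (\<lambda>z. - (\<Sum>i\<in>I. ln (r (z i))))"
  have comp: "z i \<in> space P" if "z \<in> space ?P" "i \<in> I" for z i
    using that by (auto simp: space_PiM)
  have R_pos: "0 < R z" if "z \<in> space ?P" for z
    unfolding R_def using r_pos comp[OF that] by (intro prod_pos) auto
  have L_R: "exp (- L z) = R z" if "z \<in> space ?P" for z
    using r_pos comp[OF that] I by (simp add: L_def R_def exp_sum)
  have R_int: "integrable ?P R" "(\<integral>z. R z \<partial>?P) = 1"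
    using integral_prod_PiM[OF P _ I, of r] integral_density_prob[OF Q r less_imp_le[OF r_pos]]
    by (auto simp: R_def)
  have L_int: "integrable ?P L" "(\<integral>z. L z \<partial>?P) \<le> real (card I) * \<kappa>"
    using integral_sum_PiM[OF P ln_int, of I] mult_left_mono[OF KL, of "real (card I)"]
    by (auto simp: L_def)
  have Q_eq: "?Q = density ?P R"
  proof -
    have "?Q = density ?P (\<lambda>z. \<Prod>i\<in>I. ennreal (r (z i)))" by (rule PiM_density) fact+
    also have "\<dots> = density ?P R"
      using less_imp_le[OF r_pos] comp
      by (intro density_cong AE_I2) (auto simp: R_def prod_ennreal)
    finally show ?thesis .
  qed
  have meas: "measure ?Q A = (\<integral>z. R z * indicator A z \<partial>?P)"
  proof -
    have "ennreal (measure ?Q A) = emeasure ?Q A" by (simp add: QQ.emeasure_eq_measure)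
    also have "\<dots> = (\<integral>\<^sup>+z. ennreal (R z) * indicator A z \<partial>?P)"
      unfolding Q_eq using R_int by (subst emeasure_density) auto
    also have "\<dots> = (\<integral>\<^sup>+z. ennreal (R z * indicator A z) \<partial>?P)"
      by (intro nn_integral_cong) (auto split: split_indicator)
    also have "\<dots> = ennreal (\<integral>z. R z * indicator A z \<partial>?P)"
      using R_pos by (intro nn_integral_eq_integral integrable_real_mult_indicator A R_int AE_I2)
        (auto split: split_indicator simp: less_imp_le)
    finally show ?thesis
      using R_pos by (subst (asm) ennreal_inj) (auto intro!: integral_nonneg_AE AE_I2 split: split_indicator simp: less_imp_le)
  qed
  \<comment> \<open>Where \<open>L\<close> exceeds \<open>t\<close> the first summand alone reaches
    1, elsewhere \<open>exp t * R\<close> does. Since \<open>R = exp (- L)\<close>, the sum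
    \<open>L + R\<close> is never negative, and \<open>R\<close> integrates to 1, whence the
    \<open>+ 1\<close> in the bound.\<close>
  have pw: "indicator A z \<le> (L z + R z) / t + exp t * (R z * indicator A z)"
    if z: "z \<in> space ?P" for z
  proof -
    have nn: "0 \<le> L z + R z"
      using L_R[OF z] exp_ge_add_one_self[of "- L z"] by linarith
    show ?thesis
    proof (cases "L z \<le> t")
      case True
      then have "exp (- t) \<le> R z" using L_R[OF z] by (metis exp_le_cancel_iff neg_le_iff_le)
      then have "1 \<le> exp t * R z"
        by (metis exp_ge_zero exp_minus_inverse mult_left_mono)
      then show ?thesis using nn t by (auto split: split_indicator intro!: add_nonneg_nonneg add_increasing)
    next
      case False
      then have "1 \<le> (L z + R z) / t" using R_pos[OF z] t by (simp add: field_simps)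
      then show ?thesis using R_pos[OF z] nn t by (auto split: split_indicator intro!: add_increasing2)
    qed
  qed
  have int_RA: "integrable ?P (\<lambda>z. R z * indicator A z)"
    by (intro integrable_real_mult_indicator A R_int)
  have "measure ?P A = (\<integral>z. indicator A z \<partial>?P)" using A by simp
  also have "\<dots> \<le> (\<integral>z. (L z + R z) / t + exp t * (R z * indicator A z) \<partial>?P)"
    using pw A L_int R_int int_RA
    by (intro integral_mono) (auto simp: PP.emeasure_eq_measure intro!: integrable_real_indicator)
  also have "\<dots> = ((\<integral>z. L z \<partial>?P) + 1) / t + exp t * measure ?Q A"
    using L_int R_int int_RA by (simp add: meas)
  also have "\<dots> \<le> (real (card I) * \<kappa> + 1) / t + exp t * measure ?Q A"
    using L_int t by (simp add: divide_right_mono)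
  finally show ?thesis .
qed

text \<open>The argument of Li and Barron for two-part codes: after division by the \<open>n\<close>-fold affinity,
  the root likelihood ratio has mean \<open>1\<close>, so replacing the maximum over \<open>J\<close> by the sum costs
  only \<open>ln (card J)\<close>.\<close>

lemma likelihood_selection_bound:
  fixes r :: "'j \<Rightarrow> 'b \<Rightarrow> real" and l :: "'j \<Rightarrow> real"
  assumes P: "prob_space P" and Q: "\<And>j. j \<in> J \<Longrightarrow> prob_space (density P (r j))"
    and J: "finite J" and jr: "jr \<in> J" and I: "finite I" "I \<noteq> {}"
    and r: "\<And>j. j \<in> J \<Longrightarrow> r j \<in> borel_measurable P"
    and r_pos: "\<And>j x. j \<in> J \<Longrightarrow> x \<in> space P \<Longrightarrow> 0 < r j x"
    and ln_int: "integrable P (\<lambda>x. ln (r jr x))" and KL: "- (\<integral>x. ln (r jr x) \<partial>P) \<le> \<kappa>"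
    and sel: "\<And>z. z \<in> space (PiM I (\<lambda>_. P)) \<Longrightarrow>
      s z \<in> J \<and> (\<Prod>i\<in>I. r jr (z i)) \<le> (\<Prod>i\<in>I. r (s z) (z i))"
    and l: "\<And>j. j \<in> J \<Longrightarrow> l j \<le> 2 * (1 - (\<integral>x. sqrt (r j x) \<partial>P))"
      "\<And>j. j \<in> J \<Longrightarrow> 0 \<le> l j"
  shows "(\<integral>\<^sup>+z. ennreal (l (s z)) \<partial>PiM I (\<lambda>_. P))
    \<le> ennreal (2 * ln (real (card J)) / real (card I) + \<kappa>)"
proof -
  let ?P = "PiM I (\<lambda>_. P)"
  interpret P: prob_space P by fact
  interpret PP: prob_space ?P using P by (intro prob_space_PiM) auto
  define n where "n = card I"
  define N where "N = real (card J)"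
  have n: "0 < n" using I by (auto simp: n_def card_gt_0_iff)
  have N: "0 < N" using J jr by (auto simp: N_def card_gt_0_iff)
  \<comment> \<open>The Hellinger affinity of the two laws. It is positive because
    \<open>r j\<close> is, so its powers may serve as divisors.\<close>
  define a where "a j = (\<integral>x. sqrt (r j x) \<partial>P)" for j
  have sq_int: "integrable P (\<lambda>x. sqrt (r j x))" if j: "j \<in> J" for j
    using integral_density_prob(1)[OF Q[OF j] r[OF j] less_imp_le[OF r_pos[OF j]]] r_pos[OF j]
    by (intro P.integrable_sqrt) (auto intro: less_imp_le)
  have a_pos: "0 < a j" if j: "j \<in> J" for j
  proof -
    have "a j \<noteq> 0"
    proof
      assume "a j = 0"
      then have "AE x in P. sqrt (r j x) = 0"
        unfolding a_def using r_pos[OF j] sq_int[OF j]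
        by (subst (asm) integral_nonneg_eq_0_iff_AE) (auto intro!: AE_I2 less_imp_le)
      then have "AE x in P. False"
        using AE_space
      proof eventually_elim
        case (elim x)
        then show ?case using r_pos[OF j, of x] by simp
      qed
      then show False by simp
    qed
    moreover have "0 \<le> a j"
      unfolding a_def using r_pos[OF j] by (intro integral_nonneg_AE AE_I2) (auto intro: less_imp_le)
    ultimately show ?thesis by simp
  qed
  define G where "G = (\<lambda>z. \<Sum>j\<in>J. (\<Prod>i\<in>I. sqrt (r j (z i))) / a j ^ n)"
  define L where "L = (\<lambda>z. \<Sum>i\<in>I. ln (r jr (z i)))"
  have G_int: "integrable ?P G"
    unfolding G_def using integral_prod_PiM(1)[OF P sq_int I(1)]
    by (intro Bochner_Integration.integrable_sum integrable_divide)
  have "(\<integral>z. G z \<partial>?P) = (\<Sum>j\<in>J. \<integral>z. (\<Prod>i\<in>I. sqrt (r j (z i))) / a j ^ n \<partial>?P)"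
    unfolding G_def using integral_prod_PiM(1)[OF P sq_int I(1)]
    by (intro Bochner_Integration.integral_sum integrable_divide)
  also have "\<dots> = (\<Sum>j\<in>J. 1)"
    using integral_prod_PiM(2)[OF P sq_int I(1)] a_pos
    by (intro sum.cong) (simp_all add: a_def[symmetric] n_def less_imp_neq[OF a_pos, symmetric])
  finally have G_exp: "(\<integral>z. G z \<partial>?P) = N" by (simp add: N_def)
  have L_int: "integrable ?P L" "(\<integral>z. - L z \<partial>?P) \<le> real n * \<kappa>"
    using integral_sum_PiM[OF P ln_int, of I] mult_left_mono[OF KL, of "real n"]
    by (auto simp: L_def n_def)
  \<comment> \<open>The tangent bound \<open>ln x \<le> x - 1\<close> at \<open>x = G z / N\<close>
    replaces Jensen's inequality, so that only \<open>G\<close> has to be integrated, and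
    \<open>G z / N - 1\<close> has mean 0. The factor 2 undoes the square root in
    \<open>G\<close>.\<close>
  define W where "W = (\<lambda>z. (2 * (G z / N - 1 + ln N) - L z) / real n)"
  have pw: "l (s z) \<le> W z" if z: "z \<in> space ?P" for z
  proof -
    let ?j = "s z"
    have comp: "z i \<in> space P" if "i \<in> I" for i
      using z that by (auto simp: space_PiM)
    have j: "?j \<in> J" using sel[OF z] by simp
    define T where "T = (\<Prod>i\<in>I. sqrt (r ?j (z i)))"
    have T: "0 < T" unfolding T_def using r_pos[OF j] comp by (intro prod_pos) auto
    have T2: "T\<^sup>2 = (\<Prod>i\<in>I. r ?j (z i))"
      unfolding T_def prod_power_distrib using r_pos[OF j] comp
      by (intro prod.cong) (auto simp: less_imp_le)
    have "L z = ln (\<Prod>i\<in>I. r jr (z i))"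
      unfolding L_def using less_imp_neq[OF r_pos[OF jr comp], symmetric] I
      by (intro ln_prod[symmetric]) auto
    \<comment> \<open>Here the selection rule enters: the chosen index has at least the likelihood
      of \<open>jr\<close>, whose log-ratio is controlled by \<open>\<kappa>\<close>.\<close>
    also have "\<dots> \<le> ln (T\<^sup>2)"
      unfolding T2 using sel[OF z] r_pos[OF jr] r_pos[OF j] comp
      by (subst ln_le_cancel_iff) (auto intro!: prod_pos)
    also have "\<dots> = 2 * ln T" using T by (simp add: ln_realpow)
    finally have L: "L z \<le> 2 * ln T" .
    have T_le: "T / a ?j ^ n \<le> G z"
      unfolding G_def T_def using r_pos comp a_pos J j
      by (intro member_le_sum[where f="\<lambda>j. (\<Prod>i\<in>I. sqrt (r j (z i))) / a j ^ n"])
         (auto intro!: divide_nonneg_nonneg prod_nonneg simp: less_imp_le)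
    have Gp: "0 < G z" using T_le T a_pos[OF j] by (meson divide_pos_pos less_le_trans zero_less_power)
    have "ln T - real n * ln (a ?j) = ln (T / a ?j ^ n)"
      using T a_pos[OF j] by (simp add: ln_div ln_realpow)
    also have "\<dots> \<le> ln (G z)" using T_le T a_pos[OF j] Gp by (subst ln_le_cancel_iff) auto
    also have "\<dots> = ln (G z / N) + ln N" using Gp N by (simp add: ln_div)
    also have "\<dots> \<le> G z / N - 1 + ln N" using Gp N by (simp add: ln_le_minus_one)
    finally have G: "ln T - real n * ln (a ?j) \<le> G z / N - 1 + ln N" .
    have "real n * l ?j \<le> real n * (2 * (1 - a ?j))"
      using l(1)[OF j] by (intro mult_left_mono) (auto simp: a_def)
    \<comment> \<open>Replacing \<open>1 - a\<close> by \<open>- ln a\<close> makes the loss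
      additive over the observations, so that it can be compared with the logarithm of a
      product.\<close>
    also have "\<dots> \<le> real n * (- 2 * ln (a ?j))"
      using ln_le_minus_one[OF a_pos[OF j]] by (intro mult_left_mono) auto
    also have "\<dots> = 2 * (ln T - real n * ln (a ?j)) - 2 * ln T" by (simp add: algebra_simps)
    also have "\<dots> \<le> 2 * (G z / N - 1 + ln N) - L z"
      using G L by (intro diff_mono mult_left_mono) auto
    finally show ?thesis using n by (simp add: W_def field_simps)
  qed
  have W_nonneg: "0 \<le> W z" if z: "z \<in> space ?P" for z
    using pw[OF z] l(2) sel[OF z] by (meson order.trans)
  have W_int: "integrable ?P W" unfolding W_def using G_int L_int by auto
  have "(\<integral>z. W z \<partial>?P) = (2 * ln N + (\<integral>z. - L z \<partial>?P)) / real n"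
    unfolding W_def using G_int G_exp L_int N by (simp add: PP.prob_space)
  also have "\<dots> \<le> (2 * ln N + real n * \<kappa>) / real n"
    using L_int by (intro divide_right_mono) auto
  also have "\<dots> = 2 * ln N / real n + \<kappa>" using n by (simp add: field_simps)
  finally have W_le: "(\<integral>z. W z \<partial>?P) \<le> 2 * ln N / real n + \<kappa>" .
  have "(\<integral>\<^sup>+z. ennreal (l (s z)) \<partial>?P) \<le> (\<integral>\<^sup>+z. ennreal (W z) \<partial>?P)"
    using pw by (intro nn_integral_mono ennreal_leI) auto
  also have "\<dots> = ennreal (\<integral>z. W z \<partial>?P)"
    using W_nonneg by (intro nn_integral_eq_integral W_int AE_I2) auto
  also have "\<dots> \<le> ennreal (2 * ln N / real n + \<kappa>)" using W_le by (rule ennreal_leI)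
  finally show ?thesis by (simp add: N_def n_def)
qed

section \<open>Error densities\<close>

text \<open>The last condition makes Kullback-Leibler divergences quadratic in the location and scale
  parameters, although the densities may have kinks.\<close>

definition regular_error :: "(real \<Rightarrow> real) \<Rightarrow> bool" where
  "regular_error f \<longleftrightarrow>
     f \<in> borel_measurable borel \<and> (\<forall>y. 0 < f y) \<and> (\<integral>\<^sup>+y. ennreal (f y) \<partial>lborel) = 1 \<and>
     (\<forall>b. \<exists>\<kappa>>0. \<forall>y. \<bar>y\<bar> \<le> b \<longrightarrow> \<kappa> \<le> f y) \<and>
     (\<forall>b\<ge>1. \<exists>K. \<forall>c d. inverse b \<le> c \<and> c \<le> b \<and> \<bar>d\<bar> \<le> b \<longrightarrow>
        (\<integral>\<^sup>+u. ennreal ((ln (f u) - ln (f (c * u + d)))\<^sup>2 * f u) \<partial>lborel)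
          \<le> ennreal (K * (\<bar>c - 1\<bar> + \<bar>d\<bar>)\<^sup>2))"

section \<open>Half-line integrals and densities with exponential tails\<close>

lemma nn_integral_lborel_halves:
  fixes g :: "real \<Rightarrow> ennreal"
  assumes g[measurable]: "g \<in> borel_measurable borel"
  shows "(\<integral>\<^sup>+y. g y \<partial>lborel)
    = (\<integral>\<^sup>+y. g y * indicator {0..} y \<partial>lborel) + (\<integral>\<^sup>+y. g (- y) * indicator {0..} y \<partial>lborel)"
proof -
  have "(\<integral>\<^sup>+y. g y \<partial>lborel) = (\<integral>\<^sup>+y. g y * indicator {0..} y + g y * indicator {..0} y \<partial>lborel)"
    by (intro nn_integral_cong_AE eventually_mono[OF AE_lborel_singleton[of 0]])
       (auto split: split_indicator)
  also have "\<dots> = (\<integral>\<^sup>+y. g y * indicator {0..} y \<partial>lborel) + (\<integral>\<^sup>+y. g y * indicator {..0} y \<partial>lborel)"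
    by (intro nn_integral_add) auto
  also have "(\<integral>\<^sup>+y. g y * indicator {..0} y \<partial>lborel)
      = (\<integral>\<^sup>+y. g (- y) * indicator {..0} (- y) \<partial>lborel)"
    using nn_integral_real_affine[of "\<lambda>y. g y * indicator {..0} y" "-1" 0] by simp
  also have "\<dots> = (\<integral>\<^sup>+y. g (- y) * indicator {0..} y \<partial>lborel)"
    by (intro nn_integral_cong) (auto split: split_indicator)
  finally show ?thesis .
qed

lemma nn_integral_exp_half_line:
  fixes k :: real assumes k: "0 < k"
  shows "(\<integral>\<^sup>+y. ennreal (exp (- (k * y))) * indicator {0..} y \<partial>lborel) = ennreal (1 / k)"
proof -
  have "((\<lambda>x. - exp (- (k * x)) / k) \<longlongrightarrow> - 0 / k) at_top"
    using k by real_asymp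
  moreover have "((\<lambda>y. - exp (- (k * y)) / k) has_real_derivative exp (- (k * x))) (at x)" for x
    using k by (auto intro!: derivative_eq_intros)
  ultimately show ?thesis
    using nn_integral_FTC_atLeast[of "\<lambda>y. exp (- (k * y))" 0 "\<lambda>y. - exp (- (k * y)) / k"] by simp
qed

lemma nn_integral_exp_abs_finite:
  fixes k :: real assumes k: "0 < k"
  shows "(\<integral>\<^sup>+y. ennreal (exp (- (k * \<bar>y\<bar>))) \<partial>lborel) = ennreal (2 / k)"
proof -
  have "(\<integral>\<^sup>+y. ennreal (exp (- (k * \<bar>y\<bar>))) * indicator {0..} y \<partial>lborel) = ennreal (1 / k)"
    unfolding nn_integral_exp_half_line[OF k, symmetric]
    by (intro nn_integral_cong) (auto split: split_indicator)
  then show ?thesis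
    using k by (subst nn_integral_lborel_halves) (auto simp flip: ennreal_plus)
qed

text \<open>Even a near-identity affine map displaces distant points far. The weight
  \<open>1 + \<bar>u\<bar>\<close> has to be paid for by the tail of the density or by the flatness
  of its logarithm.\<close>

lemma abs_affine_diff_le:
  fixes c d u :: real
  shows "\<bar>u - (c * u + d)\<bar> \<le> (1 + \<bar>u\<bar>) * (\<bar>c - 1\<bar> + \<bar>d\<bar>)"
proof -
  have "\<bar>u - (c * u + d)\<bar> = \<bar>(c - 1) * u + d\<bar>"
    unfolding abs_minus_commute[of u] by (simp add: algebra_simps)
  also have "\<dots> \<le> \<bar>c - 1\<bar> * \<bar>u\<bar> + \<bar>d\<bar>"
    using abs_triangle_ineq[of "(c - 1) * u" d] by (simp add: abs_mult)
  also have "\<dots> \<le> (1 + \<bar>u\<bar>) * (\<bar>c - 1\<bar> + \<bar>d\<bar>)" by (simp add: algebra_simps)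
  finally show ?thesis .
qed

lemma abs_affine_le:
  fixes b c d u :: real
  assumes "1 \<le> b" "\<bar>c\<bar> \<le> b" "\<bar>d\<bar> \<le> b"
  shows "\<bar>c * u + d\<bar> \<le> b * (1 + \<bar>u\<bar>)"
proof -
  have "\<bar>c * u + d\<bar> \<le> \<bar>c\<bar> * \<bar>u\<bar> + \<bar>d\<bar>"
    using abs_triangle_ineq[of "c * u" d] by (simp add: abs_mult)
  also have "\<dots> \<le> b * \<bar>u\<bar> + b" using assms by (intro add_mono mult_right_mono) auto
  finally show ?thesis by (simp add: algebra_simps)
qed

text \<open>The slope of \<open>ln f\<close> may grow linearly, as it does for a normal density.
  Together with the linear displacement of \<open>u\<close>, the squared log-ratio then grows at
  most like the fourth power of \<open>1 + \<bar>u\<bar>\<close>, which half of the exponential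
  decay absorbs.\<close>

lemma regular_error_exponential_tail:
  fixes f :: "real \<Rightarrow> real"
  assumes f: "f \<in> borel_measurable borel" "\<And>y. 0 < f y" "(\<integral>\<^sup>+y. ennreal (f y) \<partial>lborel) = 1"
    and lip: "\<And>u v. \<bar>ln (f u) - ln (f v)\<bar> \<le> A * (1 + \<bar>u\<bar> + \<bar>v\<bar>) * \<bar>u - v\<bar>"
    and tail: "\<And>y. f y \<le> T * exp (- (k * \<bar>y\<bar>))" and k: "0 < k"
  shows "regular_error f"
proof -
  note f(1)[measurable]
  have A: "0 \<le> A" using lip[of 0 1] abs_ge_zero[of "ln (f 0) - ln (f 1)"] by simp
  have T: "0 \<le> T" using tail[of 0] f(2)[of 0] by simp
  have "\<exists>\<kappa>>0. \<forall>y. \<bar>y\<bar> \<le> b \<longrightarrow> \<kappa> \<le> f y" for b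
  proof (intro exI[of _ "f 0 * exp (- (A * (1 + \<bar>b\<bar>) * \<bar>b\<bar>))"] conjI allI impI)
    show "0 < f 0 * exp (- (A * (1 + \<bar>b\<bar>) * \<bar>b\<bar>))" using f by simp
    fix y assume y: "\<bar>y\<bar> \<le> b"
    have "ln (f 0) - ln (f y) \<le> A * (1 + \<bar>y\<bar>) * \<bar>y\<bar>" using lip[of 0 y] by simp
    also have "\<dots> \<le> A * (1 + \<bar>b\<bar>) * \<bar>b\<bar>" using y A by (intro mult_mono) auto
    finally have "exp (ln (f 0) - A * (1 + \<bar>b\<bar>) * \<bar>b\<bar>) \<le> exp (ln (f y))"
      by (subst exp_le_cancel_iff) linarith
    then show "f 0 * exp (- (A * (1 + \<bar>b\<bar>) * \<bar>b\<bar>)) \<le> f y"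
      using f(2) by (simp add: exp_diff exp_minus divide_inverse)
  qed
  moreover have "\<exists>K. \<forall>c d. inverse b \<le> c \<and> c \<le> b \<and> \<bar>d\<bar> \<le> b \<longrightarrow>
        (\<integral>\<^sup>+u. ennreal ((ln (f u) - ln (f (c * u + d)))\<^sup>2 * f u) \<partial>lborel)
          \<le> ennreal (K * (\<bar>c - 1\<bar> + \<bar>d\<bar>)\<^sup>2)" if b: "1 \<le> b" for b
  proof -
    define E where "E = A * (1 + b)"
    \<comment> \<open>From \<open>1 + \<bar>u\<bar> \<le> (1 + 8 / k) * exp (k / 8 *
      \<bar>u\<bar>)\<close>: the fourth power uses up the rate \<open>k / 2\<close> and leaves
      \<open>k / 2\<close> for integration.\<close>
    define P where "P = (1 + 8 / k) ^ 4 * T"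
    have E: "0 \<le> E" and P: "0 \<le> P" using A T b k by (auto simp: E_def P_def)
    show ?thesis
    \<comment> \<open>The factor \<open>4 / k\<close> is the integral of the remaining tail
      \<open>exp (- (k / 2 * \<bar>u\<bar>))\<close>.\<close>
    proof (intro exI[of _ "E\<^sup>2 * P * (4 / k)"] allI impI)
      fix c d :: real assume cd: "inverse b \<le> c \<and> c \<le> b \<and> \<bar>d\<bar> \<le> b"
      define \<delta> where "\<delta> = \<bar>c - 1\<bar> + \<bar>d\<bar>"
      have c: "\<bar>c\<bar> \<le> b" using cd b by (smt (verit) inverse_nonnegative_iff_nonnegative)
      have "(ln (f u) - ln (f (c * u + d)))\<^sup>2 * f u \<le> (E\<^sup>2 * P * \<delta>\<^sup>2) * exp (- (k / 2 * \<bar>u\<bar>))" for u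
      proof -
        have "\<bar>ln (f u) - ln (f (c * u + d))\<bar> \<le> A * (1 + \<bar>u\<bar> + \<bar>c * u + d\<bar>) * \<bar>u - (c * u + d)\<bar>"
          by (rule lip)
        also have "\<dots> \<le> A * (1 + \<bar>u\<bar> + b * (1 + \<bar>u\<bar>)) * ((1 + \<bar>u\<bar>) * \<delta>)"
          using A b c cd unfolding \<delta>_def
          by (intro mult_mono add_mono order.refl abs_affine_le abs_affine_diff_le) auto
        also have "\<dots> = E * \<delta> * (1 + \<bar>u\<bar>)\<^sup>2"
          by (simp add: E_def algebra_simps power2_eq_square)
        finally have "(ln (f u) - ln (f (c * u + d)))\<^sup>2 \<le> (E * \<delta> * (1 + \<bar>u\<bar>)\<^sup>2)\<^sup>2"
          by (metis abs_ge_zero power2_abs power_mono)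
        also have "\<dots> = E\<^sup>2 * \<delta>\<^sup>2 * (1 + \<bar>u\<bar>) ^ 4" by (simp add: power_mult_distrib flip: power_mult)
        also have "\<dots> \<le> E\<^sup>2 * \<delta>\<^sup>2 * ((1 + 8 / k) * exp (k / 8 * \<bar>u\<bar>)) ^ 4"
        proof -
          have "(1 + \<bar>u\<bar>) \<le> (1 + 8 / k) * (1 + k / 8 * \<bar>u\<bar>)" using k by (simp add: field_simps)
          also have "\<dots> \<le> (1 + 8 / k) * exp (k / 8 * \<bar>u\<bar>)"
            using k by (intro mult_left_mono exp_ge_add_one_self) auto
          finally show ?thesis by (intro mult_left_mono power_mono) auto
        qed
        also have "\<dots> = E\<^sup>2 * \<delta>\<^sup>2 * (1 + 8 / k) ^ 4 * exp (k / 2 * \<bar>u\<bar>)"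
          by (simp add: power_mult_distrib flip: exp_of_nat_mult)
        finally have "(ln (f u) - ln (f (c * u + d)))\<^sup>2 * f u
            \<le> E\<^sup>2 * \<delta>\<^sup>2 * (1 + 8 / k) ^ 4 * exp (k / 2 * \<bar>u\<bar>) * (T * exp (- (k * \<bar>u\<bar>)))"
          using f(2)[of u] tail[of u] k by (intro mult_mono) auto
        also have "\<dots> = (E\<^sup>2 * P * \<delta>\<^sup>2) * (exp (k / 2 * \<bar>u\<bar>) * exp (- (k * \<bar>u\<bar>)))"
          by (simp add: P_def)
        also have "exp (k / 2 * \<bar>u\<bar>) * exp (- (k * \<bar>u\<bar>)) = exp (- (k / 2 * \<bar>u\<bar>))"
          by (simp flip: exp_add)
        finally show ?thesis .
      qed
      then have "(\<integral>\<^sup>+u. ennreal ((ln (f u) - ln (f (c * u + d)))\<^sup>2 * f u) \<partial>lborel)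
          \<le> (\<integral>\<^sup>+u. ennreal (E\<^sup>2 * P * \<delta>\<^sup>2) * ennreal (exp (- (k / 2 * \<bar>u\<bar>))) \<partial>lborel)"
        using P by (intro nn_integral_mono) (auto simp flip: ennreal_mult intro!: ennreal_leI)
      also have "\<dots> = ennreal (E\<^sup>2 * P * \<delta>\<^sup>2) * ennreal (2 / (k / 2))"
        using k by (subst nn_integral_cmult) (auto simp only: nn_integral_exp_abs_finite half_gt_zero, auto)
      also have "\<dots> = ennreal (E\<^sup>2 * P * (4 / k) * \<delta>\<^sup>2)"
        using k P by (simp flip: ennreal_mult add: algebra_simps)
      finally show "(\<integral>\<^sup>+u. ennreal ((ln (f u) - ln (f (c * u + d)))\<^sup>2 * f u) \<partial>lborel)
        \<le> ennreal (E\<^sup>2 * P * (4 / k) * (\<bar>c - 1\<bar> + \<bar>d\<bar>)\<^sup>2)" by (simp add: \<delta>_def)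
    qed
  qed
  ultimately show ?thesis using f by (simp add: regular_error_def)
qed

text \<open>The tail is too heavy to pay for polynomial weights. Instead the slope of the
  log-density decays like \<open>1 / \<bar>u\<bar>\<close> and cancels the linear growth of the
  displacement, so the log-ratio is bounded uniformly in \<open>u\<close> by a multiple of
  \<open>\<delta>\<close>.\<close>

lemma regular_error_cauchy: "regular_error cauchy_density"
proof -
  let ?f = cauchy_density
  have pos: "0 < ?f y" for y
    by (simp add: cauchy_density_def add_pos_nonneg)
  have meas[measurable]: "?f \<in> borel_measurable borel"
    unfolding cauchy_density_def[abs_def] by measurable
  have half: "(\<integral>\<^sup>+y. ennreal (?f y) * indicator {0..} y \<partial>lborel) = ennreal (1 / 2)"
  proof -
    have lim: "((\<lambda>x. arctan x / pi) \<longlongrightarrow> (pi / 2) / pi) at_top"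
      by (intro tendsto_intros tendsto_arctan_at_top) auto
    have der: "((\<lambda>y. arctan y / pi) has_real_derivative ?f x) (at x)" for x
      unfolding cauchy_density_def
      by (rule derivative_eq_intros refl)+ (simp_all add: add_nonneg_eq_0_iff divide_inverse mult.commute)
    show ?thesis
      using nn_integral_FTC_atLeast[OF meas der less_imp_le[OF pos] lim, of 0] by simp
  qed
  have "?f (- y) = ?f y" for y by (simp add: cauchy_density_def)
  then have "(\<integral>\<^sup>+y. ennreal (?f y) \<partial>lborel) = ennreal (1 / 2) + ennreal (1 / 2)"
    using half by (subst nn_integral_lborel_halves) (simp_all del: ennreal_half)
  also have "\<dots> = 1" by (simp flip: ennreal_plus del: ennreal_half)
  finally have one: "(\<integral>\<^sup>+y. ennreal (?f y) \<partial>lborel) = 1" .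
  have "\<exists>\<kappa>>0. \<forall>y. \<bar>y\<bar> \<le> b \<longrightarrow> \<kappa> \<le> ?f y" for b
  proof (intro exI[of _ "?f b"] conjI allI impI pos)
    fix y assume "\<bar>y\<bar> \<le> b"
    then have "y\<^sup>2 \<le> b\<^sup>2" using abs_le_square_iff[of y b] by simp
    then show "?f b \<le> ?f y"
      unfolding cauchy_density_def by (intro divide_left_mono mult_left_mono mult_pos_pos add_pos_nonneg) auto
  qed
  moreover have "\<exists>K. \<forall>c d. inverse b \<le> c \<and> c \<le> b \<and> \<bar>d\<bar> \<le> b \<longrightarrow>
        (\<integral>\<^sup>+u. ennreal ((ln (?f u) - ln (?f (c * u + d)))\<^sup>2 * ?f u) \<partial>lborel)
          \<le> ennreal (K * (\<bar>c - 1\<bar> + \<bar>d\<bar>)\<^sup>2)" if b: "1 \<le> b" for b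
  proof -
    \<comment> \<open>With \<open>v = c * u + d\<close>, the constant \<open>E\<close> bounds the
      difference of the squares of \<open>u\<close> and \<open>v\<close> by
      \<open>E * \<delta>\<close> times one plus the square of \<open>u\<close>, and
      \<open>F\<close> bounds one plus the square of \<open>u\<close> by \<open>F\<close> times the
      same for \<open>v\<close>.\<close>
    define E where "E = 2 * (1 + b)"
    define F where "F = 5 * b ^ 4"
    have b4: "1 \<le> b ^ 4" using b by (rule one_le_power)
    have E: "0 \<le> E" using b by (simp add: E_def)
    have F: "1 \<le> F" unfolding F_def using b4 by linarith
    show ?thesis
    proof (intro exI[of _ "(E * F)\<^sup>2"] allI impI)
      fix c d :: real assume cd: "inverse b \<le> c \<and> c \<le> b \<and> \<bar>d\<bar> \<le> b"
      define \<delta> where "\<delta> = \<bar>c - 1\<bar> + \<bar>d\<bar>"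
      have \<delta>: "0 \<le> \<delta>" by (simp add: \<delta>_def)
      have c: "\<bar>c\<bar> \<le> b" "0 < c" using cd b
        by (smt (verit) inverse_nonnegative_iff_nonnegative positive_imp_inverse_positive)+
      have ic: "inverse c \<le> b" using cd b c
        by (metis inverse_inverse_eq inverse_positive_iff_positive le_imp_inverse_le less_le_trans zero_less_one)
      have log: "\<bar>ln (?f u) - ln (?f (c * u + d))\<bar> \<le> E * F * \<delta>" for u
      proof -
        define v where "v = c * u + d"
        have pu: "0 < 1 + u\<^sup>2" and pv: "0 < 1 + v\<^sup>2" by (auto intro: add_pos_nonneg)
        have uv: "\<bar>u - v\<bar> \<le> (1 + \<bar>u\<bar>) * \<delta>"
          unfolding v_def \<delta>_def by (rule abs_affine_diff_le)
        have v: "\<bar>v\<bar> \<le> b * (1 + \<bar>u\<bar>)"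
          unfolding v_def using abs_affine_le[of b c d u] b c cd by auto
        have u2: "(1 + \<bar>u\<bar>)\<^sup>2 \<le> 2 * (1 + u\<^sup>2)"
          using zero_le_power2[of "1 - \<bar>u\<bar>"] by (simp add: power2_eq_square algebra_simps)
        have "\<bar>u\<^sup>2 - v\<^sup>2\<bar> = \<bar>u - v\<bar> * \<bar>u + v\<bar>"
          by (simp add: power2_eq_square algebra_simps flip: abs_mult)
        also have "\<dots> \<le> (1 + \<bar>u\<bar>) * \<delta> * ((1 + b) * (1 + \<bar>u\<bar>))"
        proof (intro mult_mono uv)
          have "\<bar>u + v\<bar> \<le> \<bar>u\<bar> + \<bar>v\<bar>" by (rule abs_triangle_ineq)
          then show "\<bar>u + v\<bar> \<le> (1 + b) * (1 + \<bar>u\<bar>)" using v by (simp add: algebra_simps)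
        qed (use \<delta> in auto)
        also have "\<dots> = (1 + b) * \<delta> * (1 + \<bar>u\<bar>)\<^sup>2" by (simp add: power2_eq_square)
        also have "\<dots> \<le> (1 + b) * \<delta> * (2 * (1 + u\<^sup>2))"
          using \<delta> b u2 by (intro mult_left_mono) auto
        finally have sq: "\<bar>u\<^sup>2 - v\<^sup>2\<bar> \<le> E * \<delta> * (1 + u\<^sup>2)" by (simp add: E_def algebra_simps)
        \<comment> \<open>Comparing the quadratics in the other direction uses the inverse affine
          map; this is where the lower bound on \<open>c\<close> matters.\<close>
        have "\<bar>u\<bar> = \<bar>inverse c * v + inverse c * (- d)\<bar>"
          using c by (simp add: v_def field_simps)
        also have "\<dots> \<le> b * \<bar>v\<bar> + b * \<bar>d\<bar>"
        proof -
          have "\<bar>inverse c * v + inverse c * (- d)\<bar> \<le> inverse c * \<bar>v\<bar> + inverse c * \<bar>d\<bar>"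
            using c abs_triangle_ineq[of "inverse c * v" "inverse c * (- d)"] by (simp add: abs_mult)
          also have "\<dots> \<le> b * \<bar>v\<bar> + b * \<bar>d\<bar>"
            using ic by (intro add_mono mult_right_mono) auto
          finally show ?thesis .
        qed
        also have "\<dots> \<le> b * \<bar>v\<bar> + b * b" using cd b by simp
        finally have "\<bar>u\<bar>\<^sup>2 \<le> (b * \<bar>v\<bar> + b * b)\<^sup>2" by (intro power_mono) auto
        also have "\<dots> \<le> 2 * ((b * \<bar>v\<bar>)\<^sup>2 + (b * b)\<^sup>2)"
          using zero_le_power2[of "b * \<bar>v\<bar> - b * b"] by (simp add: power2_eq_square algebra_simps)
        also have "\<dots> = 2 * b\<^sup>2 * v\<^sup>2 + 2 * b ^ 4"
          by (simp add: power_mult_distrib power4_eq_xxxx power2_eq_square)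
        also have "\<dots> \<le> 2 * b ^ 4 * v\<^sup>2 + 2 * b ^ 4"
          using b by (intro add_mono mult_right_mono mult_left_mono power_increasing) auto
        finally have "u\<^sup>2 \<le> 2 * (b ^ 4 * v\<^sup>2) + 2 * b ^ 4" by (simp add: mult.assoc)
        moreover have "F * (1 + v\<^sup>2) = 5 * b ^ 4 + 5 * (b ^ 4 * v\<^sup>2)" by (simp add: F_def algebra_simps)
        moreover have "0 \<le> b ^ 4 * v\<^sup>2" by simp
        ultimately have uF: "1 + u\<^sup>2 \<le> F * (1 + v\<^sup>2)" using b4 by linarith
        have "ln (1 + v\<^sup>2) - ln (1 + u\<^sup>2) = ln ((1 + v\<^sup>2) / (1 + u\<^sup>2))" using pu pv by (simp add: ln_div)
        also have "\<dots> \<le> (1 + v\<^sup>2) / (1 + u\<^sup>2) - 1" using pu pv by (intro ln_le_minus_one) simp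
        also have "\<dots> \<le> E * \<delta>" using sq pu by (simp add: field_simps)
        also have "\<dots> \<le> E * \<delta> * F" using mult_left_mono[OF F, of "E * \<delta>"] E \<delta> by simp
        finally have 1: "ln (1 + v\<^sup>2) - ln (1 + u\<^sup>2) \<le> E * F * \<delta>" by (simp add: algebra_simps)
        have "ln (1 + u\<^sup>2) - ln (1 + v\<^sup>2) = ln ((1 + u\<^sup>2) / (1 + v\<^sup>2))" using pu pv by (simp add: ln_div)
        also have "\<dots> \<le> (1 + u\<^sup>2) / (1 + v\<^sup>2) - 1" using pu pv by (intro ln_le_minus_one) simp
        also have "\<dots> \<le> E * F * \<delta>"
        proof -
          have "u\<^sup>2 - v\<^sup>2 \<le> E * \<delta> * (1 + u\<^sup>2)" using sq by simp
          also have "\<dots> \<le> E * \<delta> * (F * (1 + v\<^sup>2))" using uF E \<delta> by (intro mult_left_mono) auto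
          finally show ?thesis using pv by (simp add: field_simps)
        qed
        finally have "\<bar>ln (1 + v\<^sup>2) - ln (1 + u\<^sup>2)\<bar> \<le> E * F * \<delta>" using 1 by linarith
        moreover have "ln (?f u) - ln (?f v) = ln (1 + v\<^sup>2) - ln (1 + u\<^sup>2)"
          using pu pv by (simp add: cauchy_density_def ln_div ln_mult)
        ultimately show ?thesis by (simp add: v_def)
      qed
      have "(\<integral>\<^sup>+u. ennreal ((ln (?f u) - ln (?f (c * u + d)))\<^sup>2 * ?f u) \<partial>lborel)
          \<le> (\<integral>\<^sup>+u. ennreal ((E * F * \<delta>)\<^sup>2) * ennreal (?f u) \<partial>lborel)"
      proof (intro nn_integral_mono)
        fix u
        have "(ln (?f u) - ln (?f (c * u + d)))\<^sup>2 \<le> (E * F * \<delta>)\<^sup>2"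
          using log[of u] by (metis abs_ge_zero power2_abs power_mono)
        then show "ennreal ((ln (?f u) - ln (?f (c * u + d)))\<^sup>2 * ?f u)
            \<le> ennreal ((E * F * \<delta>)\<^sup>2) * ennreal (?f u)"
          using pos[of u] by (auto simp flip: ennreal_mult intro!: ennreal_leI mult_right_mono)
      qed
      also have "\<dots> = ennreal ((E * F * \<delta>)\<^sup>2)" by (subst nn_integral_cmult) (auto simp: one)
      finally show "(\<integral>\<^sup>+u. ennreal ((ln (?f u) - ln (?f (c * u + d)))\<^sup>2 * ?f u) \<partial>lborel)
        \<le> ennreal ((E * F)\<^sup>2 * (\<bar>c - 1\<bar> + \<bar>d\<bar>)\<^sup>2)" by (simp add: \<delta>_def power_mult_distrib)
    qed
  qed
  ultimately show ?thesis using pos one by (simp add: regular_error_def)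
qed

section \<open>Error densities built from the check loss\<close>

lemma check_loss_eq: "check_loss \<tau> y = (if 0 \<le> y then \<tau> * y else (1 - \<tau>) * (- y))"
  by (simp add: check_loss_def algebra_simps)

text \<open>The loss is the maximum of two lines whose slopes \<tau> and \<tau> - 1 both have
  modulus below 1.\<close>

lemma check_loss_lipschitz:
  assumes "0 < \<tau>" "\<tau> < 1"
  shows "\<bar>check_loss \<tau> u - check_loss \<tau> v\<bar> \<le> \<bar>u - v\<bar>"
proof -
  have e: "check_loss \<tau> y = max (\<tau> * y) ((\<tau> - 1) * y)" for y
    using assms by (auto simp: check_loss_eq max_def algebra_simps mult_le_0_iff)
  have "\<bar>\<tau> * u - \<tau> * v\<bar> \<le> \<bar>u - v\<bar>" "\<bar>(\<tau> - 1) * u - (\<tau> - 1) * v\<bar> \<le> \<bar>u - v\<bar>"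
    using assms by (auto simp flip: right_diff_distrib simp: abs_mult mult_left_le_one_le)
  then show ?thesis unfolding e by linarith
qed

lemma check_loss_ge:
  assumes "0 < \<tau>" "\<tau> < 1"
  shows "min \<tau> (1 - \<tau>) * \<bar>y\<bar> \<le> check_loss \<tau> y"
proof (cases "0 \<le> y")
  case True
  then show ?thesis by (simp add: check_loss_eq mult_right_mono)
next
  case False
  then have "min \<tau> (1 - \<tau>) * \<bar>y\<bar> \<le> (1 - \<tau>) * \<bar>y\<bar>" by (intro mult_right_mono) auto
  then show ?thesis using False by (simp add: check_loss_eq)
qed

lemma borel_measurable_check_loss[measurable]: "check_loss \<tau> \<in> borel_measurable borel"
  unfolding check_loss_def[abs_def] by measurable

text \<open>Unlike \<open>t powr a * exp (- t)\<close>, which vanishes at \<open>t = 0\<close>, this form is positive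
  everywhere, so that log-likelihoods are defined; for \<open>a = 0\<close> it gives the Laplace case.\<close>

definition gamma_kernel :: "real \<Rightarrow> real \<Rightarrow> real" where
  "gamma_kernel a t = exp (a * ln t - t)"

lemma gamma_kernel_pos: "0 < gamma_kernel a t"
  by (simp add: gamma_kernel_def)

lemma borel_measurable_gamma_kernel[measurable]: "gamma_kernel a \<in> borel_measurable borel"
  unfolding gamma_kernel_def[abs_def] by measurable

lemma gamma_kernel_eq:
  assumes "0 < t"
  shows "gamma_kernel a t = t powr a * exp (- t)"
  using assms by (simp add: gamma_kernel_def powr_def exp_diff exp_minus field_simps)

text \<open>The logarithm lies below its tangent at \<open>2 * a + 1\<close>, and
  \<open>a / (2 * a + 1)\<close> is at most one half, so half of the exponential decay survives.
  Adding 1 to \<open>2 * a\<close> keeps the point of tangency positive for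
  \<open>a = 0\<close>.\<close>

lemma gamma_kernel_le:
  assumes a: "0 \<le> a" and t: "0 \<le> t"
  shows "gamma_kernel a t \<le> exp (a * ln (2 * a + 1)) * exp (- t / 2)"
proof -
  have "a * ln t \<le> a * ln (2 * a + 1) + t / 2"
  \<comment> \<open>The tangent bound needs a positive argument; at 0 the convention
    \<open>ln 0 = 0\<close> makes the left-hand side vanish.\<close>
  proof (cases "t = 0")
    case True
    then show ?thesis using a by simp
  next
    case False
    then have t: "0 < t" using t by simp
    have "ln t - ln (2 * a + 1) = ln (t / (2 * a + 1))" using t a by (simp add: ln_div)
    also have "\<dots> \<le> t / (2 * a + 1) - 1" using t a by (intro ln_le_minus_one) simp
    also have "\<dots> \<le> t / (2 * a + 1)" by simp
    finally have "a * ln t \<le> a * (ln (2 * a + 1) + t / (2 * a + 1))"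
      using a by (intro mult_left_mono) auto
    also have "a * (t / (2 * a + 1)) \<le> t / 2" using a t by (simp add: field_simps)
    then have "a * (ln (2 * a + 1) + t / (2 * a + 1)) \<le> a * ln (2 * a + 1) + t / 2"
      by (simp add: algebra_simps)
    finally show ?thesis .
  qed
  then show ?thesis by (simp add: gamma_kernel_def flip: exp_add)
qed

lemma nn_integral_gamma_kernel:
  assumes a: "0 \<le> a"
  shows "0 < upper_Gamma (a + 1) a"
    and "(\<integral>\<^sup>+t. ennreal (gamma_kernel a t) * indicator {a..} t \<partial>lborel) = ennreal (upper_Gamma (a + 1) a)"
proof -
  let ?g = "\<lambda>t. indicator {a..} t * gamma_kernel a t"
  define C where "C = exp (a * ln (2 * a + 1))"
  have int: "integrable lborel ?g"
  proof (rule integrableI_bounded)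
    have "(\<integral>\<^sup>+t. ennreal (norm (?g t)) \<partial>lborel)
        \<le> (\<integral>\<^sup>+t. ennreal C * ennreal (exp (- (1/2 * \<bar>t\<bar>))) \<partial>lborel)"
    proof (intro nn_integral_mono)
      fix t
      show "ennreal (norm (?g t)) \<le> ennreal C * ennreal (exp (- (1/2 * \<bar>t\<bar>)))"
        using gamma_kernel_le[OF a, of t] gamma_kernel_pos[of a t] a
        by (auto split: split_indicator simp: C_def intro!: ennreal_leI simp flip: ennreal_mult)
    qed
    also have "\<dots> = ennreal C * ennreal (2 / (1/2))"
      by (subst nn_integral_cmult) (auto simp only: nn_integral_exp_abs_finite, auto)
    also have "\<dots> < \<infinity>" by (simp add: ennreal_mult_less_top)
    finally show "(\<integral>\<^sup>+t. ennreal (norm (?g t)) \<partial>lborel) < \<infinity>" .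
  qed measurable
  have nn: "0 \<le> ?g t" for t using gamma_kernel_pos[of a t] by (simp split: split_indicator)
  \<comment> \<open>The integrands differ only at \<open>t = 0\<close>, a point of the domain only
    for \<open>a = 0\<close>, where \<open>0 powr 0 = 0\<close> but the kernel is 1.\<close>
  have up: "upper_Gamma (a + 1) a = (\<integral>t. ?g t \<partial>lborel)"
    unfolding upper_Gamma_def set_lebesgue_integral_def
  proof (intro integral_cong_AE eventually_mono[OF AE_lborel_singleton[of 0]])
    fix t :: real assume "t \<noteq> 0"
    then show "indicator {a..} t *\<^sub>R (t powr (a + 1 - 1) * exp (- t)) = ?g t"
      using a by (auto simp: gamma_kernel_eq split: split_indicator)
  qed measurable
  show "(\<integral>\<^sup>+t. ennreal (gamma_kernel a t) * indicator {a..} t \<partial>lborel) = ennreal (upper_Gamma (a + 1) a)"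
    unfolding up nn_integral_eq_integral[OF int AE_I2[OF nn], symmetric]
    by (intro nn_integral_cong) (auto split: split_indicator)
  \<comment> \<open>As the kernel is positive, a vanishing integral would make the half-line from
    \<open>a\<close> a null set, although it contains an interval of length 1.\<close>
  have "(\<integral>t. ?g t \<partial>lborel) \<noteq> 0"
  proof
    assume "(\<integral>t. ?g t \<partial>lborel) = 0"
    then have "AE t in lborel. ?g t = 0"
      using integral_nonneg_eq_0_iff_AE[OF int AE_I2[OF nn]] by simp
    then have "AE t in lborel. t \<notin> {a..}"
      by eventually_elim (use gamma_kernel_pos in \<open>auto split: split_indicator_asm simp: less_le\<close>)
    then have "emeasure lborel {a..} = 0"
      by (subst (asm) AE_iff_measurable[of "{a..}"]) auto
    moreover have "emeasure lborel {a..a + 1} \<le> emeasure lborel {a..}" by (intro emeasure_mono) auto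
    ultimately show False by simp
  qed
  moreover have "0 \<le> (\<integral>t. ?g t \<partial>lborel)" using nn by (intro integral_nonneg_AE) auto
  ultimately show "0 < upper_Gamma (a + 1) a" by (simp add: up)
qed

lemma upper_Gamma_1_0: "upper_Gamma 1 0 = 1"
proof -
  have "ennreal (upper_Gamma 1 0) = 1"
    using nn_integral_gamma_kernel(2)[of 0] nn_integral_exp_half_line[of 1]
    by (simp add: gamma_kernel_def)
  then show ?thesis by simp
qed

text \<open>An everywhere positive version of \<open>truncated_gamma_density\<close>: the two can
  differ only at \<open>y = 0\<close>, and only if \<open>a = 0\<close>.\<close>

definition check_gamma_density :: "real \<Rightarrow> real \<Rightarrow> real \<Rightarrow> real" where
  "check_gamma_density \<tau> a y =
     \<tau> * (1 - \<tau>) / upper_Gamma (a + 1) a * gamma_kernel a (a + check_loss \<tau> y)"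

text \<open>The shift by \<open>a\<close> keeps the argument of the logarithm at or above
  \<open>a\<close>, so \<open>a * ln\<close> has slope at most 1 there. Hence the log-density is
  Lipschitz as a function of the check loss, which is itself Lipschitz.\<close>

lemma regular_error_check_gamma:
  assumes \<tau>: "0 < \<tau>" "\<tau> < 1" and a: "0 \<le> a"
  shows "regular_error (check_gamma_density \<tau> a)"
proof -
  define f where "f = check_gamma_density \<tau> a"
  define G where "G = upper_Gamma (a + 1) a"
  define c where "c = \<tau> * (1 - \<tau>) / G"
  define m where "m = min \<tau> (1 - \<tau>)"
  have G: "0 < G" using nn_integral_gamma_kernel(1)[OF a] by (simp add: G_def)
  have c: "0 < c" using G \<tau> by (simp add: c_def)
  have f: "f y = c * gamma_kernel a (a + check_loss \<tau> y)" for y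
    by (simp add: f_def check_gamma_density_def c_def G_def)
  have \<rho>: "0 \<le> check_loss \<tau> y" for y using \<tau> by (auto simp: check_loss_eq mult_nonneg_nonpos)
  have meas[measurable]: "f \<in> borel_measurable borel" unfolding f[abs_def] by measurable
  have pos: "0 < f y" for y using c gamma_kernel_pos by (simp add: f)
  \<comment> \<open>Substituting \<open>t = a + s * y\<close> on each half-line, with
    \<open>s\<close> equal to \<tau> on the right and 1 - \<tau> on the left. The total mass is 1
    because \<open>1 / \<tau> + 1 / (1 - \<tau>) = 1 / (\<tau> * (1 - \<tau>))\<close>.\<close>
  have side: "(\<integral>\<^sup>+y. ennreal (c * gamma_kernel a (a + s * y)) * indicator {0..} y \<partial>lborel)
      = ennreal (c * G / s)" if s: "0 < s" for s
  proof -
    have "ennreal G = ennreal \<bar>s\<bar> *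
        (\<integral>\<^sup>+y. ennreal (gamma_kernel a (a + s * y)) * indicator {a..} (a + s * y) \<partial>lborel)"
      unfolding G_def nn_integral_gamma_kernel(2)[OF a, symmetric]
      using s by (intro nn_integral_real_affine) auto
    also have "(\<integral>\<^sup>+y. ennreal (gamma_kernel a (a + s * y)) * indicator {a..} (a + s * y) \<partial>lborel)
        = (\<integral>\<^sup>+y. ennreal (gamma_kernel a (a + s * y)) * indicator {0..} y \<partial>lborel)"
      using s by (intro nn_integral_cong) (auto split: split_indicator simp: zero_le_mult_iff)
    finally have i: "ennreal G = ennreal s * (\<integral>\<^sup>+y. ennreal (gamma_kernel a (a + s * y)) * indicator {0..} y \<partial>lborel)"
      using s by simp
    have "(\<integral>\<^sup>+y. ennreal (c * gamma_kernel a (a + s * y)) * indicator {0..} y \<partial>lborel)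
        = (\<integral>\<^sup>+y. ennreal (c / s) * (ennreal s * (ennreal (gamma_kernel a (a + s * y)) * indicator {0..} y)) \<partial>lborel)"
      using c s gamma_kernel_pos[THEN less_imp_le]
      by (intro nn_integral_cong) (auto split: split_indicator simp flip: ennreal_mult)
    also have "\<dots> = ennreal (c / s) * ennreal G"
      unfolding i by (simp add: nn_integral_cmult)
    also have "\<dots> = ennreal (c * G / s)" using c s G by (simp flip: ennreal_mult)
    finally show ?thesis .
  qed
  have one: "(\<integral>\<^sup>+y. ennreal (f y) \<partial>lborel) = 1"
  proof -
    have "(\<integral>\<^sup>+y. ennreal (f y) * indicator {0..} y \<partial>lborel)
        = (\<integral>\<^sup>+y. ennreal (c * gamma_kernel a (a + \<tau> * y)) * indicator {0..} y \<partial>lborel)"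
      by (intro nn_integral_cong) (auto split: split_indicator simp: f check_loss_eq)
    moreover have "(\<integral>\<^sup>+y. ennreal (f (- y)) * indicator {0..} y \<partial>lborel)
        = (\<integral>\<^sup>+y. ennreal (c * gamma_kernel a (a + (1 - \<tau>) * y)) * indicator {0..} y \<partial>lborel)"
      by (intro nn_integral_cong) (auto split: split_indicator simp: f check_loss_eq)
    ultimately have "(\<integral>\<^sup>+y. ennreal (f y) \<partial>lborel) = ennreal (c * G / \<tau>) + ennreal (c * G / (1 - \<tau>))"
      using side \<tau> by (subst nn_integral_lborel_halves) auto
    also have "\<dots> = ennreal 1"
      using \<tau> G by (subst ennreal_plus[symmetric]) (auto simp: c_def)
    finally show ?thesis by simp
  qed
  \<comment> \<open>One unit of the constant 2 comes from the logarithmic term of the kernel, the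
    other from its linear term.\<close>
  have lip: "\<bar>ln (f u) - ln (f v)\<bar> \<le> 2 * (1 + \<bar>u\<bar> + \<bar>v\<bar>) * \<bar>u - v\<bar>" for u v
  proof -
    define p where "p = a + check_loss \<tau> u"
    define q where "q = a + check_loss \<tau> v"
    have pq: "a \<le> p" "a \<le> q" using \<rho> by (auto simp: p_def q_def)
    have dpq: "\<bar>p - q\<bar> \<le> \<bar>u - v\<bar>" using check_loss_lipschitz[OF \<tau>, of u v] by (simp add: p_def q_def)
    have step: "a * ln x - a * ln y \<le> \<bar>x - y\<bar>" if "a \<le> x" "a \<le> y" for x y
    proof (cases "a = 0")
      case False
      then have p: "0 < a" "0 < x" "0 < y" using a that by auto
      have "a * ln x - a * ln y = a * ln (x / y)" using p by (simp add: ln_div algebra_simps)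
      also have "\<dots> \<le> a * (x / y - 1)" using p by (intro mult_left_mono ln_le_minus_one) auto
      also have "\<dots> = (a / y) * (x - y)" using p by (simp add: field_simps)
      also have "\<dots> \<le> 1 * \<bar>x - y\<bar>" using p that
        by (intro order.trans[OF mult_left_mono[OF abs_ge_self] mult_right_mono]) auto
      finally show ?thesis by simp
    qed simp
    have "\<bar>a * ln p - a * ln q\<bar> \<le> \<bar>p - q\<bar>"
      using step[OF pq] step[OF pq(2) pq(1)] by linarith
    moreover have "ln (f u) - ln (f v) = (a * ln p - a * ln q) - (p - q)"
      using c by (simp add: f ln_mult gamma_kernel_pos) (simp add: gamma_kernel_def p_def q_def)
    moreover have "\<bar>x - y\<bar> \<le> 2 * z" if "\<bar>x\<bar> \<le> \<bar>y\<bar>" "\<bar>y\<bar> \<le> z" for x y z :: real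
      using that by linarith
    ultimately have "\<bar>ln (f u) - ln (f v)\<bar> \<le> 2 * \<bar>u - v\<bar>" using dpq by metis
    also have "\<dots> \<le> 2 * (1 + \<bar>u\<bar> + \<bar>v\<bar>) * \<bar>u - v\<bar>" by (intro mult_right_mono) auto
    finally show ?thesis .
  qed
  have tail: "f y \<le> c * exp (a * ln (2 * a + 1)) * exp (- (m / 2 * \<bar>y\<bar>))" for y
  proof -
    have "f y \<le> c * (exp (a * ln (2 * a + 1)) * exp (- (a + check_loss \<tau> y) / 2))"
      unfolding f using c a \<rho> by (intro mult_left_mono gamma_kernel_le) auto
    also have "\<dots> \<le> c * (exp (a * ln (2 * a + 1)) * exp (- (m / 2 * \<bar>y\<bar>)))"
      using c a check_loss_ge[OF \<tau>, of y] unfolding m_def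
      by (intro mult_left_mono, subst exp_le_cancel_iff) auto
    finally show ?thesis by (simp add: mult.assoc)
  qed
  have "regular_error f"
    by (rule regular_error_exponential_tail[OF meas pos one lip tail]) (use \<tau> in \<open>simp add: m_def\<close>)
  then show ?thesis by (simp add: f_def)
qed

lemma asymmetric_laplace_density_eq: "asymmetric_laplace_density \<tau> = check_gamma_density \<tau> 0"
  by (auto simp: asymmetric_laplace_density_def check_gamma_density_def gamma_kernel_def upper_Gamma_1_0)

lemma truncated_gamma_density_AE:
  assumes \<tau>: "0 < \<tau>" "\<tau> < 1" and a: "0 \<le> a"
  shows "AE y in lborel. truncated_gamma_density \<tau> a y = check_gamma_density \<tau> a y"
proof (intro eventually_mono[OF AE_lborel_singleton[of 0]])
  fix y :: real assume "y \<noteq> 0"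
  then have "0 < min \<tau> (1 - \<tau>) * \<bar>y\<bar>" using \<tau> by simp
  also have "\<dots> \<le> check_loss \<tau> y" by (rule check_loss_ge[OF \<tau>])
  finally show "truncated_gamma_density \<tau> a y = check_gamma_density \<tau> a y"
    using a by (simp add: truncated_gamma_density_def check_gamma_density_def gamma_kernel_eq)
qed

text \<open>The matching condition gives both branches the same constant, so the log-density is
  continuous at 0; its slope is linear on the normal side and constant on the Laplace side.\<close>

lemma regular_error_normal_laplace:
  assumes \<tau>: "0 < \<tau>" "\<tau> < 1" and \<beta>: "0 < \<beta>" and eq: "(1 - \<tau>) / \<beta> = 2 * \<tau> / sqrt (2 * pi)"
  shows "regular_error (normal_laplace_density \<tau> \<beta>)"
proof -
  define c where "c = (1 - \<tau>) / \<beta>"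
  define f where "f = normal_laplace_density \<tau> \<beta>"
  define \<phi> where "\<phi> y = (if y \<le> 0 then y\<^sup>2 / 2 else y / \<beta>)" for y
  have c: "0 < c" using \<tau> \<beta> by (simp add: c_def)
  have f: "f y = c * exp (- \<phi> y)" for y
    using eq by (simp add: f_def normal_laplace_density_def c_def \<phi>_def)
  have meas[measurable]: "f \<in> borel_measurable borel"
    unfolding f_def normal_laplace_density_def[abs_def] by measurable
  have pos: "0 < f y" for y using c by (simp add: f)
  have R: "(\<integral>\<^sup>+y. ennreal (f y) * indicator {0..} y \<partial>lborel) = ennreal (1 - \<tau>)"
  proof -
    have "(\<integral>\<^sup>+y. ennreal (f y) * indicator {0..} y \<partial>lborel)
      = (\<integral>\<^sup>+y. ennreal c * (ennreal (exp (- (1 / \<beta> * y))) * indicator {0..} y) \<partial>lborel)"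
      using c by (intro nn_integral_cong) (auto split: split_indicator simp: f \<phi>_def simp flip: ennreal_mult)
    also have "\<dots> = ennreal c * ennreal (1 / (1 / \<beta>))"
      using \<beta> by (subst nn_integral_cmult) (auto simp only: nn_integral_exp_half_line zero_less_divide_1_iff, auto)
    also have "\<dots> = ennreal (1 - \<tau>)" using \<beta> c by (simp flip: ennreal_mult add: c_def)
    finally show ?thesis .
  qed
  have L: "(\<integral>\<^sup>+y. ennreal (f (- y)) * indicator {0..} y \<partial>lborel) = ennreal \<tau>"
  proof -
    let ?J = "\<integral>\<^sup>+y. ennreal (std_normal_density y) * indicator {0..} y \<partial>lborel"
    have "(\<integral>\<^sup>+y. ennreal (std_normal_density y) \<partial>lborel) = 1"
    proof -
      interpret prob_space "density lborel std_normal_density"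
        by (rule prob_space_normal_density) simp
      show ?thesis using emeasure_space_1 by (simp add: emeasure_density)
    qed
    moreover have "(\<integral>\<^sup>+y. ennreal (std_normal_density y) \<partial>lborel) = ?J + ?J"
      by (subst nn_integral_lborel_halves) (auto simp: std_normal_density_def)
    ultimately have J: "2 * ?J = 1" by (simp add: mult_2)
    have "(\<integral>\<^sup>+y. ennreal (f (- y)) * indicator {0..} y \<partial>lborel)
      = (\<integral>\<^sup>+y. ennreal \<tau> * (2 * (ennreal (std_normal_density y) * indicator {0..} y)) \<partial>lborel)"
    proof (intro nn_integral_cong)
      fix y
      have "f (- y) = \<tau> * (2 * std_normal_density y)" if "0 \<le> y"
        using that unfolding f c_def eq by (simp add: std_normal_density_def \<phi>_def)
      then show "ennreal (f (- y)) * indicator {0..} y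
          = ennreal \<tau> * (2 * (ennreal (std_normal_density y) * indicator {0..} y))"
        using \<tau> by (auto split: split_indicator simp: ennreal_mult)
    qed
    also have "\<dots> = ennreal \<tau> * (2 * ?J)" by (simp add: nn_integral_cmult)
    finally show ?thesis by (simp add: J)
  qed
  have one: "(\<integral>\<^sup>+y. ennreal (f y) \<partial>lborel) = 1"
    using \<tau> by (subst nn_integral_lborel_halves) (auto simp: L R simp flip: ennreal_plus)
  have \<phi>: "\<bar>\<phi> u - \<phi> v\<bar> \<le> (1 + 1 / \<beta>) * (1 + \<bar>u\<bar> + \<bar>v\<bar>) * \<bar>u - v\<bar>" if "u \<le> v" for u v
  proof -
    have sq: "\<bar>x\<^sup>2 / 2 - y\<^sup>2 / 2\<bar> \<le> (\<bar>x\<bar> + \<bar>y\<bar>) * \<bar>x - y\<bar>" for x y :: real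
    proof -
      have "\<bar>x\<^sup>2 / 2 - y\<^sup>2 / 2\<bar> = \<bar>x + y\<bar> / 2 * \<bar>x - y\<bar>"
        by (simp add: power2_eq_square algebra_simps flip: abs_mult diff_divide_distrib)
      also have "\<dots> \<le> (\<bar>x\<bar> + \<bar>y\<bar>) * \<bar>x - y\<bar>" by (intro mult_right_mono) auto
      finally show ?thesis .
    qed
    define d where "d = \<bar>u - v\<bar>"
    have "\<bar>\<phi> u - \<phi> v\<bar> \<le> (\<bar>u\<bar> + \<bar>v\<bar>) * d + 1 / \<beta> * d"
    proof -
      consider "v \<le> 0" | "u \<le> 0" "0 < v" | "0 < u" by linarith
      then show ?thesis
      proof cases
        case 1
        then show ?thesis using sq[of u v] that \<beta> by (simp add: \<phi>_def d_def add_increasing2)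
      next
        \<comment> \<open>With the kink between \<open>u\<close> and \<open>v\<close>, both branches
          are compared with their common value at 0, and \<open>\<bar>u\<bar>\<close> and
          \<open>v\<close> are at most \<open>d\<close>.\<close>
        case 2
        have "\<bar>u\<^sup>2 / 2 - v / \<beta>\<bar> \<le> \<bar>u\<^sup>2 / 2\<bar> + \<bar>v / \<beta>\<bar>" by (rule abs_triangle_ineq4)
        also have "\<dots> = u\<^sup>2 / 2 + 1 / \<beta> * v" using 2 \<beta> by simp
        also have "\<dots> \<le> (\<bar>u\<bar> + \<bar>v\<bar>) * d + 1 / \<beta> * d"
        proof (intro add_mono mult_left_mono)
          have "u\<^sup>2 / 2 \<le> \<bar>u\<bar> * \<bar>u\<bar>" by (simp add: power2_eq_square)
          also have "\<dots> \<le> (\<bar>u\<bar> + \<bar>v\<bar>) * d" using 2 by (intro mult_mono) (auto simp: d_def)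
          finally show "u\<^sup>2 / 2 \<le> (\<bar>u\<bar> + \<bar>v\<bar>) * d" .
        qed (use 2 \<beta> in \<open>auto simp: d_def\<close>)
        finally show ?thesis using 2 by (simp add: \<phi>_def)
      next
        case 3
        have "\<bar>u / \<beta> - v / \<beta>\<bar> = 1 / \<beta> * d"
          using \<beta> by (simp add: d_def abs_divide flip: diff_divide_distrib)
        then show ?thesis using 3 that by (simp add: \<phi>_def d_def)
      qed
    qed
    also have "\<dots> \<le> (1 + 1 / \<beta>) * (1 + \<bar>u\<bar> + \<bar>v\<bar>) * d"
    proof -
      have "(\<bar>u\<bar> + \<bar>v\<bar>) + 1 / \<beta> \<le> (1 + 1 / \<beta>) * (1 + \<bar>u\<bar> + \<bar>v\<bar>)"
        using \<beta> by (simp add: algebra_simps)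
      from mult_right_mono[OF this, of d] show ?thesis by (simp add: d_def algebra_simps)
    qed
    finally show ?thesis by (simp add: d_def)
  qed
  have lip: "\<bar>ln (f u) - ln (f v)\<bar> \<le> (1 + 1 / \<beta>) * (1 + \<bar>u\<bar> + \<bar>v\<bar>) * \<bar>u - v\<bar>" for u v
  proof -
    have "\<bar>ln (f u) - ln (f v)\<bar> = \<bar>\<phi> u - \<phi> v\<bar>" using c by (simp add: f ln_mult)
    also have "\<dots> \<le> (1 + 1 / \<beta>) * (1 + \<bar>u\<bar> + \<bar>v\<bar>) * \<bar>u - v\<bar>"
      using \<phi>[of u v] \<phi>[of v u] by (cases "u \<le> v") (auto simp: abs_minus_commute algebra_simps)
    finally show ?thesis .
  qed
  \<comment> \<open>A Gaussian exponent dominates a linear one up to 1 / 2, by completing the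
    square; this is the origin of the factor \<open>exp (1 / 2)\<close>.\<close>
  have tail: "f y \<le> c * exp (1 / 2) * exp (- (min 1 (1 / \<beta>) * \<bar>y\<bar>))" for y
  proof -
    have "min 1 (1 / \<beta>) * \<bar>y\<bar> \<le> \<phi> y + 1 / 2"
    proof (cases "y \<le> 0")
      case True
      have "min 1 (1 / \<beta>) * \<bar>y\<bar> \<le> 1 * \<bar>y\<bar>" by (intro mult_right_mono) auto
      also have "\<dots> \<le> y\<^sup>2 / 2 + 1 / 2" using True zero_le_power2[of "y + 1"]
        by (simp add: power2_eq_square algebra_simps)
      finally show ?thesis using True by (simp add: \<phi>_def)
    next
      case False
      have "min 1 (1 / \<beta>) * \<bar>y\<bar> \<le> 1 / \<beta> * \<bar>y\<bar>" by (intro mult_right_mono) auto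
      also have "\<dots> \<le> \<phi> y + 1 / 2" using False by (simp add: \<phi>_def)
      finally show ?thesis .
    qed
    then have "exp (- \<phi> y) \<le> exp (1 / 2) * exp (- (min 1 (1 / \<beta>) * \<bar>y\<bar>))"
      unfolding exp_add[symmetric] by (subst exp_le_cancel_iff) linarith
    then show ?thesis using c unfolding f mult.assoc by (intro mult_left_mono) auto
  qed
  have "regular_error f"
    by (rule regular_error_exponential_tail[OF meas pos one lip tail]) (use \<beta> in simp)
  then show ?thesis by (simp add: f_def)
qed

section \<open>Location-scale families\<close>

definition scaled_density :: "(real \<Rightarrow> real) \<Rightarrow> real \<Rightarrow> real \<Rightarrow> real \<Rightarrow> real" where
  "scaled_density f m s y = f ((y - m) / s) / s"

lemma scaled_density_affine: "s \<noteq> 0 \<Longrightarrow> scaled_density f m s (m + s * u) = f u / s"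
  by (simp add: scaled_density_def)

lemma nn_integral_scaled_density:
  assumes [measurable]: "f \<in> borel_measurable borel" "g \<in> borel_measurable borel"
    and f: "\<And>u. 0 \<le> f u" and s: "0 < s"
  shows "(\<integral>\<^sup>+y. ennreal (scaled_density f m s y) * g y \<partial>lborel)
    = (\<integral>\<^sup>+u. ennreal (f u) * g (m + s * u) \<partial>lborel)"
proof -
  have "(\<integral>\<^sup>+y. ennreal (scaled_density f m s y) * g y \<partial>lborel)
      = ennreal \<bar>s\<bar> * (\<integral>\<^sup>+u. ennreal (scaled_density f m s (m + s * u)) * g (m + s * u) \<partial>lborel)"
    using s by (intro nn_integral_real_affine) (auto simp: scaled_density_def[abs_def])
  also have "\<dots> = (\<integral>\<^sup>+u. ennreal s * (ennreal (f u / s) * g (m + s * u)) \<partial>lborel)"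
    using s by (subst nn_integral_cmult[symmetric]) (auto simp: scaled_density_affine)
  also have "\<dots> = (\<integral>\<^sup>+u. ennreal (f u) * g (m + s * u) \<partial>lborel)"
    using s f by (intro nn_integral_cong) (simp add: mult.assoc[symmetric] flip: ennreal_mult)
  finally show ?thesis .
qed

lemma square_sum_le: "(a + b)\<^sup>2 \<le> 2 * a\<^sup>2 + 2 * b\<^sup>2" for a b :: real
  using zero_le_power2[of "a - b"] by (simp add: power2_eq_square algebra_simps)

text \<open>After the substitution \<open>y = m + s * u\<close> the second density is evaluated at
  \<open>c * u + d\<close> with \<open>c = s / s'\<close> and \<open>d = (m - m') / s'\<close>, the
  situation of \<open>regular_error\<close>. The normalizing factors of the two densities contribute
  the term \<open>e = ln s' - ln s\<close>.\<close>

lemma log_density_L2_bound: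
  assumes f: "regular_error f" and \<sigma>bar: "1 < \<sigma>bar" and B: "0 \<le> B"
  obtains K where "0 \<le> K"
    "\<And>m m' s s'. \<bar>m\<bar> \<le> B \<Longrightarrow> \<bar>m'\<bar> \<le> B \<Longrightarrow> inverse \<sigma>bar \<le> s \<Longrightarrow> s \<le> \<sigma>bar \<Longrightarrow>
      inverse \<sigma>bar \<le> s' \<Longrightarrow> s' \<le> \<sigma>bar \<Longrightarrow>
      (\<integral>\<^sup>+y. ennreal (scaled_density f m s y)
          * ennreal ((ln (scaled_density f m s y) - ln (scaled_density f m' s' y))\<^sup>2) \<partial>lborel)
        \<le> ennreal (K * ((m - m')\<^sup>2 + (s - s')\<^sup>2))"
proof -
  \<comment> \<open>Large enough for both coefficients: \<open>c\<close> and its inverse are at most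
    \<open>\<sigma>bar * \<sigma>bar\<close>, and \<open>\<bar>d\<bar>\<close> is at most
    \<open>2 * B * \<sigma>bar\<close>.\<close>
  define b where "b = \<sigma>bar * \<sigma>bar + 2 * B * \<sigma>bar"
  have sb: "0 < \<sigma>bar" "1 \<le> \<sigma>bar * \<sigma>bar" using \<sigma>bar by (auto intro: order.strict_implies_order less_1_mult)
  have b: "1 \<le> b" using sb B by (simp add: b_def add_increasing2)
  from f b obtain K0 where K0: "\<And>c d. inverse b \<le> c \<Longrightarrow> c \<le> b \<Longrightarrow> \<bar>d\<bar> \<le> b \<Longrightarrow>
        (\<integral>\<^sup>+u. ennreal ((ln (f u) - ln (f (c * u + d)))\<^sup>2 * f u) \<partial>lborel)
          \<le> ennreal (K0 * (\<bar>c - 1\<bar> + \<bar>d\<bar>)\<^sup>2)"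
    unfolding regular_error_def by blast
  \<comment> \<open>\<open>regular_error\<close> leaves the sign of its constant open, since
    \<open>ennreal\<close> sends negative numbers to 0.\<close>
  define K where "K = \<bar>K0\<bar>"
  have meas[measurable]: "f \<in> borel_measurable borel" and pos: "\<And>u. 0 < f u"
    and one: "(\<integral>\<^sup>+y. ennreal (f y) \<partial>lborel) = 1"
    using f by (auto simp: regular_error_def)
  show thesis
  \<comment> \<open>Splitting off \<open>e\<close> gives a factor 2, squaring the sum of
    \<open>\<bar>c - 1\<bar>\<close> and \<open>\<bar>d\<bar>\<close> another 2 in the term with
    \<open>K\<close>; the powers of \<open>\<sigma>bar\<close> come from division by scales.\<close>
  proof (rule that[of "(4 * K + 2) * \<sigma>bar\<^sup>2"])
    show "0 \<le> (4 * K + 2) * \<sigma>bar\<^sup>2" by (simp add: K_def)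
    fix m m' s s' :: real
    assume m: "\<bar>m\<bar> \<le> B" "\<bar>m'\<bar> \<le> B" and s: "inverse \<sigma>bar \<le> s" "s \<le> \<sigma>bar" "inverse \<sigma>bar \<le> s'" "s' \<le> \<sigma>bar"
    have sp: "0 < s" "0 < s'" using s sb by (auto intro: less_le_trans positive_imp_inverse_positive)
    have inv: "inverse s \<le> \<sigma>bar" "inverse s' \<le> \<sigma>bar"
      using s sp sb by (metis inverse_inverse_eq inverse_positive_iff_positive le_imp_inverse_le)+
    define c where "c = s / s'"
    define d where "d = (m - m') / s'"
    define e where "e = ln s' - ln s"
    have c1: "\<bar>c - 1\<bar> \<le> \<sigma>bar * \<bar>s - s'\<bar>"
    proof -
      have "\<bar>c - 1\<bar> = inverse s' * \<bar>s - s'\<bar>" using sp by (simp add: c_def field_simps abs_divide flip: abs_mult_pos)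
      then show ?thesis using inv by (simp add: mult_right_mono)
    qed
    have d1: "\<bar>d\<bar> \<le> \<sigma>bar * \<bar>m - m'\<bar>"
    proof -
      have "\<bar>d\<bar> = inverse s' * \<bar>m - m'\<bar>" using sp by (simp add: d_def field_simps)
      then show ?thesis using inv by (simp add: mult_right_mono)
    qed
    have lnle: "ln x - ln y \<le> \<sigma>bar * \<bar>x - y\<bar>" if "0 < x" "0 < y" "inverse y \<le> \<sigma>bar" for x y
    proof -
      have "ln x - ln y \<le> x / y - 1" using that ln_le_minus_one[of "x / y"] by (simp add: ln_div)
      also have "\<dots> = inverse y * (x - y)" using that by (simp add: field_simps)
      also have "\<dots> \<le> \<sigma>bar * \<bar>x - y\<bar>" using that sb
        by (intro order.trans[OF mult_left_mono[OF abs_ge_self] mult_right_mono]) auto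
      finally show ?thesis .
    qed
    have "\<bar>e\<bar> \<le> \<sigma>bar * \<bar>s - s'\<bar>"
      using lnle[OF sp inv(2)] lnle[OF sp(2,1) inv(1)] unfolding e_def abs_le_iff
      by (simp add: abs_minus_commute)
    then have e2: "e\<^sup>2 \<le> \<sigma>bar\<^sup>2 * (s - s')\<^sup>2"
      by (metis abs_ge_zero power2_abs power_mono power_mult_distrib)
    have cb: "inverse b \<le> c" "c \<le> b"
    proof -
      have "c \<le> \<sigma>bar * \<sigma>bar"
        using s sp inv sb unfolding c_def divide_inverse by (intro mult_mono) auto
      then show "c \<le> b" using B sb by (simp add: b_def add_increasing2)
      have "inverse c = s' * inverse s" using sp by (simp add: c_def divide_inverse)
      also have "\<dots> \<le> \<sigma>bar * \<sigma>bar" using s sp inv sb by (intro mult_mono) auto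
      finally have "inverse c \<le> b" using B sb by (simp add: b_def add_increasing2)
      then show "inverse b \<le> c"
        using sp b by (metis c_def divide_pos_pos inverse_inverse_eq inverse_positive_iff_positive le_imp_inverse_le)
    qed
    have db: "\<bar>d\<bar> \<le> b"
    proof -
      have "\<bar>d\<bar> \<le> \<sigma>bar * \<bar>m - m'\<bar>" by (rule d1)
      also have "\<dots> \<le> \<sigma>bar * (2 * B)" using m sb by (intro mult_left_mono) auto
      finally show ?thesis using sb by (simp add: b_def mult.commute mult.left_commute)
    qed
    have pw: "(ln (scaled_density f m s (m + s * u)) - ln (scaled_density f m' s' (m + s * u)))\<^sup>2
        \<le> 2 * (ln (f u) - ln (f (c * u + d)))\<^sup>2 + 2 * e\<^sup>2" for u
    proof -
      have arg: "(m + s * u - m') / s' = c * u + d" using sp by (simp add: c_def d_def field_simps)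
      have "ln (scaled_density f m s (m + s * u)) - ln (scaled_density f m' s' (m + s * u))
          = (ln (f u) - ln (f (c * u + d))) + e"
        using sp pos[of u] pos[of "c * u + d"] by (simp add: scaled_density_def arg ln_div e_def)
      then show ?thesis using square_sum_le by simp
    qed
    have "(\<integral>\<^sup>+y. ennreal (scaled_density f m s y)
          * ennreal ((ln (scaled_density f m s y) - ln (scaled_density f m' s' y))\<^sup>2) \<partial>lborel)
      = (\<integral>\<^sup>+u. ennreal (f u) * ennreal ((ln (scaled_density f m s (m + s * u))
          - ln (scaled_density f m' s' (m + s * u)))\<^sup>2) \<partial>lborel)"
      using sp pos by (intro nn_integral_scaled_density) (auto simp: scaled_density_def[abs_def] less_imp_le)
    also have "\<dots> \<le> (\<integral>\<^sup>+u. 2 * ennreal ((ln (f u) - ln (f (c * u + d)))\<^sup>2 * f u)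
        + ennreal (2 * e\<^sup>2) * ennreal (f u) \<partial>lborel)"
    proof (intro nn_integral_mono)
      fix u
      have "f u * (ln (scaled_density f m s (m + s * u)) - ln (scaled_density f m' s' (m + s * u)))\<^sup>2
        \<le> f u * (2 * (ln (f u) - ln (f (c * u + d)))\<^sup>2 + 2 * e\<^sup>2)"
        using pos[of u] pw by (intro mult_left_mono) auto
      also have "\<dots> = 2 * ((ln (f u) - ln (f (c * u + d)))\<^sup>2 * f u) + 2 * e\<^sup>2 * f u"
        by (simp add: algebra_simps)
      finally have "ennreal (f u * (ln (scaled_density f m s (m + s * u)) - ln (scaled_density f m' s' (m + s * u)))\<^sup>2)
        \<le> ennreal (2 * ((ln (f u) - ln (f (c * u + d)))\<^sup>2 * f u) + 2 * e\<^sup>2 * f u)" by (rule ennreal_leI)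
      also have "\<dots> = 2 * ennreal ((ln (f u) - ln (f (c * u + d)))\<^sup>2 * f u)
        + ennreal (2 * e\<^sup>2) * ennreal (f u)"
        using pos[of u] by (subst ennreal_plus) (auto simp: ennreal_mult')
      finally show "ennreal (f u) * ennreal ((ln (scaled_density f m s (m + s * u))
          - ln (scaled_density f m' s' (m + s * u)))\<^sup>2)
        \<le> 2 * ennreal ((ln (f u) - ln (f (c * u + d)))\<^sup>2 * f u) + ennreal (2 * e\<^sup>2) * ennreal (f u)"
        using pos[of u] by (simp add: ennreal_mult)
    qed
    also have "\<dots> = 2 * (\<integral>\<^sup>+u. ennreal ((ln (f u) - ln (f (c * u + d)))\<^sup>2 * f u) \<partial>lborel) + ennreal (2 * e\<^sup>2)"
      by (subst nn_integral_add) (auto simp: nn_integral_cmult one)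
    also have "\<dots> \<le> 2 * ennreal (K * (\<bar>c - 1\<bar> + \<bar>d\<bar>)\<^sup>2) + ennreal (2 * e\<^sup>2)"
      by (intro add_mono mult_left_mono order.trans[OF K0[OF cb db]] ennreal_leI mult_right_mono)
         (auto simp: K_def)
    also have "\<dots> = ennreal (2 * (K * (\<bar>c - 1\<bar> + \<bar>d\<bar>)\<^sup>2) + 2 * e\<^sup>2)"
      by (subst ennreal_plus) (auto simp: K_def ennreal_mult')
    also have "\<dots> \<le> ennreal ((4 * K + 2) * \<sigma>bar\<^sup>2 * ((m - m')\<^sup>2 + (s - s')\<^sup>2))"
    proof (intro ennreal_leI)
      have "(\<bar>c - 1\<bar> + \<bar>d\<bar>)\<^sup>2 \<le> (\<sigma>bar * \<bar>s - s'\<bar> + \<sigma>bar * \<bar>m - m'\<bar>)\<^sup>2"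
        using c1 d1 by (intro power_mono) auto
      also have "\<dots> \<le> 2 * (\<sigma>bar * \<bar>s - s'\<bar>)\<^sup>2 + 2 * (\<sigma>bar * \<bar>m - m'\<bar>)\<^sup>2" by (rule square_sum_le)
      also have "\<dots> = 2 * \<sigma>bar\<^sup>2 * ((m - m')\<^sup>2 + (s - s')\<^sup>2)" by (simp add: power_mult_distrib algebra_simps)
      finally have "2 * (K * (\<bar>c - 1\<bar> + \<bar>d\<bar>)\<^sup>2) \<le> 2 * (K * (2 * \<sigma>bar\<^sup>2 * ((m - m')\<^sup>2 + (s - s')\<^sup>2)))"
        by (intro mult_left_mono) (auto simp: K_def)
      moreover have "2 * e\<^sup>2 \<le> 2 * (\<sigma>bar\<^sup>2 * ((m - m')\<^sup>2 + (s - s')\<^sup>2))"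
        using e2 by (intro mult_left_mono) (auto simp: algebra_simps add_increasing)
      ultimately show "2 * (K * (\<bar>c - 1\<bar> + \<bar>d\<bar>)\<^sup>2) + 2 * e\<^sup>2
          \<le> (4 * K + 2) * \<sigma>bar\<^sup>2 * ((m - m')\<^sup>2 + (s - s')\<^sup>2)" by (simp add: algebra_simps)
    qed
    finally show "(\<integral>\<^sup>+y. ennreal (scaled_density f m s y)
          * ennreal ((ln (scaled_density f m s y) - ln (scaled_density f m' s' y))\<^sup>2) \<partial>lborel)
        \<le> ennreal ((4 * K + 2) * \<sigma>bar\<^sup>2 * ((m - m')\<^sup>2 + (s - s')\<^sup>2))" .
  qed
qed

text \<open>Write \<open>p - q\<close> as the product of the difference and the sum of the square
  roots and apply the Cauchy-Schwarz inequality; the squared sum has integral at most 4, whence the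
  divisor.\<close>

lemma hellinger_ge_event_difference:
  fixes p q :: "'b \<Rightarrow> real"
  assumes p: "integrable M p" "\<And>y. 0 \<le> p y" "(\<integral>y. p y \<partial>M) = 1"
    and q: "integrable M q" "\<And>y. 0 \<le> q y" "(\<integral>y. q y \<partial>M) = 1"
    and E: "E \<in> sets M"
  shows "ennreal (((\<integral>y. p y * indicator E y \<partial>M) - (\<integral>y. q y * indicator E y \<partial>M))\<^sup>2 / 4)
    \<le> (\<integral>\<^sup>+y. ennreal ((sqrt (p y) - sqrt (q y))\<^sup>2) \<partial>M)"
proof -
  define d where "d = \<bar>(\<integral>y. p y * indicator E y \<partial>M) - (\<integral>y. q y * indicator E y \<partial>M)\<bar>"
  let ?h = "\<lambda>y. (sqrt (p y) - sqrt (q y))\<^sup>2"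
  have hle: "?h y \<le> p y + q y" for y
    using p(2)[of y] q(2)[of y] by (simp add: power2_diff)
  have pm: "p \<in> borel_measurable M" and qm: "q \<in> borel_measurable M" using p q by auto
  note pm[measurable] qm[measurable]
  have hi: "integrable M ?h"
    by (rule Bochner_Integration.integrable_bound[where f="\<lambda>y. p y + q y"])
       (use p q hle in \<open>auto intro!: AE_I2\<close>)
  have "d\<^sup>2 / 4 \<le> (\<integral>y. ?h y \<partial>M)"
  proof (cases "d = 0")
    case True
    then show ?thesis by (simp add: integral_nonneg_AE)
  next
    case False
    then have d: "0 < d" by (simp add: d_def)
    have "d = \<bar>\<integral>y. p y * indicator E y - q y * indicator E y \<partial>M\<bar>"
      unfolding d_def using p q E by (subst Bochner_Integration.integral_diff) (auto intro!: integrable_real_mult_indicator)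
    also have "\<dots> \<le> (\<integral>y. \<bar>p y * indicator E y - q y * indicator E y\<bar> \<partial>M)" by (rule integral_abs_bound)
    also have "\<dots> \<le> (\<integral>y. 2 / d * ?h y + d / 4 * (p y + q y) \<partial>M)"
    proof (rule integral_mono)
      fix y
      define a where "a = sqrt (p y) - sqrt (q y)"
      define b where "b = sqrt (p y) + sqrt (q y)"
      have "\<bar>p y * indicator E y - q y * indicator E y\<bar> \<le> \<bar>p y - q y\<bar>" by (auto split: split_indicator)
      also have "p y - q y = a * b"
        using p(2)[of y] q(2)[of y] by (simp add: a_def b_def algebra_simps)
      \<comment> \<open>Cauchy-Schwarz in pointwise form, with the weight tuned to \<open>d\<close>:
        after integration the second term is at most \<open>d / 2\<close>, half of what has to be
        bounded.\<close>
      also have "\<bar>a * b\<bar> \<le> 2 / d * a\<^sup>2 + d / 8 * b\<^sup>2"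
      proof -
        have "0 \<le> (4 * \<bar>a\<bar> - d * \<bar>b\<bar>)\<^sup>2" by simp
        then have "8 * d * \<bar>a * b\<bar> \<le> 16 * a\<^sup>2 + d\<^sup>2 * b\<^sup>2"
          by (simp add: power2_eq_square algebra_simps abs_mult flip: abs_mult)
        then show ?thesis using d by (simp add: field_simps power2_eq_square)
      qed
      also have "\<dots> \<le> 2 / d * a\<^sup>2 + d / 8 * (2 * (p y + q y))"
      proof (intro add_left_mono mult_left_mono)
        show "b\<^sup>2 \<le> 2 * (p y + q y)"
          using square_sum_le[of "sqrt (p y)" "sqrt (q y)"] p(2)[of y] q(2)[of y] by (simp add: b_def)
      qed (use d in auto)
      finally show "\<bar>p y * indicator E y - q y * indicator E y\<bar> \<le> 2 / d * ?h y + d / 4 * (p y + q y)"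
        by (simp add: a_def field_simps)
    qed (use p q hi E in \<open>auto intro!: integrable_real_mult_indicator Bochner_Integration.integrable_diff\<close>)
    also have "\<dots> = 2 / d * (\<integral>y. ?h y \<partial>M) + d / 2" using p q hi by simp
    finally show ?thesis using d by (simp add: field_simps power2_eq_square)
  qed
  then show ?thesis
    using nn_integral_eq_integral[OF hi] by (simp add: d_def ennreal_leI)
qed

text \<open>The probability of the half-line below \<open>m\<close> is \<open>F 0\<close> under the first density and
  \<open>F ((m - m') / s')\<close> under the second, and \<open>F\<close> has slope bounded below.\<close>

lemma hellinger_location_bound:
  assumes f: "regular_error f" and \<sigma>bar: "1 < \<sigma>bar" and B: "0 \<le> B"
  obtains k where "0 < k"
    "\<And>m m' s s'. \<bar>m\<bar> \<le> B \<Longrightarrow> \<bar>m'\<bar> \<le> B \<Longrightarrow> inverse \<sigma>bar \<le> s \<Longrightarrow> s \<le> \<sigma>bar \<Longrightarrow>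
      inverse \<sigma>bar \<le> s' \<Longrightarrow> s' \<le> \<sigma>bar \<Longrightarrow>
      ennreal (k * (m - m')\<^sup>2)
        \<le> (\<integral>\<^sup>+y. ennreal ((sqrt (scaled_density f m s y) - sqrt (scaled_density f m' s' y))\<^sup>2) \<partial>lborel)"
proof -
  have sb: "0 < \<sigma>bar" using \<sigma>bar by simp
  have meas[measurable]: "f \<in> borel_measurable borel" and pos: "\<And>u. 0 < f u"
    and one: "(\<integral>\<^sup>+y. ennreal (f y) \<partial>lborel) = 1"
    using f by (auto simp: regular_error_def)
  \<comment> \<open>The radius is chosen so that the interval contains 0 and every possible value of
    \<open>(m - m') / s'\<close>.\<close>
  from f obtain \<kappa> where \<kappa>: "0 < \<kappa>" "\<And>y. \<bar>y\<bar> \<le> 2 * B * \<sigma>bar \<Longrightarrow> \<kappa> \<le> f y"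
    unfolding regular_error_def by blast
  have fi: "integrable lborel f"
    using one pos by (intro integrableI_nn_integral_finite[where x=1]) (auto simp: less_imp_le)
  have f1: "(\<integral>u. f u \<partial>lborel) = 1"
    using nn_integral_eq_integral[OF fi] one pos by (auto simp: less_imp_le)
  define F where "F t = (\<integral>u. f u * indicator {..t} u \<partial>lborel)" for t
  have Fi: "integrable lborel (\<lambda>u. f u * indicator A u)" if "A \<in> sets borel" for A
    using fi that by (intro integrable_real_mult_indicator) auto
  have Fdiff: "\<kappa> * (t - t') \<le> F t - F t'" if t: "t' \<le> t" "\<bar>t\<bar> \<le> 2 * B * \<sigma>bar" "\<bar>t'\<bar> \<le> 2 * B * \<sigma>bar" for t t'
  proof -
    have "\<kappa> * (t - t') = (\<integral>u. \<kappa> * indicator {t'<..t} u \<partial>lborel)" using t by simp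
    also have "\<dots> \<le> (\<integral>u. f u * indicator {..t} u - f u * indicator {..t'} u \<partial>lborel)"
    proof (rule integral_mono)
      fix u
      show "\<kappa> * indicator {t'<..t} u \<le> f u * indicator {..t} u - f u * indicator {..t'} u"
        using \<kappa>(2)[of u] t by (auto split: split_indicator)
      show "integrable lborel (\<lambda>u. \<kappa> * indicator {t'<..t} u)"
        by (cases "t' \<le> t") (auto intro!: integrable_mult_right integrable_real_indicator)
    qed (use Fi in auto)
    also have "\<dots> = F t - F t'" unfolding F_def using Fi by simp
    finally show ?thesis .
  qed
  show thesis
  \<comment> \<open>The slope of \<open>F\<close> is at least \<open>\<kappa>\<close>, division by
    \<open>s'\<close> costs at most \<open>\<sigma>bar\<close>, and the quarter comes from
    \<open>hellinger_ge_event_difference\<close>.\<close>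
  proof (rule that[of "(\<kappa> / \<sigma>bar)\<^sup>2 / 4"])
    show "0 < (\<kappa> / \<sigma>bar)\<^sup>2 / 4" using \<kappa> sb by simp
    fix m m' s s' :: real
    assume m: "\<bar>m\<bar> \<le> B" "\<bar>m'\<bar> \<le> B" and s: "inverse \<sigma>bar \<le> s" "s \<le> \<sigma>bar" "inverse \<sigma>bar \<le> s'" "s' \<le> \<sigma>bar"
    have sp: "0 < s" "0 < s'" using s sb by (auto intro: less_le_trans positive_imp_inverse_positive)
    have inv: "inverse s' \<le> \<sigma>bar"
      using s sp sb by (metis inverse_inverse_eq inverse_positive_iff_positive le_imp_inverse_le)
    have dens: "integrable lborel (scaled_density f n r)" "(\<integral>y. scaled_density f n r y \<partial>lborel) = 1"
      "(\<integral>y. scaled_density f n r y * indicator {..t} y \<partial>lborel) = F ((t - n) / r)" if r: "0 < r" for n r t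
    proof -
      have "scaled_density f n r = (\<lambda>y. f (- n / r + (1 / r) * y) / r)"
        by (auto simp: scaled_density_def diff_divide_distrib)
      then show "integrable lborel (scaled_density f n r)"
        using lborel_integrable_real_affine[OF fi, of "1 / r" "- n / r"] r by simp
      have "(\<integral>y. scaled_density f n r y \<partial>lborel) = \<bar>r\<bar> *\<^sub>R (\<integral>u. scaled_density f n r (n + r * u) \<partial>lborel)"
        using r by (intro lborel_integral_real_affine) auto
      then show "(\<integral>y. scaled_density f n r y \<partial>lborel) = 1"
        using r f1 by (simp add: scaled_density_affine)
      have "(\<integral>y. scaled_density f n r y * indicator {..t} y \<partial>lborel)
          = \<bar>r\<bar> *\<^sub>R (\<integral>u. scaled_density f n r (n + r * u) * indicator {..t} (n + r * u) \<partial>lborel)"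
        using r by (intro lborel_integral_real_affine) auto
      also have "\<dots> = (\<integral>u. r * (scaled_density f n r (n + r * u) * indicator {..t} (n + r * u)) \<partial>lborel)"
        using r by simp
      also have "\<dots> = F ((t - n) / r)"
      proof -
        have "indicator {..t} (n + r * u) = (indicator {..(t - n) / r} u :: real)" for u
          using r by (auto simp: pos_le_divide_eq algebra_simps split: split_indicator)
        then show ?thesis unfolding F_def using r by (simp add: scaled_density_affine)
      qed
      finally show "(\<integral>y. scaled_density f n r y * indicator {..t} y \<partial>lborel) = F ((t - n) / r)" .
    qed
    define d where "d = (m - m') / s'"
    have db: "\<bar>d\<bar> \<le> 2 * B * \<sigma>bar"
    proof -
      have "\<bar>d\<bar> = \<bar>m - m'\<bar> * inverse s'" using sp by (simp add: d_def field_simps)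
      also have "\<dots> \<le> (2 * B) * \<sigma>bar" using m inv sp B by (intro mult_mono) auto
      finally show ?thesis .
    qed
    have d1: "\<bar>m - m'\<bar> / \<sigma>bar \<le> \<bar>d\<bar>"
      using s sp by (simp add: d_def divide_left_mono)
    have "\<kappa> * \<bar>d\<bar> \<le> \<bar>F 0 - F d\<bar>"
      using Fdiff[of 0 d] Fdiff[of d 0] db by (cases "0 \<le> d") auto
    then have "(\<kappa> / \<sigma>bar) * \<bar>m - m'\<bar> \<le> \<bar>F 0 - F d\<bar>"
      using mult_left_mono[OF d1, of \<kappa>] \<kappa> by (simp add: field_simps)
    then have "((\<kappa> / \<sigma>bar) * \<bar>m - m'\<bar>)\<^sup>2 \<le> \<bar>F 0 - F d\<bar>\<^sup>2"
      using \<kappa> sb by (intro power_mono) auto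
    then have "(\<kappa> / \<sigma>bar)\<^sup>2 / 4 * (m - m')\<^sup>2 \<le> (F 0 - F d)\<^sup>2 / 4"
      by (simp add: power_mult_distrib power_divide)
    then have "ennreal ((\<kappa> / \<sigma>bar)\<^sup>2 / 4 * (m - m')\<^sup>2) \<le> ennreal ((F 0 - F d)\<^sup>2 / 4)" by (rule ennreal_leI)
    also have "\<dots> \<le> (\<integral>\<^sup>+y. ennreal ((sqrt (scaled_density f m s y) - sqrt (scaled_density f m' s' y))\<^sup>2) \<partial>lborel)"
      using hellinger_ge_event_difference[of lborel "scaled_density f m s" "scaled_density f m' s'" "{..m}"]
        dens[OF sp(1)] dens[OF sp(2)] sp pos
      by (simp add: d_def scaled_density_def less_imp_le)
    finally show "ennreal ((\<kappa> / \<sigma>bar)\<^sup>2 / 4 * (m - m')\<^sup>2)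
        \<le> (\<integral>\<^sup>+y. ennreal ((sqrt (scaled_density f m s y) - sqrt (scaled_density f m' s' y))\<^sup>2) \<partial>lborel)" .
  qed
qed

section \<open>The regression model\<close>

text \<open>Meant for \<open>u = ln r\<close> with a likelihood ratio \<open>r\<close>: the two
  terms on the right become second moments of \<open>ln r\<close> under the two laws.\<close>

lemma exp_quadratic_bound: "exp u - 1 - u \<le> u\<^sup>2 * (1 + exp u)" for u :: real
proof (cases "0 \<le> u")
  case True
  have "exp u * ((1 - u) * (1 + u)) \<le> exp u * (exp (- u) * (1 + u))"
    using True exp_ge_add_one_self[of "- u"] by (intro mult_left_mono mult_right_mono) auto
  also have "\<dots> = 1 + u" by (simp add: exp_minus)
  finally have "exp u - 1 - u \<le> u\<^sup>2 * exp u" by (simp add: algebra_simps power2_eq_square)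
  also have "\<dots> \<le> u\<^sup>2 * (1 + exp u)" by (intro mult_left_mono) auto
  finally show ?thesis .
next
  case False
  define w where "w = - u"
  have w: "0 \<le> w" using False by (simp add: w_def)
  \<comment> \<open>For negative \<open>u\<close> this yields the sharper bound by half the square
    of \<open>u\<close>: the second factor is below \<open>exp w\<close>, so the first is above
    \<open>exp (- w)\<close>.\<close>
  have "1 \<le> (1 - w + w\<^sup>2 / 2) * (1 + w + w\<^sup>2 / 2)"
  proof -
    have "(1 - w + w\<^sup>2 / 2) * (1 + w + w\<^sup>2 / 2) = 1 + (w\<^sup>2)\<^sup>2 / 4"
      by (simp add: power2_eq_square algebra_simps)
    then show ?thesis by simp
  qed
  also have "\<dots> \<le> (1 - w + w\<^sup>2 / 2) * exp w"
  proof (intro mult_left_mono exp_lower_Taylor_quadratic w)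
    show "0 \<le> 1 - w + w\<^sup>2 / 2" using zero_le_power2[of "w - 1"] by (simp add: power2_eq_square algebra_simps)
  qed
  finally have "exp (- w) * 1 \<le> exp (- w) * ((1 - w + w\<^sup>2 / 2) * exp w)" by (intro mult_left_mono) auto
  also have "\<dots> = 1 - w + w\<^sup>2 / 2" by (simp add: exp_minus)
  finally have "exp u - 1 - u \<le> u\<^sup>2 / 2" by (simp add: w_def)
  also have "\<dots> \<le> u\<^sup>2 * (1 + exp u)" by (simp add: algebra_simps add_increasing)
  finally show ?thesis .
qed

text \<open>As \<open>r - 1\<close> integrates to 0, the divergence is the integral of
  \<open>r - 1 - ln r\<close>, to which \<open>exp_quadratic_bound\<close> applies pointwise. In
  this way no pointwise bound on \<open>r\<close> enters.\<close>

lemma KL_le_log_ratio_L2: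
  fixes r :: "'b \<Rightarrow> real"
  assumes P: "prob_space P" and Q: "prob_space (density P r)"
    and r: "r \<in> borel_measurable P" and r_pos: "\<And>x. x \<in> space P \<Longrightarrow> 0 < r x"
    and V: "0 \<le> V" "(\<integral>\<^sup>+x. ennreal ((ln (r x))\<^sup>2) \<partial>P) \<le> ennreal V"
      "(\<integral>\<^sup>+x. ennreal ((ln (r x))\<^sup>2) \<partial>density P r) \<le> ennreal V"
  shows "integrable P (\<lambda>x. ln (r x))" and "- (\<integral>x. ln (r x) \<partial>P) \<le> 2 * V"
proof -
  interpret prob_space P by fact
  note r[measurable]
  have i2: "integrable P (\<lambda>x. (ln (r x))\<^sup>2)"
    using V(2) by (intro integrableI_bounded) (auto intro: le_less_trans)
  have e2: "(\<integral>x. (ln (r x))\<^sup>2 \<partial>P) \<le> V"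
    using V nn_integral_eq_integral[OF i2] by simp
  have Q2: "(\<integral>\<^sup>+x. ennreal (r x * (ln (r x))\<^sup>2) \<partial>P) \<le> ennreal V"
  proof -
    have "(\<integral>\<^sup>+x. ennreal (r x * (ln (r x))\<^sup>2) \<partial>P) = (\<integral>\<^sup>+x. ennreal ((ln (r x))\<^sup>2) \<partial>density P r)"
      using r_pos by (subst nn_integral_density) (auto intro!: nn_integral_cong simp: ennreal_mult less_imp_le)
    then show ?thesis using V by simp
  qed
  have i3: "integrable P (\<lambda>x. r x * (ln (r x))\<^sup>2)"
  proof (intro integrableI_bounded)
    have "(\<integral>\<^sup>+x. ennreal (norm (r x * (ln (r x))\<^sup>2)) \<partial>P) = (\<integral>\<^sup>+x. ennreal (r x * (ln (r x))\<^sup>2) \<partial>P)"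
      using r_pos by (intro nn_integral_cong) (simp add: less_imp_le abs_mult)
    then show "(\<integral>\<^sup>+x. ennreal (norm (r x * (ln (r x))\<^sup>2)) \<partial>P) < \<infinity>" using Q2 by (auto intro: le_less_trans)
  qed measurable
  have e3: "(\<integral>x. r x * (ln (r x))\<^sup>2 \<partial>P) \<le> V"
    using V Q2 nn_integral_eq_integral[OF i3] r_pos by (simp add: less_imp_le AE_I2)
  show i: "integrable P (\<lambda>x. ln (r x))"
  proof (rule Bochner_Integration.integrable_bound[where f="\<lambda>x. 1 + (ln (r x))\<^sup>2"])
    show "AE x in P. norm (ln (r x)) \<le> norm (1 + (ln (r x))\<^sup>2)"
    proof (intro AE_I2)
      fix x
      have "\<bar>ln (r x)\<bar> \<le> 1 + \<bar>ln (r x)\<bar>\<^sup>2"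
        using zero_le_power2[of "\<bar>ln (r x)\<bar> - 1"] by (simp add: power2_eq_square algebra_simps)
      then show "norm (ln (r x)) \<le> norm (1 + (ln (r x))\<^sup>2)" by simp
    qed
  qed (use i2 in auto)
  have ri: "integrable P r" "(\<integral>x. r x \<partial>P) = 1"
    using integral_density_prob[OF Q r less_imp_le[OF r_pos]] by auto
  have "(\<integral>x. r x - 1 - ln (r x) \<partial>P) \<le> (\<integral>x. (ln (r x))\<^sup>2 + r x * (ln (r x))\<^sup>2 \<partial>P)"
  proof (rule integral_mono)
    fix x assume "x \<in> space P"
    then show "r x - 1 - ln (r x) \<le> (ln (r x))\<^sup>2 + r x * (ln (r x))\<^sup>2"
      using exp_quadratic_bound[of "ln (r x)"] r_pos by (simp add: algebra_simps)
  qed (use i i2 i3 ri in auto)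
  also have "\<dots> \<le> V + V" using i2 i3 e2 e3 by simp
  finally show "- (\<integral>x. ln (r x) \<partial>P) \<le> 2 * V" using ri i by (simp add: prob_space)
qed

lemma sq_L2_dist_density:
  assumes "h \<in> prob_densities D" "\<mu> \<in> borel_measurable D" "\<nu> \<in> borel_measurable D"
  shows "sq_L2_dist D h \<mu> \<nu> = (\<integral>\<^sup>+x. ennreal ((\<mu> x - \<nu> x)\<^sup>2) \<partial>density D h)"
proof -
  have [measurable]: "h \<in> borel_measurable D" "\<mu> \<in> borel_measurable D" "\<nu> \<in> borel_measurable D"
    using assms by (auto simp: prob_densities_def)
  have "\<forall>x\<in>space D. 0 \<le> h x" using assms by (simp add: prob_densities_def)
  then show ?thesis
    unfolding sq_L2_dist_def
    by (subst nn_integral_density) (auto intro!: nn_integral_cong simp: ennreal_mult mult.commute)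
qed

lemma prob_space_covariate:
  assumes "h \<in> prob_densities D"
  shows "prob_space (density D h)"
proof
  have [measurable]: "h \<in> borel_measurable D" using assms by (simp add: prob_densities_def)
  have "emeasure (density D h) (space D) = (\<integral>\<^sup>+x. ennreal (h x) \<partial>D)"
    by (subst emeasure_density) (auto intro!: nn_integral_cong)
  then show "emeasure (density D h) (space (density D h)) = 1"
    using assms by (simp add: prob_densities_def)
qed

section \<open>Likelihood, divergence and Hellinger distance of one observation\<close>

locale regression_family =
  fixes D :: "'a measure" and f :: "real \<Rightarrow> real" and B \<sigma>bar :: real
  assumes error: "regular_error f" and \<sigma>bar: "1 < \<sigma>bar"
begin

text \<open>The locale fixes no sign for \<open>B\<close>, hence the absolute value in the
  bound.\<close>

definition admissible :: "('a \<Rightarrow> real) \<Rightarrow> ('a \<Rightarrow> real) \<Rightarrow> bool" where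
  "admissible \<mu> \<sigma> \<longleftrightarrow> \<mu> \<in> borel_measurable D \<and> \<sigma> \<in> borel_measurable D \<and>
     (\<forall>x\<in>space D. \<bar>\<mu> x\<bar> \<le> \<bar>B\<bar> \<and> inverse \<sigma>bar \<le> \<sigma> x \<and> \<sigma> x \<le> \<sigma>bar)"

definition lik :: "('a \<Rightarrow> real) \<Rightarrow> ('a \<Rightarrow> real) \<Rightarrow> 'a \<times> real \<Rightarrow> real" where
  "lik \<mu> \<sigma> = (\<lambda>(x, y). scaled_density f (\<mu> x) (\<sigma> x) y)"

text \<open>The covariate law is put into the reference measure, so that \<open>lik\<close> does not
  involve \<open>h\<close> and can be maximized without knowing it.\<close>

definition base :: "('a \<Rightarrow> real) \<Rightarrow> ('a \<times> real) measure" where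
  "base h = density D h \<Otimes>\<^sub>M lborel"

lemma error_measurable[measurable]: "f \<in> borel_measurable borel"
  and error_pos: "0 < f u"
  and error_integral: "(\<integral>\<^sup>+y. ennreal (f y) \<partial>lborel) = 1"
  using error by (auto simp: regular_error_def)

lemma prob_space_error: "prob_space (density lborel f)"
  by standard (simp add: emeasure_density error_integral)

lemma admissible_scale_pos: "admissible \<mu> \<sigma> \<Longrightarrow> x \<in> space D \<Longrightarrow> 0 < \<sigma> x"
  using \<sigma>bar unfolding admissible_def
  by (metis inverse_positive_iff_positive less_le_trans order.strict_trans zero_less_one)

lemma sets_base[simp, measurable_cong]: "sets (base h) = sets (D \<Otimes>\<^sub>M borel)"
  unfolding base_def by (intro sets_pair_measure_cong) auto

lemma space_base[simp]: "space (base h) = space D \<times> UNIV"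
  by (simp add: base_def space_pair_measure)

lemma lik_measurable:
  assumes "admissible \<mu> \<sigma>"
  shows "lik \<mu> \<sigma> \<in> borel_measurable (D \<Otimes>\<^sub>M borel)"
proof -
  have [measurable]: "\<mu> \<in> borel_measurable D" "\<sigma> \<in> borel_measurable D"
    using assms by (auto simp: admissible_def)
  show ?thesis unfolding lik_def scaled_density_def by measurable
qed

lemma lik_pos: "admissible \<mu> \<sigma> \<Longrightarrow> z \<in> space D \<times> UNIV \<Longrightarrow> 0 < lik \<mu> \<sigma> z"
  using error_pos admissible_scale_pos by (auto simp: lik_def scaled_density_def)

lemma nn_integral_base:
  assumes "g \<in> borel_measurable (D \<Otimes>\<^sub>M borel)"
  shows "(\<integral>\<^sup>+z. g z \<partial>base h) = (\<integral>\<^sup>+x. \<integral>\<^sup>+y. g (x, y) \<partial>lborel \<partial>density D h)"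
proof -
  have "sets (density D h \<Otimes>\<^sub>M (lborel :: real measure)) = sets (D \<Otimes>\<^sub>M borel)"
    by (intro sets_pair_measure_cong) auto
  then have "g \<in> borel_measurable (density D h \<Otimes>\<^sub>M lborel)"
    using assms measurable_cong_sets by blast
  then show ?thesis
    unfolding base_def by (subst lborel.nn_integral_fst[symmetric]) auto
qed

text \<open>Given \<open>x\<close>, the response is an affine image of the error, so the claim is
  the substitution \<open>y = \<mu> x + \<sigma> x * e\<close> on each fibre.\<close>

lemma observation_law_density:
  assumes h: "h \<in> prob_densities D" and adm: "admissible \<mu> \<sigma>"
  shows "observation_law D f \<mu> \<sigma> h = density (base h) (lik \<mu> \<sigma>)"
proof (rule measure_eqI)
  interpret E: prob_space "density lborel f" by (rule prob_space_error)
  have [measurable]: "\<mu> \<in> borel_measurable D" "\<sigma> \<in> borel_measurable D"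
    using adm by (auto simp: admissible_def)
  note lik_measurable[OF adm, measurable]
  let ?T = "\<lambda>(x, e). (x, \<mu> x + \<sigma> x * e)"
  let ?P = "density D h \<Otimes>\<^sub>M density lborel f"
  have sP: "sets ?P = sets (D \<Otimes>\<^sub>M borel)" by (intro sets_pair_measure_cong) auto
  have T: "?T \<in> measurable ?P (D \<Otimes>\<^sub>M borel)"
    by (subst measurable_cong_sets[OF sP refl]) measurable
  show "sets (observation_law D f \<mu> \<sigma> h) = sets (density (base h) (lik \<mu> \<sigma>))"
    by (simp add: observation_law_def)
  fix A assume "A \<in> sets (observation_law D f \<mu> \<sigma> h)"
  then have A[measurable]: "A \<in> sets (D \<Otimes>\<^sub>M borel)" by (simp add: observation_law_def)
  have "emeasure (observation_law D f \<mu> \<sigma> h) A = (\<integral>\<^sup>+z. indicator A (?T z) \<partial>?P)"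
    unfolding observation_law_def
    by (subst nn_integral_indicator[symmetric], simp, subst nn_integral_distr[OF T]) simp_all
  also have "\<dots> = (\<integral>\<^sup>+x. \<integral>\<^sup>+e. indicator A (?T (x, e)) \<partial>density lborel f \<partial>density D h)"
    using measurable_compose[OF T borel_measurable_indicator[OF A]]
    by (subst E.nn_integral_fst[symmetric]) auto
  also have "\<dots> = (\<integral>\<^sup>+x. \<integral>\<^sup>+y. ennreal (lik \<mu> \<sigma> (x, y)) * indicator A (x, y) \<partial>lborel \<partial>density D h)"
  proof (intro nn_integral_cong)
    fix x assume "x \<in> space (density D h)"
    then have x[measurable]: "x \<in> space D" by simp
    have "(\<integral>\<^sup>+e. indicator A (?T (x, e)) \<partial>density lborel f)
        = (\<integral>\<^sup>+e. ennreal (f e) * indicator A (x, \<mu> x + \<sigma> x * e) \<partial>lborel)"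
      by (subst nn_integral_density) auto
    also have "\<dots> = (\<integral>\<^sup>+y. ennreal (scaled_density f (\<mu> x) (\<sigma> x) y) * indicator A (x, y) \<partial>lborel)"
      using error_pos admissible_scale_pos[OF adm x]
      by (intro nn_integral_scaled_density[symmetric]) (auto simp: less_imp_le)
    finally show "(\<integral>\<^sup>+e. indicator A (?T (x, e)) \<partial>density lborel f)
        = (\<integral>\<^sup>+y. ennreal (lik \<mu> \<sigma> (x, y)) * indicator A (x, y) \<partial>lborel)" by (simp add: lik_def)
  qed
  also have "\<dots> = (\<integral>\<^sup>+z. ennreal (lik \<mu> \<sigma> z) * indicator A z \<partial>base h)"
    by (subst nn_integral_base) auto
  also have "\<dots> = emeasure (density (base h) (lik \<mu> \<sigma>)) A"
    by (subst emeasure_density) auto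
  finally show "emeasure (observation_law D f \<mu> \<sigma> h) A = emeasure (density (base h) (lik \<mu> \<sigma>)) A" .
qed

lemma sets_observation_law[simp, measurable_cong]:
  "sets (observation_law D f \<mu> \<sigma> h) = sets (D \<Otimes>\<^sub>M borel)"
  by (simp add: observation_law_def)

lemma space_observation_law[simp]: "space (observation_law D f \<mu> \<sigma> h) = space D \<times> UNIV"
  by (simp add: observation_law_def space_pair_measure)

lemma prob_space_observation_law:
  assumes h: "h \<in> prob_densities D" and adm: "admissible \<mu> \<sigma>"
  shows "prob_space (observation_law D f \<mu> \<sigma> h)"
proof -
  interpret X: prob_space "density D h" by (rule prob_space_covariate[OF h])
  interpret E: prob_space "density lborel f" by (rule prob_space_error)
  interpret XE: pair_prob_space "density D h" "density lborel f" by standard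
  have [measurable]: "\<mu> \<in> borel_measurable D" "\<sigma> \<in> borel_measurable D"
    using adm by (auto simp: admissible_def)
  have sP: "sets (density D h \<Otimes>\<^sub>M density lborel f) = sets (D \<Otimes>\<^sub>M borel)"
    by (intro sets_pair_measure_cong) auto
  show ?thesis unfolding observation_law_def
    by (intro XE.prob_space_distr, subst measurable_cong_sets[OF sP refl]) measurable
qed

text \<open>The first pair of parameters is the one in the denominator.\<close>

definition lik_ratio where
  "lik_ratio \<mu> \<sigma> \<mu>' \<sigma>' z = lik \<mu>' \<sigma>' z / lik \<mu> \<sigma> z"

lemma lik_ratio_measurable:
  assumes "admissible \<mu> \<sigma>" "admissible \<mu>' \<sigma>'"
  shows "lik_ratio \<mu> \<sigma> \<mu>' \<sigma>' \<in> borel_measurable (observation_law D f \<mu> \<sigma> h)"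
proof -
  note assms[THEN lik_measurable, measurable]
  show ?thesis unfolding lik_ratio_def[abs_def] by measurable
qed

lemma lik_ratio_pos:
  assumes "admissible \<mu> \<sigma>" "admissible \<mu>' \<sigma>'" "z \<in> space D \<times> UNIV"
  shows "0 < lik_ratio \<mu> \<sigma> \<mu>' \<sigma>' z"
  using assms lik_pos by (simp add: lik_ratio_def)

text \<open>Presents every law of the model as a density over any other with the same
  \<open>h\<close>, the form in which the results on product measures take their laws.\<close>

lemma density_lik_ratio:
  assumes h: "h \<in> prob_densities D" and adm: "admissible \<mu> \<sigma>" and adm': "admissible \<mu>' \<sigma>'"
  shows "density (observation_law D f \<mu> \<sigma> h) (lik_ratio \<mu> \<sigma> \<mu>' \<sigma>') = observation_law D f \<mu>' \<sigma>' h"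
proof -
  note adm[THEN lik_measurable, measurable] adm'[THEN lik_measurable, measurable]
  have m[measurable]: "lik_ratio \<mu> \<sigma> \<mu>' \<sigma>' \<in> borel_measurable (D \<Otimes>\<^sub>M borel)"
    unfolding lik_ratio_def[abs_def] by measurable
  have "density (density (base h) (lik \<mu> \<sigma>)) (lik_ratio \<mu> \<sigma> \<mu>' \<sigma>')
      = density (base h) (\<lambda>z. ennreal (lik \<mu> \<sigma> z) * ennreal (lik_ratio \<mu> \<sigma> \<mu>' \<sigma>' z))"
    by (intro density_density_eq) auto
  also have "\<dots> = density (base h) (lik \<mu>' \<sigma>')"
  proof (intro density_cong AE_I2)
    fix z assume "z \<in> space (base h)"
    then have "0 < lik \<mu> \<sigma> z" "0 < lik \<mu>' \<sigma>' z" using lik_pos adm adm' by auto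
    then show "ennreal (lik \<mu> \<sigma> z) * ennreal (lik_ratio \<mu> \<sigma> \<mu>' \<sigma>' z) = ennreal (lik \<mu>' \<sigma>' z)"
      by (simp add: lik_ratio_def flip: ennreal_mult)
  qed auto
  finally show ?thesis by (simp add: observation_law_density[OF h] adm adm')
qed

text \<open>The bound for fixed location and scale is integrated over the covariate. It controls the
  second moment of the log-ratio under both laws, as \<open>KL_le_log_ratio_L2\<close>
  requires.\<close>

lemma KL_le_sq_L2_dist:
  obtains K where "0 \<le> K"
    "\<And>h \<mu> \<sigma> \<mu>' \<sigma>' v. h \<in> prob_densities D \<Longrightarrow> admissible \<mu> \<sigma> \<Longrightarrow> admissible \<mu>' \<sigma>' \<Longrightarrow> 0 \<le> v \<Longrightarrow>
      sq_L2_dist D h \<mu> \<mu>' + sq_L2_dist D h \<sigma> \<sigma>' \<le> ennreal v \<Longrightarrow>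
      integrable (observation_law D f \<mu> \<sigma> h) (\<lambda>z. ln (lik_ratio \<mu> \<sigma> \<mu>' \<sigma>' z)) \<and>
      - (\<integral>z. ln (lik_ratio \<mu> \<sigma> \<mu>' \<sigma>' z) \<partial>observation_law D f \<mu> \<sigma> h) \<le> K * v"
proof -
  obtain K where K: "0 \<le> K"
    "\<And>m m' s s'. \<bar>m\<bar> \<le> \<bar>B\<bar> \<Longrightarrow> \<bar>m'\<bar> \<le> \<bar>B\<bar> \<Longrightarrow> inverse \<sigma>bar \<le> s \<Longrightarrow> s \<le> \<sigma>bar \<Longrightarrow>
      inverse \<sigma>bar \<le> s' \<Longrightarrow> s' \<le> \<sigma>bar \<Longrightarrow>
      (\<integral>\<^sup>+y. ennreal (scaled_density f m s y)
          * ennreal ((ln (scaled_density f m s y) - ln (scaled_density f m' s' y))\<^sup>2) \<partial>lborel)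
        \<le> ennreal (K * ((m - m')\<^sup>2 + (s - s')\<^sup>2))"
    using log_density_L2_bound[OF error \<sigma>bar, of "\<bar>B\<bar>"] by auto
  have L2: "(\<integral>\<^sup>+z. ennreal ((ln (lik \<mu> \<sigma> z) - ln (lik \<mu>' \<sigma>' z))\<^sup>2) \<partial>observation_law D f \<mu> \<sigma> h)
      \<le> ennreal (K * v)"
    if h: "h \<in> prob_densities D" and adm: "admissible \<mu> \<sigma>" and adm': "admissible \<mu>' \<sigma>'" and v: "0 \<le> v"
      and d: "sq_L2_dist D h \<mu> \<mu>' + sq_L2_dist D h \<sigma> \<sigma>' \<le> ennreal v"
    for h \<mu> \<sigma> \<mu>' \<sigma>' v
  proof -
    note adm[THEN lik_measurable, measurable] adm'[THEN lik_measurable, measurable]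
    have [measurable]: "\<mu> \<in> borel_measurable D" "\<sigma> \<in> borel_measurable D"
      "\<mu>' \<in> borel_measurable D" "\<sigma>' \<in> borel_measurable D"
      using adm adm' by (auto simp: admissible_def)
    have "(\<integral>\<^sup>+z. ennreal ((ln (lik \<mu> \<sigma> z) - ln (lik \<mu>' \<sigma>' z))\<^sup>2) \<partial>observation_law D f \<mu> \<sigma> h)
      = (\<integral>\<^sup>+x. \<integral>\<^sup>+y. ennreal (lik \<mu> \<sigma> (x, y)) * ennreal ((ln (lik \<mu> \<sigma> (x, y)) - ln (lik \<mu>' \<sigma>' (x, y)))\<^sup>2)
          \<partial>lborel \<partial>density D h)"
      unfolding observation_law_density[OF h adm]
      by (subst nn_integral_density, simp, simp, subst nn_integral_base) auto
    also have "\<dots> \<le> (\<integral>\<^sup>+x. ennreal (K * ((\<mu> x - \<mu>' x)\<^sup>2 + (\<sigma> x - \<sigma>' x)\<^sup>2)) \<partial>density D h)"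
      unfolding lik_def split using adm adm'
      by (intro nn_integral_mono K(2)) (auto simp: admissible_def)
    also have "\<dots> = (\<integral>\<^sup>+x. ennreal K * (ennreal ((\<mu> x - \<mu>' x)\<^sup>2) + ennreal ((\<sigma> x - \<sigma>' x)\<^sup>2)) \<partial>density D h)"
      using K(1) by (simp add: ennreal_mult)
    also have "\<dots> = ennreal K * (sq_L2_dist D h \<mu> \<mu>' + sq_L2_dist D h \<sigma> \<sigma>')"
      using h by (simp add: nn_integral_cmult nn_integral_add sq_L2_dist_density)
    also have "\<dots> \<le> ennreal K * ennreal v" using d by (rule mult_left_mono) simp
    finally show ?thesis using K(1) v by (simp add: ennreal_mult)
  qed
  show thesis
  proof (rule that[of "2 * K"])
    show "0 \<le> 2 * K" using K by simp
    fix h \<mu> \<sigma> \<mu>' \<sigma>' and v :: real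
    assume h: "h \<in> prob_densities D" and adm: "admissible \<mu> \<sigma>" and adm': "admissible \<mu>' \<sigma>'" and v: "0 \<le> v"
      and d: "sq_L2_dist D h \<mu> \<mu>' + sq_L2_dist D h \<sigma> \<sigma>' \<le> ennreal v"
    let ?P = "observation_law D f \<mu> \<sigma> h"
    let ?r = "lik_ratio \<mu> \<sigma> \<mu>' \<sigma>'"
    have ln: "(ln (?r z))\<^sup>2 = (ln (lik \<mu> \<sigma> z) - ln (lik \<mu>' \<sigma>' z))\<^sup>2" if "z \<in> space D \<times> UNIV" for z
      using lik_pos[OF adm that] lik_pos[OF adm' that]
      by (simp add: lik_ratio_def ln_div power2_commute)
    \<comment> \<open>The moment under the second law is the same estimate with the two parameter
      pairs exchanged.\<close>
    have sym: "sq_L2_dist D h \<mu>' \<mu> + sq_L2_dist D h \<sigma>' \<sigma> \<le> ennreal v"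
      using d by (simp add: sq_L2_dist_def power2_commute)
    have "prob_space (density ?P ?r)"
      unfolding density_lik_ratio[OF h adm adm'] by (rule prob_space_observation_law[OF h adm'])
    moreover have "(\<integral>\<^sup>+z. ennreal ((ln (?r z))\<^sup>2) \<partial>?P)
        = (\<integral>\<^sup>+z. ennreal ((ln (lik \<mu> \<sigma> z) - ln (lik \<mu>' \<sigma>' z))\<^sup>2) \<partial>?P)"
      by (intro nn_integral_cong) (simp add: ln)
    then have "(\<integral>\<^sup>+z. ennreal ((ln (?r z))\<^sup>2) \<partial>?P) \<le> ennreal (K * v)"
      using L2[OF h adm adm' v d] by simp
    moreover have "(\<integral>\<^sup>+z. ennreal ((ln (?r z))\<^sup>2) \<partial>density ?P ?r) \<le> ennreal (K * v)"
    proof -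
      have "(\<integral>\<^sup>+z. ennreal ((ln (?r z))\<^sup>2) \<partial>observation_law D f \<mu>' \<sigma>' h)
        = (\<integral>\<^sup>+z. ennreal ((ln (lik \<mu>' \<sigma>' z) - ln (lik \<mu> \<sigma> z))\<^sup>2) \<partial>observation_law D f \<mu>' \<sigma>' h)"
        by (intro nn_integral_cong) (simp add: ln power2_commute)
      also have "\<dots> \<le> ennreal (K * v)" by (rule L2[OF h adm' adm v sym])
      finally show ?thesis unfolding density_lik_ratio[OF h adm adm'] .
    qed
    ultimately show "integrable ?P (\<lambda>z. ln (?r z)) \<and> - (\<integral>z. ln (?r z) \<partial>?P) \<le> 2 * K * v"
      using KL_le_log_ratio_L2[OF prob_space_observation_law[OF h adm] _ lik_ratio_measurable[OF adm adm'] lik_ratio_pos[OF adm adm'], of "K * v"]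
        K(1) v by simp
  qed
qed

text \<open>The right-hand side is the squared Hellinger distance, the mean of the square of
  \<open>1 - sqrt r\<close>, written through the affinity to fit
  \<open>likelihood_selection_bound\<close>. Its lower bound holds conditionally on the covariate
  and is integrated.\<close>

lemma sq_L2_dist_le_hellinger:
  obtains k where "0 < k"
    "\<And>h \<mu> \<sigma> \<mu>' \<sigma>'. h \<in> prob_densities D \<Longrightarrow> admissible \<mu> \<sigma> \<Longrightarrow> admissible \<mu>' \<sigma>' \<Longrightarrow>
      sq_L2_dist D h \<mu> \<mu>' \<noteq> \<top> \<and> k * enn2real (sq_L2_dist D h \<mu> \<mu>')
        \<le> 2 * (1 - (\<integral>z. sqrt (lik_ratio \<mu> \<sigma> \<mu>' \<sigma>' z) \<partial>observation_law D f \<mu> \<sigma> h))"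
proof -
  obtain k where k: "0 < k"
    "\<And>m m' s s'. \<bar>m\<bar> \<le> \<bar>B\<bar> \<Longrightarrow> \<bar>m'\<bar> \<le> \<bar>B\<bar> \<Longrightarrow> inverse \<sigma>bar \<le> s \<Longrightarrow> s \<le> \<sigma>bar \<Longrightarrow>
      inverse \<sigma>bar \<le> s' \<Longrightarrow> s' \<le> \<sigma>bar \<Longrightarrow>
      ennreal (k * (m - m')\<^sup>2)
        \<le> (\<integral>\<^sup>+y. ennreal ((sqrt (scaled_density f m s y) - sqrt (scaled_density f m' s' y))\<^sup>2) \<partial>lborel)"
    using hellinger_location_bound[OF error \<sigma>bar, of "\<bar>B\<bar>"] by auto
  show thesis
  proof (rule that[OF k(1)])
    fix h \<mu> \<sigma> \<mu>' \<sigma>'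
    assume h: "h \<in> prob_densities D" and adm: "admissible \<mu> \<sigma>" and adm': "admissible \<mu>' \<sigma>'"
    note adm[THEN lik_measurable, measurable] adm'[THEN lik_measurable, measurable]
    have [measurable]: "\<mu> \<in> borel_measurable D" "\<mu>' \<in> borel_measurable D"
      using adm adm' by (auto simp: admissible_def)
    let ?P = "observation_law D f \<mu> \<sigma> h"
    let ?r = "lik_ratio \<mu> \<sigma> \<mu>' \<sigma>'"
    interpret P: prob_space ?P by (rule prob_space_observation_law[OF h adm])
    note lik_ratio_measurable[OF adm adm', measurable]
    have r_pos: "0 < ?r z" if "z \<in> space ?P" for z using lik_ratio_pos[OF adm adm'] that by simp
    have Q: "prob_space (density ?P ?r)"
      unfolding density_lik_ratio[OF h adm adm'] by (rule prob_space_observation_law[OF h adm'])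
    have ri: "integrable ?P ?r" "(\<integral>z. ?r z \<partial>?P) = 1"
      using integral_density_prob[OF Q lik_ratio_measurable[OF adm adm'] less_imp_le[OF r_pos]] by auto
    have si: "integrable ?P (\<lambda>z. sqrt (?r z))"
      using ri(1) r_pos by (intro P.integrable_sqrt) (auto intro: less_imp_le)
    have eq: "(1 - sqrt (?r z))\<^sup>2 = 1 + ?r z - 2 * sqrt (?r z)" if "z \<in> space ?P" for z
      using r_pos[OF that] by (simp add: power2_diff)
    have hi: "integrable ?P (\<lambda>z. (1 - sqrt (?r z))\<^sup>2)"
      using ri si by (subst Bochner_Integration.integrable_cong[OF refl eq]) auto
    have he: "(\<integral>z. (1 - sqrt (?r z))\<^sup>2 \<partial>?P) = 2 * (1 - (\<integral>z. sqrt (?r z) \<partial>?P))"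
      using ri si by (subst Bochner_Integration.integral_cong[OF refl eq]) (use P.prob_space in auto)
    have "ennreal k * sq_L2_dist D h \<mu> \<mu>' = (\<integral>\<^sup>+x. ennreal (k * (\<mu> x - \<mu>' x)\<^sup>2) \<partial>density D h)"
      using h k(1) by (subst sq_L2_dist_density) (auto simp: ennreal_mult nn_integral_cmult)
    also have "\<dots> \<le> (\<integral>\<^sup>+x. \<integral>\<^sup>+y. ennreal ((sqrt (lik \<mu> \<sigma> (x, y)) - sqrt (lik \<mu>' \<sigma>' (x, y)))\<^sup>2) \<partial>lborel \<partial>density D h)"
      unfolding lik_def split using adm adm'
      by (intro nn_integral_mono k(2)) (auto simp: admissible_def)
    also have "\<dots> = (\<integral>\<^sup>+z. ennreal ((sqrt (lik \<mu> \<sigma> z) - sqrt (lik \<mu>' \<sigma>' z))\<^sup>2) \<partial>base h)"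
      by (subst nn_integral_base) auto
    also have "\<dots> = (\<integral>\<^sup>+z. ennreal (lik \<mu> \<sigma> z) * ennreal ((1 - sqrt (?r z))\<^sup>2) \<partial>base h)"
    proof (intro nn_integral_cong)
      fix z assume "z \<in> space (base h)"
      then have p: "0 < lik \<mu> \<sigma> z" "0 < lik \<mu>' \<sigma>' z" using lik_pos adm adm' by auto
      have "sqrt (lik \<mu> \<sigma> z) - sqrt (lik \<mu>' \<sigma>' z) = sqrt (lik \<mu> \<sigma> z) * (1 - sqrt (?r z))"
        using p by (simp add: lik_ratio_def real_sqrt_divide right_diff_distrib)
      then have "(sqrt (lik \<mu> \<sigma> z) - sqrt (lik \<mu>' \<sigma>' z))\<^sup>2 = lik \<mu> \<sigma> z * (1 - sqrt (?r z))\<^sup>2"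
        using p by (simp add: power_mult_distrib)
      then show "ennreal ((sqrt (lik \<mu> \<sigma> z) - sqrt (lik \<mu>' \<sigma>' z))\<^sup>2)
          = ennreal (lik \<mu> \<sigma> z) * ennreal ((1 - sqrt (?r z))\<^sup>2)" using p by (simp add: ennreal_mult)
    qed
    also have "\<dots> = (\<integral>\<^sup>+z. ennreal ((1 - sqrt (?r z))\<^sup>2) \<partial>?P)"
      unfolding observation_law_density[OF h adm] lik_ratio_def
      by (subst nn_integral_density) auto
    also have "\<dots> = ennreal (2 * (1 - (\<integral>z. sqrt (?r z) \<partial>?P)))"
      unfolding he[symmetric] by (intro nn_integral_eq_integral hi) auto
    finally have le: "ennreal k * sq_L2_dist D h \<mu> \<mu>' \<le> ennreal (2 * (1 - (\<integral>z. sqrt (?r z) \<partial>?P)))" .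
    have nn: "0 \<le> 2 * (1 - (\<integral>z. sqrt (?r z) \<partial>?P))"
      unfolding he[symmetric] by simp
    show "sq_L2_dist D h \<mu> \<mu>' \<noteq> \<top> \<and> k * enn2real (sq_L2_dist D h \<mu> \<mu>')
        \<le> 2 * (1 - (\<integral>z. sqrt (?r z) \<partial>?P))"
    proof (cases "sq_L2_dist D h \<mu> \<mu>'" rule: ennreal_cases)
      case (real d)
      then show ?thesis using le nn k(1) by (simp flip: ennreal_mult)
    next
      case top
      then show ?thesis using le k(1) by (simp add: ennreal_mult_top top_unique)
    qed
  qed
qed

end

section \<open>Squared distances and a measurable maximizer\<close>

lemma sq_L2_dist_commute: "sq_L2_dist D h \<mu> \<nu> = sq_L2_dist D h \<nu> \<mu>"
  by (simp add: sq_L2_dist_def power2_commute)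

lemma sq_L2_dist_self[simp]: "sq_L2_dist D h \<mu> \<mu> = 0"
  by (simp add: sq_L2_dist_def)

lemma sq_L2_dist_triangle:
  assumes h: "h \<in> prob_densities D"
    and m[measurable]: "\<mu> \<in> borel_measurable D" "\<nu> \<in> borel_measurable D" "m \<in> borel_measurable D"
  shows "sq_L2_dist D h \<mu> \<nu> \<le> 2 * sq_L2_dist D h \<mu> m + 2 * sq_L2_dist D h \<nu> m"
proof -
  have "(\<integral>\<^sup>+x. ennreal ((\<mu> x - \<nu> x)\<^sup>2) \<partial>density D h)
      \<le> (\<integral>\<^sup>+x. 2 * ennreal ((\<mu> x - m x)\<^sup>2) + 2 * ennreal ((\<nu> x - m x)\<^sup>2) \<partial>density D h)"
  proof (intro nn_integral_mono)
    fix x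
    have "(\<mu> x - \<nu> x)\<^sup>2 \<le> 2 * (\<mu> x - m x)\<^sup>2 + 2 * (\<nu> x - m x)\<^sup>2"
      using square_sum_le[of "\<mu> x - m x" "m x - \<nu> x"] by (simp add: power2_commute[of "m x"])
    then have "ennreal ((\<mu> x - \<nu> x)\<^sup>2) \<le> ennreal (2 * (\<mu> x - m x)\<^sup>2 + 2 * (\<nu> x - m x)\<^sup>2)"
      by (rule ennreal_leI)
    then show "ennreal ((\<mu> x - \<nu> x)\<^sup>2) \<le> 2 * ennreal ((\<mu> x - m x)\<^sup>2) + 2 * ennreal ((\<nu> x - m x)\<^sup>2)"
      by (simp add: ennreal_plus ennreal_mult')
  qed
  also have "\<dots> = 2 * (\<integral>\<^sup>+x. ennreal ((\<mu> x - m x)\<^sup>2) \<partial>density D h)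
      + 2 * (\<integral>\<^sup>+x. ennreal ((\<nu> x - m x)\<^sup>2) \<partial>density D h)"
    by (simp add: nn_integral_add nn_integral_cmult)
  finally show ?thesis using h by (simp add: sq_L2_dist_density)
qed

text \<open>Covers are built once, for \<open>h0\<close>; this carries their approximation error
  over to every covariate density.\<close>

lemma sq_L2_dist_change_density:
  assumes "\<forall>x\<in>space D. h x \<le> C * h0 x" "\<forall>x\<in>space D. 0 \<le> h0 x" "h0 \<in> borel_measurable D"
    "\<mu> \<in> borel_measurable D" "\<nu> \<in> borel_measurable D"
  shows "sq_L2_dist D h \<mu> \<nu> \<le> ennreal \<bar>C\<bar> * sq_L2_dist D h0 \<mu> \<nu>"
proof -
  have "sq_L2_dist D h \<mu> \<nu> \<le> (\<integral>\<^sup>+x. ennreal \<bar>C\<bar> * ennreal ((\<mu> x - \<nu> x)\<^sup>2 * h0 x) \<partial>D)"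
    unfolding sq_L2_dist_def
  proof (intro nn_integral_mono)
    fix x assume x: "x \<in> space D"
    have "h x \<le> \<bar>C\<bar> * h0 x"
      using assms(1,2) x by (meson abs_ge_self mult_right_mono order.trans)
    then have "(\<mu> x - \<nu> x)\<^sup>2 * h x \<le> \<bar>C\<bar> * ((\<mu> x - \<nu> x)\<^sup>2 * h0 x)"
      by (metis mult.left_commute mult_left_mono zero_le_power2)
    then show "ennreal ((\<mu> x - \<nu> x)\<^sup>2 * h x) \<le> ennreal \<bar>C\<bar> * ennreal ((\<mu> x - \<nu> x)\<^sup>2 * h0 x)"
      using assms(2) x by (simp add: ennreal_leI flip: ennreal_mult)
  qed
  also have "\<dots> = ennreal \<bar>C\<bar> * sq_L2_dist D h0 \<mu> \<nu>"
    using assms(3-5) unfolding sq_L2_dist_def by (intro nn_integral_cmult) measurable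
  finally show ?thesis .
qed

text \<open>Ties are broken by the least index in an enumeration of \<open>J\<close>, which makes
  the choice a measurable function of the data.\<close>

lemma measurable_argmax:
  fixes L :: "'j \<Rightarrow> 'z \<Rightarrow> real"
  assumes J: "finite J" "J \<noteq> {}" and L: "\<And>j. j \<in> J \<Longrightarrow> L j \<in> borel_measurable M"
  obtains s where "s \<in> measurable M (count_space J)" "\<And>z j. j \<in> J \<Longrightarrow> L j z \<le> L (s z) z" "\<And>z. s z \<in> J"
proof -
  obtain g where g: "bij_betw g {..<card J} J" using ex_bij_betw_nat_finite[OF J(1)] by (auto simp: atLeast0LessThan)
  have gJ: "g k \<in> J" if "k < card J" for k using g that by (auto simp: bij_betw_def)
  define Q where "Q k z \<longleftrightarrow> k < card J \<and> (\<forall>j\<in>J. L j z \<le> L (g k) z)" for k z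
  define K where "K z = (LEAST k. Q k z)" for z
  have ex: "\<exists>k. Q k z" for z
  proof -
    have "Max ((\<lambda>j. L j z) ` J) \<in> (\<lambda>j. L j z) ` J" using J by (intro Max_in) auto
    then obtain j where j: "j \<in> J" "L j z = Max ((\<lambda>j. L j z) ` J)" by auto
    have "j \<in> g ` {..<card J}" using g j(1) by (simp add: bij_betw_def)
    then obtain k where "k < card J" "g k = j" by auto
    then show ?thesis using j J by (auto simp: Q_def)
  qed
  then have K: "Q (K z) z" for z unfolding K_def by (meson LeastI_ex)
  have Qm: "Measurable.pred M (Q k)" for k
  proof (cases "k < card J")
    case True
    have "Measurable.pred M (\<lambda>z. \<forall>j\<in>J. L j z \<le> L (g k) z)"
      using L gJ[OF True] J(1) by (intro pred_intros_finite) (auto simp: pred_def intro!: borel_measurable_le)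
    then show ?thesis using True by (simp add: Q_def[abs_def])
  qed (simp add: Q_def[abs_def])
  have Km: "K \<in> measurable M (count_space UNIV)"
    unfolding K_def[abs_def] using Qm by (rule measurable_Least)
  show thesis
  proof (rule that[of "\<lambda>z. g (K z)"])
    have "K \<in> measurable M (count_space {..<card J})"
    proof (rule measurable_count_space_eq2[THEN iffD2], simp, intro conjI ballI)
      show "K \<in> space M \<rightarrow> {..<card J}" using K by (simp add: Q_def)
      show "K -` {k} \<inter> space M \<in> sets M" for k by (rule measurable_sets[OF Km]) simp
    qed
    then show "(\<lambda>z. g (K z)) \<in> measurable M (count_space J)"
      by (rule measurable_compose) (use gJ in simp)
  qed (use K gJ in \<open>auto simp: Q_def\<close>)
qed

section \<open>Risk bounds for a fixed sample size\<close>

context regression_family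
begin

lemma sets_sample_law: "sets (sample_law D f n \<mu> \<sigma> h) = sets (\<Pi>\<^sub>M i\<in>{..<n}. D \<Otimes>\<^sub>M borel)"
  unfolding sample_law_def by (intro sets_PiM_cong) auto

lemma space_sample_law: "space (sample_law D f n \<mu> \<sigma> h) = space (\<Pi>\<^sub>M i\<in>{..<n}. D \<Otimes>\<^sub>M borel)"
  using sets_sample_law by (rule sets_eq_imp_space_eq)

text \<open>The comparison constants are assumed rather than obtained inside, so that one
  \<open>K\<close> and one \<open>k\<close> serve all sample sizes and covers. The two logarithms
  add up to that of the size of the product of the covers.\<close>

lemma minimax_risk_upper:
  assumes KL: "0 \<le> K" "\<And>h \<mu> \<sigma> \<mu>' \<sigma>' v. h \<in> prob_densities D \<Longrightarrow> admissible \<mu> \<sigma> \<Longrightarrow> admissible \<mu>' \<sigma>' \<Longrightarrow> 0 \<le> v \<Longrightarrow>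
      sq_L2_dist D h \<mu> \<mu>' + sq_L2_dist D h \<sigma> \<sigma>' \<le> ennreal v \<Longrightarrow>
      integrable (observation_law D f \<mu> \<sigma> h) (\<lambda>z. ln (lik_ratio \<mu> \<sigma> \<mu>' \<sigma>' z)) \<and>
      - (\<integral>z. ln (lik_ratio \<mu> \<sigma> \<mu>' \<sigma>' z) \<partial>observation_law D f \<mu> \<sigma> h) \<le> K * v"
    and aff: "0 < k" "\<And>h \<mu> \<sigma> \<mu>' \<sigma>'. h \<in> prob_densities D \<Longrightarrow> admissible \<mu> \<sigma> \<Longrightarrow> admissible \<mu>' \<sigma>' \<Longrightarrow>
      sq_L2_dist D h \<mu> \<mu>' \<noteq> \<top> \<and> k * enn2real (sq_L2_dist D h \<mu> \<mu>')
        \<le> 2 * (1 - (\<integral>z. sqrt (lik_ratio \<mu> \<sigma> \<mu>' \<sigma>' z) \<partial>observation_law D f \<mu> \<sigma> h))"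
    and H: "H \<subseteq> prob_densities D" "h0 \<in> H" "\<forall>h\<in>H. \<forall>x\<in>space D. h x \<le> C * h0 x"
    and adm: "\<And>\<mu> \<sigma>. \<mu> \<in> U \<Longrightarrow> \<sigma> \<in> S \<Longrightarrow> admissible \<mu> \<sigma>"
    and NU: "finite NU" "NU \<subseteq> U" "NU \<noteq> {}" "\<And>\<mu>. \<mu> \<in> U \<Longrightarrow> \<exists>\<nu>\<in>NU. sq_L2_dist D h0 \<mu> \<nu> \<le> ennreal (\<epsilon>\<^sup>2)"
    and NS: "finite NS" "NS \<subseteq> S" "NS \<noteq> {}" "\<And>\<sigma>. \<sigma> \<in> S \<Longrightarrow> \<exists>\<nu>\<in>NS. sq_L2_dist D h0 \<sigma> \<nu> \<le> ennreal (\<epsilon>\<^sup>2)"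
    and n: "0 < n"
  shows "minimax_risk D f U S H n
    \<le> ennreal ((2 * (ln (real (card NU)) + ln (real (card NS))) / real n + K * (2 * \<bar>C\<bar> * \<epsilon>\<^sup>2)) / k)"
proof -
  define J where "J = NU \<times> NS"
  have J: "finite J" "J \<noteq> {}" using NU NS by (auto simp: J_def)
  have admJ: "admissible (fst j) (snd j)" if "j \<in> J" for j
    using that NU(2) NS(2) by (auto simp: J_def intro!: adm)
  let ?Z = "\<Pi>\<^sub>M i\<in>{..<n}. D \<Otimes>\<^sub>M (borel :: real measure)"
  define L where "L j z = (\<Prod>i<n. lik (fst j) (snd j) (z i))" for j and z :: "nat \<Rightarrow> 'a \<times> real"
  have Lm: "L j \<in> borel_measurable ?Z" if "j \<in> J" for j
  proof -
    note lik_measurable[OF admJ[OF that], measurable]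
    show ?thesis unfolding L_def[abs_def] by measurable
  qed
  obtain s where sm: "s \<in> measurable ?Z (count_space J)" and smax: "\<And>z j. j \<in> J \<Longrightarrow> L j z \<le> L (s z) z"
    and sJ: "\<And>z. s z \<in> J"
    using measurable_argmax[of J L ?Z, OF J Lm] by blast
  define m where "m z = fst (s z)" for z
  have "(\<lambda>(z, x). m z x) \<in> borel_measurable (?Z \<Otimes>\<^sub>M D)"
  proof -
    have "(\<lambda>p. fst (s (fst p)) (snd p)) \<in> borel_measurable (?Z \<Otimes>\<^sub>M D)"
    proof (rule measurable_compose_countable'[where I=J and g="\<lambda>p. s (fst p)"])
      show "(\<lambda>p. fst j (snd p)) \<in> borel_measurable (?Z \<Otimes>\<^sub>M D)" if "j \<in> J" for j
        using admJ[OF that] by (intro measurable_compose[OF measurable_snd]) (simp add: admissible_def)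
      show "(\<lambda>p. s (fst p)) \<in> measurable (?Z \<Otimes>\<^sub>M D) (count_space J)"
        using sm by (rule measurable_compose[OF measurable_fst])
    qed (use J in \<open>auto intro: countable_finite\<close>)
    then show ?thesis by (simp add: m_def case_prod_beta)
  qed
  then have est: "m \<in> estimators D n" by (simp add: estimators_def)
  let ?R = "(2 * (ln (real (card NU)) + ln (real (card NS))) / real n + K * (2 * \<bar>C\<bar> * \<epsilon>\<^sup>2)) / k"
  have "risk D f n \<mu> \<sigma> h m \<le> ennreal ?R" if \<mu>: "\<mu> \<in> U" and \<sigma>: "\<sigma> \<in> S" and hH: "h \<in> H" for \<mu> \<sigma> h
  proof -
    have h: "h \<in> prob_densities D" using H hH by auto
    have h0: "h0 \<in> prob_densities D" using H by auto
    have a: "admissible \<mu> \<sigma>" using adm \<mu> \<sigma> .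
    let ?P = "observation_law D f \<mu> \<sigma> h"
    obtain \<mu>' \<sigma>' where j0: "\<mu>' \<in> NU" "\<sigma>' \<in> NS" "sq_L2_dist D h0 \<mu> \<mu>' \<le> ennreal (\<epsilon>\<^sup>2)"
      "sq_L2_dist D h0 \<sigma> \<sigma>' \<le> ennreal (\<epsilon>\<^sup>2)"
      using NU(4)[OF \<mu>] NS(4)[OF \<sigma>] by auto
    have a': "admissible \<mu>' \<sigma>'" using j0 NU(2) NS(2) by (intro adm) auto
    have "sq_L2_dist D h \<mu> \<mu>' + sq_L2_dist D h \<sigma> \<sigma>'
        \<le> ennreal \<bar>C\<bar> * sq_L2_dist D h0 \<mu> \<mu>' + ennreal \<bar>C\<bar> * sq_L2_dist D h0 \<sigma> \<sigma>'"
      using H hH h0 a a'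
      by (intro add_mono sq_L2_dist_change_density) (auto simp: prob_densities_def admissible_def)
    also have "\<dots> \<le> ennreal \<bar>C\<bar> * ennreal (\<epsilon>\<^sup>2) + ennreal \<bar>C\<bar> * ennreal (\<epsilon>\<^sup>2)"
      using j0 by (intro add_mono mult_left_mono) auto
    also have "\<dots> = ennreal (2 * \<bar>C\<bar> * \<epsilon>\<^sup>2)" by (simp flip: ennreal_mult ennreal_plus)
    finally have kl: "integrable ?P (\<lambda>z. ln (lik_ratio \<mu> \<sigma> \<mu>' \<sigma>' z))"
      "- (\<integral>z. ln (lik_ratio \<mu> \<sigma> \<mu>' \<sigma>' z) \<partial>?P) \<le> K * (2 * \<bar>C\<bar> * \<epsilon>\<^sup>2)"
      using KL(2)[OF h a a', of "2 * \<bar>C\<bar> * \<epsilon>\<^sup>2"] by auto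
    define r where "r j = lik_ratio \<mu> \<sigma> (fst j) (snd j)" for j
    \<comment> \<open>\<open>likelihood_selection_bound\<close> needs a real loss; finiteness of the
      distances allows the passage back to \<open>ennreal\<close> after division by
      \<open>k\<close>.\<close>
    define l where "l j = k * enn2real (sq_L2_dist D h \<mu> (fst j))" for j :: "('a \<Rightarrow> real) \<times> ('a \<Rightarrow> real)"
    have fin: "sq_L2_dist D h \<mu> (fst j) \<noteq> \<top>" if "j \<in> J" for j
      using aff(2)[OF h a admJ[OF that]] by blast
    have sel: "(\<integral>\<^sup>+z. ennreal (l (s z)) \<partial>PiM {..<n} (\<lambda>_. ?P))
        \<le> ennreal (2 * ln (real (card J)) / real (card {..<n}) + K * (2 * \<bar>C\<bar> * \<epsilon>\<^sup>2))"
    proof (rule likelihood_selection_bound[where r=r and jr="(\<mu>', \<sigma>')"])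
      show "prob_space ?P" by (rule prob_space_observation_law[OF h a])
      show "prob_space (density ?P (r j))" if "j \<in> J" for j
        unfolding r_def density_lik_ratio[OF h a admJ[OF that]]
        by (rule prob_space_observation_law[OF h admJ[OF that]])
      show "(\<mu>', \<sigma>') \<in> J" using j0 by (simp add: J_def)
      show "r j \<in> borel_measurable ?P" if "j \<in> J" for j
        unfolding r_def by (rule lik_ratio_measurable[OF a admJ[OF that]])
      show "0 < r j x" if "j \<in> J" "x \<in> space ?P" for j x
        unfolding r_def using lik_ratio_pos[OF a admJ[OF that(1)]] that by simp
      show "l j \<le> 2 * (1 - (\<integral>x. sqrt (r j x) \<partial>?P))" if "j \<in> J" for j
        unfolding l_def r_def using aff(2)[OF h a admJ[OF that]] by blast
      show "0 \<le> l j" for j using aff(1) by (simp add: l_def)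
      fix z assume z: "z \<in> space (PiM {..<n} (\<lambda>_. ?P))"
      \<comment> \<open>Dividing all likelihoods by the one at the truth changes no comparison, so
        the maximizer of \<open>L\<close> also maximizes the ratios.\<close>
      have q: "(\<Prod>i\<in>{..<n}. r j (z i)) = L j z / (\<Prod>i<n. lik \<mu> \<sigma> (z i))" for j
        by (simp add: r_def lik_ratio_def L_def prod_dividef)
      have "0 < (\<Prod>i<n. lik \<mu> \<sigma> (z i))"
        using z by (intro prod_pos lik_pos[OF a]) (auto simp: space_PiM)
      then show "s z \<in> J \<and> (\<Prod>i\<in>{..<n}. r (\<mu>', \<sigma>') (z i)) \<le> (\<Prod>i\<in>{..<n}. r (s z) (z i))"
        unfolding q using sJ smax[of "(\<mu>', \<sigma>')" z] j0 by (auto simp: J_def intro!: divide_right_mono)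
    qed (use J kl n in \<open>auto simp: r_def\<close>)
    have "risk D f n \<mu> \<sigma> h m = (\<integral>\<^sup>+z. ennreal (1 / k) * ennreal (l (s z)) \<partial>PiM {..<n} (\<lambda>_. ?P))"
      unfolding risk_def sample_law_def
    proof (intro nn_integral_cong)
      fix z
      show "sq_L2_dist D h \<mu> (m z) = ennreal (1 / k) * ennreal (l (s z))"
        using fin[OF sJ[of z]] aff(1) by (simp add: m_def l_def less_top[symmetric] flip: ennreal_mult)
    qed
    also have "\<dots> = ennreal (1 / k) * (\<integral>\<^sup>+z. ennreal (l (s z)) \<partial>PiM {..<n} (\<lambda>_. ?P))"
    proof (intro nn_integral_cmult)
      have "s \<in> measurable (PiM {..<n} (\<lambda>_. ?P)) (count_space J)"
        using sm measurable_cong_sets[OF sets_sample_law[of n \<mu> \<sigma> h] refl] unfolding sample_law_def by blast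
      then show "(\<lambda>z. ennreal (l (s z))) \<in> borel_measurable (PiM {..<n} (\<lambda>_. ?P))"
        by (rule measurable_compose) simp
    qed
    also have "\<dots> \<le> ennreal (1 / k) * ennreal (2 * ln (real (card J)) / real n + K * (2 * \<bar>C\<bar> * \<epsilon>\<^sup>2))"
      using sel by (intro mult_left_mono) auto
    also have "\<dots> = ennreal ?R"
    proof -
      have c: "0 < card NU" "0 < card NS" using NU NS by (auto simp: card_gt_0_iff)
      then have "ln (real (card J)) = ln (real (card NU)) + ln (real (card NS))"
        by (simp add: J_def card_cartesian_product ln_mult)
      moreover have "0 \<le> ln (real (card NU))" "0 \<le> ln (real (card NS))" using c by auto
      ultimately show ?thesis using aff(1) KL(1)
        by (subst ennreal_mult[symmetric]) (auto intro!: add_nonneg_nonneg divide_nonneg_nonneg)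
    qed
    finally show ?thesis .
  qed
  then have "(SUP \<mu>\<in>U. SUP \<sigma>\<in>S. SUP h\<in>H. risk D f n \<mu> \<sigma> h m) \<le> ennreal ?R"
    by (intro SUP_least) auto
  then show ?thesis unfolding minimax_risk_def using est by (meson INF_lower2)
qed

text \<open>The probabilities of correct identification average to at most 1 / 2 over the packing,
  so some element is missed with probability at least 1 / 2. There the loss exceeds a quarter of the
  squared separation, which gives the eighth.\<close>

lemma minimax_risk_lower:
  assumes KL: "0 \<le> K" "\<And>h \<mu> \<sigma> \<mu>' \<sigma>' v. h \<in> prob_densities D \<Longrightarrow> admissible \<mu> \<sigma> \<Longrightarrow> admissible \<mu>' \<sigma>' \<Longrightarrow> 0 \<le> v \<Longrightarrow>
      sq_L2_dist D h \<mu> \<mu>' + sq_L2_dist D h \<sigma> \<sigma>' \<le> ennreal v \<Longrightarrow>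
      integrable (observation_law D f \<mu> \<sigma> h) (\<lambda>z. ln (lik_ratio \<mu> \<sigma> \<mu>' \<sigma>' z)) \<and>
      - (\<integral>z. ln (lik_ratio \<mu> \<sigma> \<mu>' \<sigma>' z) \<partial>observation_law D f \<mu> \<sigma> h) \<le> K * v"
    and H: "H \<subseteq> prob_densities D" "h0 \<in> H" and \<sigma>: "\<sigma> \<in> S"
    and adm: "\<And>\<mu> \<sigma>. \<mu> \<in> U \<Longrightarrow> \<sigma> \<in> S \<Longrightarrow> admissible \<mu> \<sigma>"
    and N: "packing_set D h0 U \<eta> N" "N \<noteq> {}"
    and V: "finite V" "V \<subseteq> U" "\<And>\<mu>. \<mu> \<in> U \<Longrightarrow> \<exists>\<nu>\<in>V. sq_L2_dist D h0 \<mu> \<nu> \<le> ennreal (\<epsilon>\<^sup>2)"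
    and t: "0 < t" "(real n * (K * \<epsilon>\<^sup>2) + 1) / t + exp t * real (card V) / real (card N) \<le> 1 / 2"
  shows "ennreal (\<eta>\<^sup>2 / 8) \<le> minimax_risk D f U S H n"
  unfolding minimax_risk_def
proof (rule INF_greatest)
  fix m assume m: "m \<in> estimators D n"
  let ?Z = "\<Pi>\<^sub>M i\<in>{..<n}. D \<Otimes>\<^sub>M (borel :: real measure)"
  have h0: "h0 \<in> prob_densities D" using H by auto
  interpret X: prob_space "density D h0" by (rule prob_space_covariate[OF h0])
  have NU: "finite N" "N \<subseteq> U" using N by (auto simp: packing_set_def)
  have cN: "0 < card N" using NU N(2) by (simp add: card_gt_0_iff)
  have aU: "admissible \<mu> \<sigma>" if "\<mu> \<in> U" for \<mu> using adm that \<sigma> .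
  have Um: "\<mu> \<in> borel_measurable D" if "\<mu> \<in> U" for \<mu> using aU[OF that] by (simp add: admissible_def)
  have mj: "(\<lambda>(z, x). m z x) \<in> borel_measurable (?Z \<Otimes>\<^sub>M D)" using m by (simp add: estimators_def)
  have mz: "m z \<in> borel_measurable D" if "z \<in> space ?Z" for z
    using measurable_Pair2[OF mj that] by simp
  define P where "P \<mu> = sample_law D f n \<mu> \<sigma> h0" for \<mu>
  have P_prob: "prob_space (P \<mu>)" if "\<mu> \<in> U" for \<mu>
    unfolding P_def sample_law_def
    by (intro prob_space_PiM prob_space_observation_law h0 aU that)
  have setsP[simp]: "sets (P \<mu>) = sets ?Z" and spaceP[simp]: "space (P \<mu>) = space ?Z" for \<mu>
    by (simp_all add: P_def sets_sample_law space_sample_law)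
  have dm: "(\<lambda>z. sq_L2_dist D h0 \<mu> (m z)) \<in> borel_measurable ?Z" if "\<mu> \<in> U" for \<mu>
  proof -
    note Um[OF that, measurable] mj[measurable]
    have "sets (?Z \<Otimes>\<^sub>M density D h0) = sets (?Z \<Otimes>\<^sub>M D)" by (intro sets_pair_measure_cong) auto
    moreover have "(\<lambda>(z, x). ennreal ((\<mu> x - m z x)\<^sup>2)) \<in> borel_measurable (?Z \<Otimes>\<^sub>M D)"
      using mj by (simp add: case_prod_beta) measurable
    ultimately have "(\<lambda>(z, x). ennreal ((\<mu> x - m z x)\<^sup>2)) \<in> borel_measurable (?Z \<Otimes>\<^sub>M density D h0)"
      by (simp cong: measurable_cong_sets)
    then have "(\<lambda>z. \<integral>\<^sup>+x. ennreal ((\<mu> x - m z x)\<^sup>2) \<partial>density D h0) \<in> borel_measurable ?Z"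
      by (rule X.borel_measurable_nn_integral)
    then show ?thesis
      by (rule measurable_cong[THEN iffD1, rotated]) (simp add: sq_L2_dist_density h0 mz Um that)
  qed
  \<comment> \<open>Half the separation as a radius: with the factors 2 of
    \<open>sq_L2_dist_triangle\<close>, a quarter of its square is what still keeps the events
    disjoint.\<close>
  define A where "A \<mu> = {z \<in> space ?Z. sq_L2_dist D h0 \<mu> (m z) \<le> ennreal (\<eta>\<^sup>2 / 4)}" for \<mu>
  have A: "A \<mu> \<in> sets ?Z" if "\<mu> \<in> U" for \<mu>
  proof -
    note dm[OF that, measurable]
    show ?thesis unfolding A_def by measurable
  qed
  have disj: "disjoint_family_on A N"
    unfolding disjoint_family_on_def
  proof (intro ballI impI)
    fix \<mu> \<nu> assume \<mu>\<nu>: "\<mu> \<in> N" "\<nu> \<in> N" "\<mu> \<noteq> \<nu>"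
    show "A \<mu> \<inter> A \<nu> = {}"
    proof (rule ccontr)
      assume "A \<mu> \<inter> A \<nu> \<noteq> {}"
      then obtain z where z: "z \<in> space ?Z" "sq_L2_dist D h0 \<mu> (m z) \<le> ennreal (\<eta>\<^sup>2 / 4)"
        "sq_L2_dist D h0 \<nu> (m z) \<le> ennreal (\<eta>\<^sup>2 / 4)" by (auto simp: A_def)
      have "sq_L2_dist D h0 \<mu> \<nu> \<le> 2 * sq_L2_dist D h0 \<mu> (m z) + 2 * sq_L2_dist D h0 \<nu> (m z)"
        using \<mu>\<nu> NU by (intro sq_L2_dist_triangle h0 Um mz z) auto
      also have "\<dots> \<le> ennreal 2 * ennreal (\<eta>\<^sup>2 / 4) + ennreal 2 * ennreal (\<eta>\<^sup>2 / 4)"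
        using z by (intro add_mono mult_mono) auto
      also have "\<dots> = ennreal (\<eta>\<^sup>2)" by (simp flip: ennreal_mult ennreal_plus del: ennreal_numeral)
      finally show False using N \<mu>\<nu> by (auto simp: packing_set_def not_le[symmetric])
    qed
  qed
  define w where "w = (real n * (K * \<epsilon>\<^sup>2) + 1) / t"
  have one: "measure (P \<mu>) (A \<mu>) \<le> w + exp t * (\<Sum>\<nu>\<in>V. measure (P \<nu>) (A \<mu>))" if \<mu>: "\<mu> \<in> N" for \<mu>
  proof -
    have \<mu>U: "\<mu> \<in> U" using \<mu> NU by auto
    obtain \<nu> where \<nu>: "\<nu> \<in> V" "sq_L2_dist D h0 \<mu> \<nu> \<le> ennreal (\<epsilon>\<^sup>2)" using V(3)[OF \<mu>U] by auto
    have \<nu>U: "\<nu> \<in> U" using \<nu> V by auto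
    let ?P = "observation_law D f \<mu> \<sigma> h0"
    have kl: "integrable ?P (\<lambda>z. ln (lik_ratio \<mu> \<sigma> \<nu> \<sigma> z))"
      "- (\<integral>z. ln (lik_ratio \<mu> \<sigma> \<nu> \<sigma> z) \<partial>?P) \<le> K * \<epsilon>\<^sup>2"
      using KL(2)[OF h0 aU[OF \<mu>U] aU[OF \<nu>U], of "\<epsilon>\<^sup>2"] \<nu> by auto
    have "measure (PiM {..<n} (\<lambda>_. ?P)) (A \<mu>) \<le> (real (card {..<n}) * (K * \<epsilon>\<^sup>2) + 1) / t
        + exp t * measure (PiM {..<n} (\<lambda>_. density ?P (lik_ratio \<mu> \<sigma> \<nu> \<sigma>))) (A \<mu>)"
    proof (rule change_of_measure_bound)
      show "prob_space ?P" by (rule prob_space_observation_law[OF h0 aU[OF \<mu>U]])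
      show "prob_space (density ?P (lik_ratio \<mu> \<sigma> \<nu> \<sigma>))"
        unfolding density_lik_ratio[OF h0 aU[OF \<mu>U] aU[OF \<nu>U]]
        by (rule prob_space_observation_law[OF h0 aU[OF \<nu>U]])
      show "lik_ratio \<mu> \<sigma> \<nu> \<sigma> \<in> borel_measurable ?P"
        by (rule lik_ratio_measurable[OF aU[OF \<mu>U] aU[OF \<nu>U]])
      show "0 < lik_ratio \<mu> \<sigma> \<nu> \<sigma> x" if "x \<in> space ?P" for x
        using lik_ratio_pos[OF aU[OF \<mu>U] aU[OF \<nu>U]] that by simp
      show "A \<mu> \<in> sets (PiM {..<n} (\<lambda>_. ?P))"
        using A[OF \<mu>U] sets_sample_law[of n \<mu> \<sigma> h0] by (simp add: sample_law_def)
    qed (use kl t in auto)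
    then have "measure (P \<mu>) (A \<mu>) \<le> w + exp t * measure (P \<nu>) (A \<mu>)"
      unfolding density_lik_ratio[OF h0 aU[OF \<mu>U] aU[OF \<nu>U]] by (simp add: P_def sample_law_def w_def)
    \<comment> \<open>The approximating \<nu> depends on \<mu>. Summing over all of \<open>V\<close>
      removes this dependence, so that the two sums can be exchanged and disjointness used under
      each law of the cover.\<close>
    also have "\<dots> \<le> w + exp t * (\<Sum>\<nu>\<in>V. measure (P \<nu>) (A \<mu>))"
      using V \<nu> by (intro add_left_mono mult_left_mono member_le_sum) auto
    finally show ?thesis .
  qed
  have tot: "(\<Sum>\<mu>\<in>N. measure (P \<nu>) (A \<mu>)) \<le> 1" if "\<nu> \<in> V" for \<nu>
  proof -
    interpret Q: prob_space "P \<nu>" using P_prob V that by auto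
    have "(\<Sum>\<mu>\<in>N. measure (P \<nu>) (A \<mu>)) = measure (P \<nu>) (\<Union>\<mu>\<in>N. A \<mu>)"
      using A NU disj by (intro Q.finite_measure_finite_Union[symmetric]) auto
    then show ?thesis by simp
  qed
  have "(\<Sum>\<mu>\<in>N. measure (P \<mu>) (A \<mu>)) \<le> (\<Sum>\<mu>\<in>N. w + exp t * (\<Sum>\<nu>\<in>V. measure (P \<nu>) (A \<mu>)))"
    using one by (rule sum_mono)
  also have "\<dots> = real (card N) * w + exp t * (\<Sum>\<mu>\<in>N. \<Sum>\<nu>\<in>V. measure (P \<nu>) (A \<mu>))"
    by (simp add: sum.distrib sum_distrib_left)
  also have "(\<Sum>\<mu>\<in>N. \<Sum>\<nu>\<in>V. measure (P \<nu>) (A \<mu>)) = (\<Sum>\<nu>\<in>V. \<Sum>\<mu>\<in>N. measure (P \<nu>) (A \<mu>))"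
    by (rule sum.swap)
  also have "\<dots> \<le> (\<Sum>\<nu>\<in>V. 1)" using tot by (rule sum_mono)
  finally have "(\<Sum>\<mu>\<in>N. measure (P \<mu>) (A \<mu>)) \<le> real (card N) * w + exp t * real (card V)" by simp
  also have "\<dots> = real (card N) * (w + exp t * real (card V) / real (card N))"
    using cN by (simp add: field_simps)
  also have "\<dots> \<le> real (card N) * (1 / 2)" using t(2) by (intro mult_left_mono) (auto simp: w_def)
  finally have sum_le: "(\<Sum>\<mu>\<in>N. measure (P \<mu>) (A \<mu>)) \<le> (\<Sum>\<mu>\<in>N. 1 / 2)" by simp
  have "\<exists>\<mu>\<in>N. measure (P \<mu>) (A \<mu>) \<le> 1 / 2"
  proof (rule ccontr)
    assume "\<not> ?thesis"
    then have "(\<Sum>\<mu>\<in>N. 1 / 2) < (\<Sum>\<mu>\<in>N. measure (P \<mu>) (A \<mu>))"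
      using NU N(2) by (intro sum_strict_mono) auto
    then show False using sum_le by simp
  qed
  then obtain \<mu> where \<mu>: "\<mu> \<in> N" "measure (P \<mu>) (A \<mu>) \<le> 1 / 2" by auto
  have \<mu>U: "\<mu> \<in> U" using \<mu> NU by auto
  interpret Q: prob_space "P \<mu>" by (rule P_prob[OF \<mu>U])
  have "ennreal (\<eta>\<^sup>2 / 8) = ennreal (\<eta>\<^sup>2 / 4) * ennreal (1 / 2)"
    by (simp flip: ennreal_mult del: ennreal_half)
  also have "\<dots> \<le> ennreal (\<eta>\<^sup>2 / 4) * emeasure (P \<mu>) (space ?Z - A \<mu>)"
  proof (intro mult_left_mono)
    have "1 / 2 \<le> measure (P \<mu>) (space ?Z - A \<mu>)"
      using Q.prob_compl[of "A \<mu>"] A[OF \<mu>U] \<mu> by simp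
    then show "ennreal (1 / 2) \<le> emeasure (P \<mu>) (space ?Z - A \<mu>)"
      unfolding Q.emeasure_eq_measure by (rule ennreal_leI)
  qed simp
  also have "\<dots> = (\<integral>\<^sup>+z. ennreal (\<eta>\<^sup>2 / 4) * indicator (space ?Z - A \<mu>) z \<partial>P \<mu>)"
    using A[OF \<mu>U] by (subst nn_integral_cmult_indicator) auto
  also have "\<dots> \<le> (\<integral>\<^sup>+z. sq_L2_dist D h0 \<mu> (m z) \<partial>P \<mu>)"
    by (intro nn_integral_mono) (auto simp: A_def split: split_indicator)
  also have "\<dots> = risk D f n \<mu> \<sigma> h0 m" by (simp add: risk_def P_def)
  also have "\<dots> \<le> (SUP h\<in>H. risk D f n \<mu> \<sigma> h m)" using H(2) by (rule SUP_upper)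
  also have "\<dots> \<le> (SUP \<sigma>\<in>S. SUP h\<in>H. risk D f n \<mu> \<sigma> h m)" using \<sigma> by (rule SUP_upper)
  also have "\<dots> \<le> (SUP \<mu>\<in>U. SUP \<sigma>\<in>S. SUP h\<in>H. risk D f n \<mu> \<sigma> h m)" using \<mu>U by (rule SUP_upper)
  finally show "ennreal (\<eta>\<^sup>2 / 8) \<le> (SUP \<mu>\<in>U. SUP \<sigma>\<in>S. SUP h\<in>H. risk D f n \<mu> \<sigma> h m)" .
qed

end

section \<open>Metric entropy and the minimax rate\<close>

text \<open>Finite entropy bounds the sizes of packings, so one of greatest size exists; a point it
  failed to cover could be added to it.\<close>

lemma maximal_packing_covers:
  assumes ent: "metric_entropy D h G \<epsilon> \<le> ennreal a" and a: "0 \<le> a"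
  obtains N where "packing_set D h G \<epsilon> N" "\<And>g. g \<in> G \<Longrightarrow> \<exists>g'\<in>N. sq_L2_dist D h g g' \<le> ennreal (\<epsilon>\<^sup>2)"
    "ln (real (card N)) \<le> a"
proof -
  have ln_le: "ln (real (card N)) \<le> a" if "packing_set D h G \<epsilon> N" for N
  proof -
    have "ennreal (ln (real (card N))) \<le> metric_entropy D h G \<epsilon>"
      unfolding metric_entropy_def using that by (intro SUP_upper) simp
    then have "ennreal (ln (real (card N))) \<le> ennreal a" using ent by (rule order.trans)
    then show ?thesis using a by simp
  qed
  have card_le: "card N \<le> nat \<lceil>exp a\<rceil>" if "packing_set D h G \<epsilon> N" for N
  proof (cases "card N = 0")
    case False
    then have "real (card N) = exp (ln (real (card N)))" by simp
    also have "\<dots> \<le> exp a" using ln_le[OF that] by simp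
    finally show ?thesis by linarith
  qed simp
  have "packing_set D h G \<epsilon> {}" by (simp add: packing_set_def)
  then obtain N where N: "packing_set D h G \<epsilon> N"
    and max: "\<And>N'. packing_set D h G \<epsilon> N' \<Longrightarrow> card N' \<le> card N"
    using ex_has_greatest_nat[of "packing_set D h G \<epsilon>" "{}" card "Suc (nat \<lceil>exp a\<rceil>)"] card_le
    by (auto simp: less_Suc_eq_le)
  show thesis
  proof (rule that[OF N _ ln_le[OF N]])
    fix g assume g: "g \<in> G"
    show "\<exists>g'\<in>N. sq_L2_dist D h g g' \<le> ennreal (\<epsilon>\<^sup>2)"
    proof (rule ccontr)
      assume "\<not> ?thesis"
      then have far: "\<And>g'. g' \<in> N \<Longrightarrow> ennreal (\<epsilon>\<^sup>2) < sq_L2_dist D h g g'" by (auto simp: not_le)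
      then have "packing_set D h G \<epsilon> (insert g N)"
        using N g by (auto simp: packing_set_def sq_L2_dist_commute[of D h _ g])
      moreover have "g \<notin> N" using far[of g] by auto
      ultimately show False using max[of "insert g N"] N by (simp add: packing_set_def)
    qed
  qed
qed

lemma metric_entropy_antimono:
  assumes "0 \<le> \<epsilon>" "\<epsilon> \<le> \<delta>"
  shows "metric_entropy D h G \<delta> \<le> metric_entropy D h G \<epsilon>"
  unfolding metric_entropy_def
proof (rule SUP_subset_mono)
  have "ennreal (\<epsilon>\<^sup>2) \<le> ennreal (\<delta>\<^sup>2)" using assms by (intro ennreal_leI power_mono) auto
  then show "{N. packing_set D h G \<delta> N} \<subseteq> {N. packing_set D h G \<epsilon> N}"
    unfolding packing_set_def by (blast intro: le_less_trans)
qed simp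

text \<open>Below \<open>\<epsilon>0\<close> the ratio in the definition of richness stays above
  some \<open>\<rho> > 1\<close>, and refining by \<open>\<alpha>\<close> never leaves this range,
  so the inequality can be iterated.\<close>

lemma rich_growth:
  assumes nonneg: "\<forall>\<epsilon>>0. 0 \<le> M \<epsilon>" and rich: "rich M"
  obtains \<alpha> \<rho> \<epsilon>0 where "0 < \<alpha>" "\<alpha> < 1" "1 < \<rho>" "0 < \<epsilon>0"
    "\<And>\<epsilon>. 0 < \<epsilon> \<Longrightarrow> \<epsilon> < \<epsilon>0 \<Longrightarrow> 0 < M \<epsilon>"
    "\<And>\<epsilon> j. 0 < \<epsilon> \<Longrightarrow> \<epsilon> < \<epsilon>0 \<Longrightarrow> \<rho> ^ j * M \<epsilon> \<le> M (\<alpha> ^ j * \<epsilon>)"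
proof -
  obtain \<alpha> where \<alpha>: "0 < \<alpha>" "\<alpha> < 1" and L: "1 < Liminf (at_right 0) (\<lambda>\<epsilon>. ereal (M (\<alpha> * \<epsilon>) / M \<epsilon>))"
    using rich by (auto simp: rich_def)
  obtain \<rho> where \<rho>: "1 < ereal \<rho>" "ereal \<rho> < Liminf (at_right 0) (\<lambda>\<epsilon>. ereal (M (\<alpha> * \<epsilon>) / M \<epsilon>))"
    using ereal_dense2[OF L] by blast
  have \<rho>1: "1 < \<rho>" using \<rho>(1) by simp
  have "eventually (\<lambda>\<epsilon>. ereal \<rho> < ereal (M (\<alpha> * \<epsilon>) / M \<epsilon>)) (at_right 0)"
    using less_LiminfD[OF \<rho>(2)] .
  then obtain \<epsilon>0 where \<epsilon>0: "0 < \<epsilon>0" and r: "\<And>\<epsilon>. 0 < \<epsilon> \<Longrightarrow> \<epsilon> < \<epsilon>0 \<Longrightarrow> \<rho> < M (\<alpha> * \<epsilon>) / M \<epsilon>"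
    by (auto simp: eventually_at_right_field)
  \<comment> \<open>If \<open>M \<epsilon>\<close> were 0, the quotient would be 0 by the convention
    for division by zero, contradicting \<open>\<rho> > 1\<close>.\<close>
  have pos: "0 < M \<epsilon>" if "0 < \<epsilon>" "\<epsilon> < \<epsilon>0" for \<epsilon>
    using r[OF that] \<rho>1 nonneg that by (cases "M \<epsilon> = 0") (auto simp: order.order_iff_strict)
  have step: "\<rho> * M \<epsilon> \<le> M (\<alpha> * \<epsilon>)" if "0 < \<epsilon>" "\<epsilon> < \<epsilon>0" for \<epsilon>
    using r[OF that] pos[OF that] by (simp add: field_simps)
  have "\<rho> ^ j * M \<epsilon> \<le> M (\<alpha> ^ j * \<epsilon>)" if \<epsilon>: "0 < \<epsilon>" "\<epsilon> < \<epsilon>0" for \<epsilon> j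
  proof (induction j)
    case (Suc j)
    have "\<alpha> ^ j * \<epsilon> \<le> 1 * \<epsilon>" using \<alpha> \<epsilon> by (intro mult_right_mono power_le_one) auto
    then have "\<alpha> ^ j * \<epsilon> < \<epsilon>0" using \<epsilon> by linarith
    then have "\<rho> * M (\<alpha> ^ j * \<epsilon>) \<le> M (\<alpha> * (\<alpha> ^ j * \<epsilon>))" using \<alpha> \<epsilon> by (intro step) auto
    moreover have "\<rho> * (\<rho> ^ j * M \<epsilon>) \<le> \<rho> * M (\<alpha> ^ j * \<epsilon>)" using Suc \<rho>1 by (intro mult_left_mono) auto
    ultimately show ?case by (simp add: mult.assoc)
  qed simp
  then show thesis using that[OF \<alpha> \<rho>1 \<epsilon>0 pos] by blast
qed

text \<open>At the critical radius the estimation term \<open>M (e n) / n\<close> equals the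
  approximation term, the square of \<open>e n\<close>, so the upper bound is of that order; the
  lower bound differs only by constants independent of n.\<close>

lemma (in regression_family) minimax_rate:
  assumes H: "H \<subseteq> prob_densities D"
    and U_measurable: "U \<subseteq> borel_measurable D"
    and U_bounded: "\<forall>\<mu>\<in>U. \<forall>x\<in>space D. \<bar>\<mu> x\<bar> \<le> B"
    and S_nonempty: "S \<noteq> {}"
    and S_measurable: "S \<subseteq> borel_measurable D"
    and S_bounded: "\<forall>\<sigma>\<in>S. \<forall>x\<in>space D. inverse \<sigma>bar \<le> \<sigma> x \<and> \<sigma> x \<le> \<sigma>bar"
    and h0: "h0 \<in> H"
    and ratio_bounded: "\<forall>h\<in>H. \<forall>x\<in>space D. h x \<le> C * h0 x"
    and M_nonneg: "\<forall>\<epsilon>>0. 0 \<le> M \<epsilon>"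
    and M_order: "same_order (at_right 0) (metric_entropy D h0 U) (\<lambda>\<epsilon>. ennreal (M \<epsilon>))"
    and M_rich: "rich M"
    and S_entropy: "ennreal_bigo (at_right 0) (metric_entropy D h0 S) (metric_entropy D h0 U)"
    and e: "critical_radius M e"
  shows "same_order sequentially (minimax_risk D f U S H) (\<lambda>n. ennreal ((e n)\<^sup>2))"
proof -
  have adm: "admissible \<mu> \<sigma>" if "\<mu> \<in> U" "\<sigma> \<in> S" for \<mu> \<sigma>
    using that U_measurable U_bounded S_measurable S_bounded
    by (auto simp: admissible_def intro: order.trans[OF _ abs_ge_self])
  obtain K where KL: "0 \<le> K" "\<And>h \<mu> \<sigma> \<mu>' \<sigma>' v. h \<in> prob_densities D \<Longrightarrow> admissible \<mu> \<sigma> \<Longrightarrow> admissible \<mu>' \<sigma>' \<Longrightarrow> 0 \<le> v \<Longrightarrow>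
      sq_L2_dist D h \<mu> \<mu>' + sq_L2_dist D h \<sigma> \<sigma>' \<le> ennreal v \<Longrightarrow>
      integrable (observation_law D f \<mu> \<sigma> h) (\<lambda>z. ln (lik_ratio \<mu> \<sigma> \<mu>' \<sigma>' z)) \<and>
      - (\<integral>z. ln (lik_ratio \<mu> \<sigma> \<mu>' \<sigma>' z) \<partial>observation_law D f \<mu> \<sigma> h) \<le> K * v"
    using KL_le_sq_L2_dist by blast
  obtain k where aff: "0 < k" "\<And>h \<mu> \<sigma> \<mu>' \<sigma>'. h \<in> prob_densities D \<Longrightarrow> admissible \<mu> \<sigma> \<Longrightarrow> admissible \<mu>' \<sigma>' \<Longrightarrow>
      sq_L2_dist D h \<mu> \<mu>' \<noteq> \<top> \<and> k * enn2real (sq_L2_dist D h \<mu> \<mu>')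
        \<le> 2 * (1 - (\<integral>z. sqrt (lik_ratio \<mu> \<sigma> \<mu>' \<sigma>' z) \<partial>observation_law D f \<mu> \<sigma> h))"
    using sq_L2_dist_le_hellinger by blast
  obtain \<alpha> \<rho> \<epsilon>0 where \<alpha>: "0 < \<alpha>" "\<alpha> < 1" and \<rho>: "1 < \<rho>" and \<epsilon>0: "0 < \<epsilon>0"
    and M_pos: "\<And>\<epsilon>. 0 < \<epsilon> \<Longrightarrow> \<epsilon> < \<epsilon>0 \<Longrightarrow> 0 < M \<epsilon>"
    and growth: "\<And>\<epsilon> j. 0 < \<epsilon> \<Longrightarrow> \<epsilon> < \<epsilon>0 \<Longrightarrow> \<rho> ^ j * M \<epsilon> \<le> M (\<alpha> ^ j * \<epsilon>)"
    using rich_growth[OF M_nonneg M_rich] by metis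
  define ent where "ent = metric_entropy D h0 U"
  obtain a1 a2 a3 where a:
    "eventually (\<lambda>\<epsilon>. ent \<epsilon> \<le> ennreal a1 * ennreal (M \<epsilon>)) (at_right 0)"
    "eventually (\<lambda>\<epsilon>. ennreal (M \<epsilon>) \<le> ennreal a2 * ent \<epsilon>) (at_right 0)"
    "eventually (\<lambda>\<epsilon>. metric_entropy D h0 S \<epsilon> \<le> ennreal a3 * ent \<epsilon>) (at_right 0)"
    using M_order S_entropy by (auto simp: same_order_def ennreal_bigo_def ent_def)
  \<comment> \<open>One constant for all three order relations, at least 1 so that it can only
    enlarge bounds.\<close>
  define A where "A = max 1 (max a1 (max a2 a3))"
  have A: "1 \<le> A" "a1 \<le> A" "a2 \<le> A" "a3 \<le> A" by (auto simp: A_def)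
  have "eventually (\<lambda>\<epsilon>. \<epsilon> < \<epsilon>0 \<and> ent \<epsilon> \<le> ennreal (A * M \<epsilon>) \<and> ennreal (M \<epsilon>) \<le> ennreal A * ent \<epsilon>
      \<and> metric_entropy D h0 S \<epsilon> \<le> ennreal (A * A * M \<epsilon>)) (at_right 0)"
    using a eventually_at_right_real[OF \<epsilon>0]
  proof eventually_elim
    case (elim \<epsilon>)
    have m: "0 \<le> M \<epsilon>" using M_nonneg elim by auto
    have 1: "ent \<epsilon> \<le> ennreal (A * M \<epsilon>)"
    proof -
      have "ennreal a1 * ennreal (M \<epsilon>) \<le> ennreal A * ennreal (M \<epsilon>)"
        using A by (intro mult_right_mono ennreal_leI) auto
      then show ?thesis using elim(1) A m by (simp add: ennreal_mult order.trans)
    qed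
    have 2: "ennreal (M \<epsilon>) \<le> ennreal A * ent \<epsilon>"
      using elim(2) A by (meson ennreal_leI mult_right_mono order.trans zero_le)
    have "metric_entropy D h0 S \<epsilon> \<le> ennreal A * ent \<epsilon>"
      using elim(3) A by (meson ennreal_leI mult_right_mono order.trans zero_le)
    also have "\<dots> \<le> ennreal A * ennreal (A * M \<epsilon>)" using 1 by (intro mult_left_mono) auto
    also have "\<dots> = ennreal (A * A * M \<epsilon>)" using A m by (simp add: mult.assoc flip: ennreal_mult)
    finally show ?case using 1 2 elim by auto
  qed
  then obtain \<epsilon>1 where \<epsilon>1: "0 < \<epsilon>1" and near: "\<And>\<epsilon>. 0 < \<epsilon> \<Longrightarrow> \<epsilon> < \<epsilon>1 \<Longrightarrow> \<epsilon> < \<epsilon>0 \<and> ent \<epsilon> \<le> ennreal (A * M \<epsilon>)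
      \<and> ennreal (M \<epsilon>) \<le> ennreal A * ent \<epsilon> \<and> metric_entropy D h0 S \<epsilon> \<le> ennreal (A * A * M \<epsilon>)"
    unfolding eventually_at_right_field by auto
  \<comment> \<open>\<open>M\<close> is only an order of the entropy and need not be monotone. The
    entropy is, and two passages between them cost \<open>A\<close> each.\<close>
  have M_almost_antimono: "M \<delta> \<le> A * A * M \<epsilon>" if "0 < \<epsilon>" "\<epsilon> \<le> \<delta>" "\<delta> < \<epsilon>1" for \<epsilon> \<delta>
  proof -
    have "ennreal (M \<delta>) \<le> ennreal A * ent \<delta>" using near[of \<delta>] that by auto
    also have "\<dots> \<le> ennreal A * ent \<epsilon>"
      unfolding ent_def using that by (intro mult_left_mono metric_entropy_antimono) auto
    also have "\<dots> \<le> ennreal A * ennreal (A * M \<epsilon>)" using near[of \<epsilon>] that by (intro mult_left_mono) auto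
    also have "\<dots> = ennreal (A * A * M \<epsilon>)" using A M_nonneg that by (simp add: mult.assoc flip: ennreal_mult)
    finally show ?thesis using A M_nonneg that by simp
  qed
  \<comment> \<open>Needed to absorb additive constants into multiples of \<open>M\<close>. Richness
    gives growth along a geometric sequence only; almost monotonicity extends it to the radii in
    between.\<close>
  have M_large: "\<exists>\<delta>>0. \<forall>\<epsilon>. 0 < \<epsilon> \<and> \<epsilon> < \<delta> \<longrightarrow> 1 \<le> M \<epsilon>"
  proof -
    define x where "x = \<epsilon>1 / 2"
    have x: "0 < x" "x < \<epsilon>1" "x < \<epsilon>0" using \<epsilon>1 near[of x] by (auto simp: x_def)
    have Mx: "0 < M x" using M_pos x by auto
    obtain j where j: "A * A / M x < \<rho> ^ j" using real_arch_pow[OF \<rho>] by blast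
    have "\<alpha> ^ j * x \<le> 1 * x" using \<alpha> x by (intro mult_right_mono power_le_one) auto
    then have xj: "\<alpha> ^ j * x < \<epsilon>1" using x by linarith
    show ?thesis
    proof (intro exI[of _ "\<alpha> ^ j * x"] conjI allI impI)
      show "0 < \<alpha> ^ j * x" using \<alpha> x by simp
      fix \<epsilon> assume \<epsilon>: "0 < \<epsilon> \<and> \<epsilon> < \<alpha> ^ j * x"
      have "A * A < \<rho> ^ j * M x" using j Mx by (simp add: field_simps)
      also have "\<dots> \<le> M (\<alpha> ^ j * x)" by (rule growth) (use x in auto)
      also have "\<dots> \<le> A * A * M \<epsilon>" using \<epsilon> xj x by (intro M_almost_antimono) auto
      finally show "1 \<le> M \<epsilon>" using A by (simp add: mult_less_cancel_left1)
    qed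
  qed
  then obtain \<epsilon>2 where \<epsilon>2: "0 < \<epsilon>2" "\<And>\<epsilon>. 0 < \<epsilon> \<Longrightarrow> \<epsilon> < \<epsilon>2 \<Longrightarrow> 1 \<le> M \<epsilon>" by auto
  have ev: "eventually (\<lambda>n. 0 < n \<and> 0 < e n \<and> M (e n) = real n * (e n)\<^sup>2 \<and> e n < \<epsilon>1 \<and> e n < \<epsilon>2) sequentially"
  proof -
    have "e \<longlonglongrightarrow> 0" using e by (simp add: critical_radius_def)
    then have "eventually (\<lambda>n. e n < \<epsilon>1) sequentially" "eventually (\<lambda>n. e n < \<epsilon>2) sequentially"
      using \<epsilon>1 \<epsilon>2 by (auto intro: order_tendstoD)
    moreover have "eventually (\<lambda>n. 0 < e n \<and> M (e n) = real n * (e n)\<^sup>2) sequentially"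
      using e by (simp add: critical_radius_def)
    ultimately show ?thesis using eventually_gt_at_top[of 0] by eventually_elim auto
  qed
  have cover: thesis if \<epsilon>: "0 < \<epsilon>" "\<epsilon> < \<epsilon>1"
    and r: "\<And>NU NS. finite NU \<Longrightarrow> NU \<subseteq> U \<Longrightarrow> finite NS \<Longrightarrow> NS \<subseteq> S \<Longrightarrow>
      (\<And>\<mu>. \<mu> \<in> U \<Longrightarrow> \<exists>\<nu>\<in>NU. sq_L2_dist D h0 \<mu> \<nu> \<le> ennreal (\<epsilon>\<^sup>2)) \<Longrightarrow>
      (\<And>\<mu>. \<mu> \<in> S \<Longrightarrow> \<exists>\<nu>\<in>NS. sq_L2_dist D h0 \<mu> \<nu> \<le> ennreal (\<epsilon>\<^sup>2)) \<Longrightarrow>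
      ln (real (card NU)) \<le> A * M \<epsilon> \<Longrightarrow> ln (real (card NS)) \<le> A * A * M \<epsilon> \<Longrightarrow> thesis" for \<epsilon> thesis
  proof -
    have m: "0 \<le> M \<epsilon>" using M_nonneg \<epsilon> by auto
    obtain NU where NU: "packing_set D h0 U \<epsilon> NU"
      "\<And>g. g \<in> U \<Longrightarrow> \<exists>g'\<in>NU. sq_L2_dist D h0 g g' \<le> ennreal (\<epsilon>\<^sup>2)" "ln (real (card NU)) \<le> A * M \<epsilon>"
      using maximal_packing_covers[of D h0 U \<epsilon> "A * M \<epsilon>"] near[OF \<epsilon>] A m by (auto simp: ent_def)
    obtain NS where NS: "packing_set D h0 S \<epsilon> NS"
      "\<And>g. g \<in> S \<Longrightarrow> \<exists>g'\<in>NS. sq_L2_dist D h0 g g' \<le> ennreal (\<epsilon>\<^sup>2)" "ln (real (card NS)) \<le> A * A * M \<epsilon>"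
      using maximal_packing_covers[of D h0 S \<epsilon> "A * A * M \<epsilon>"] near[OF \<epsilon>] A m by auto
    show thesis using NU NS by (intro r) (auto simp: packing_set_def)
  qed
  \<comment> \<open>The empty class has only the empty packing, hence entropy 0 as
    \<open>ln 0 = 0\<close>, whereas \<open>M\<close> is positive near 0.\<close>
  have U_nonempty: "U \<noteq> {}"
  proof
    assume "U = {}"
    then have "ent \<epsilon> = 0" for \<epsilon>
      by (auto simp: ent_def metric_entropy_def packing_set_def intro!: antisym SUP_least)
    then show False using near[of "\<epsilon>1 / 2"] M_pos[of "\<epsilon>1 / 2"] \<epsilon>1 by auto
  qed
  have upper: "ennreal_bigo sequentially (minimax_risk D f U S H) (\<lambda>n. ennreal ((e n)\<^sup>2))"
    unfolding ennreal_bigo_def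
  proof (intro exI eventually_mono[OF ev])
    fix n assume n: "0 < n \<and> 0 < e n \<and> M (e n) = real n * (e n)\<^sup>2 \<and> e n < \<epsilon>1 \<and> e n < \<epsilon>2"
    show "minimax_risk D f U S H n \<le> ennreal ((2 * (A + A * A) + K * (2 * \<bar>C\<bar>)) / k) * ennreal ((e n)\<^sup>2)"
    proof (rule cover[of "e n"])
      fix NU NS
      assume NU: "finite NU" "NU \<subseteq> U" "\<And>\<mu>. \<mu> \<in> U \<Longrightarrow> \<exists>\<nu>\<in>NU. sq_L2_dist D h0 \<mu> \<nu> \<le> ennreal ((e n)\<^sup>2)"
        "ln (real (card NU)) \<le> A * M (e n)"
        and NS: "finite NS" "NS \<subseteq> S" "\<And>\<sigma>. \<sigma> \<in> S \<Longrightarrow> \<exists>\<nu>\<in>NS. sq_L2_dist D h0 \<sigma> \<nu> \<le> ennreal ((e n)\<^sup>2)"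
        "ln (real (card NS)) \<le> A * A * M (e n)"
      have ne: "NU \<noteq> {}" "NS \<noteq> {}" using NU(3) NS(3) U_nonempty S_nonempty by auto
      have "minimax_risk D f U S H n
        \<le> ennreal ((2 * (ln (real (card NU)) + ln (real (card NS))) / real n + K * (2 * \<bar>C\<bar> * (e n)\<^sup>2)) / k)"
        using n by (intro minimax_risk_upper[OF KL aff H h0 ratio_bounded adm NU(1,2) ne(1) NU(3) NS(1,2) ne(2) NS(3)]) auto
      also have "\<dots> \<le> ennreal ((2 * (A * M (e n) + A * A * M (e n)) / real n + K * (2 * \<bar>C\<bar> * (e n)\<^sup>2)) / k)"
        using NU(4) NS(4) aff(1) n
        by (intro ennreal_leI divide_right_mono add_right_mono mult_left_mono add_mono) auto
      also have "(2 * (A * M (e n) + A * A * M (e n)) / real n + K * (2 * \<bar>C\<bar> * (e n)\<^sup>2)) / k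
          = (2 * (A + A * A) + K * (2 * \<bar>C\<bar>)) / k * (e n)\<^sup>2"
        using n aff(1) by (simp add: field_simps)
      finally show ?thesis by (simp only: ennreal_mult'' zero_le_power2)
    qed (use n in auto)
  qed
  obtain \<sigma> where \<sigma>: "\<sigma> \<in> S" using S_nonempty by auto
  \<comment> \<open>For \<open>x \<ge> 1\<close> this gives
    \<open>4 * (K * x + 1) + A * x + 2 \<le> Q * x\<close>: the threshold \<open>t\<close>, the
    logarithm of the size of the cover, and a margin of 2.\<close>
  define Q where "Q = 4 * K + A + 6"
  \<comment> \<open>Enough refinements for the growth to beat \<open>Q\<close> even after the loss
    of \<open>A\<close> between \<open>M\<close> and the entropy; \<open>j\<close> is fixed before
    n.\<close>
  obtain j where j: "A * Q < \<rho> ^ j" using real_arch_pow[OF \<rho>] by blast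
  have lower: "ennreal_bigo sequentially (\<lambda>n. ennreal ((e n)\<^sup>2)) (minimax_risk D f U S H)"
    unfolding ennreal_bigo_def
  proof (intro exI eventually_mono[OF ev])
    fix n assume n: "0 < n \<and> 0 < e n \<and> M (e n) = real n * (e n)\<^sup>2 \<and> e n < \<epsilon>1 \<and> e n < \<epsilon>2"
    define x where "x = M (e n)"
    have x: "1 \<le> x" using n \<epsilon>2(2)[of "e n"] by (simp add: x_def)
    define \<eta> where "\<eta> = \<alpha> ^ j * e n"
    have \<eta>: "0 < \<eta>" "\<eta> < \<epsilon>1"
    proof -
      show "0 < \<eta>" using \<alpha> n by (simp add: \<eta>_def)
      have "\<eta> \<le> 1 * e n" unfolding \<eta>_def using \<alpha> n by (intro mult_right_mono power_le_one) auto
      then show "\<eta> < \<epsilon>1" using n by simp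
    qed
    have Q0: "0 \<le> Q" using KL A by (simp add: Q_def)
    have "ennreal (Q * x) < ent \<eta>"
    proof (rule ccontr)
      assume "\<not> ?thesis"
      then have le: "ent \<eta> \<le> ennreal (Q * x)" by (simp add: not_less)
      have "ennreal (\<rho> ^ j * x) \<le> ennreal (M \<eta>)"
        unfolding \<eta>_def x_def using growth[of "e n" j] near[of "e n"] n by (intro ennreal_leI) auto
      also have "\<dots> \<le> ennreal A * ent \<eta>" using near[OF \<eta>] by auto
      also have "\<dots> \<le> ennreal A * ennreal (Q * x)" using le by (intro mult_left_mono) auto
      also have "\<dots> = ennreal (A * Q * x)" using A Q0 x by (simp add: mult.assoc flip: ennreal_mult)
      finally have "\<rho> ^ j * x \<le> A * Q * x" using A Q0 x by simp
      then show False using j x by simp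
    qed
    then obtain N where N: "packing_set D h0 U \<eta> N" "ennreal (Q * x) < ennreal (ln (real (card N)))"
      unfolding ent_def metric_entropy_def by (auto simp: less_SUP_iff)
    have lnN: "Q * x < ln (real (card N))"
      using N(2) Q0 x by (simp add: ennreal_less_iff)
    have Qx: "0 \<le> Q * x" using Q0 x by (intro mult_nonneg_nonneg) auto
    have Nne: "N \<noteq> {}"
    proof
      \<comment> \<open>Since \<open>ln 0 = 0\<close>, an empty packing cannot exceed the
        nonnegative bound \<open>Q * x\<close>.\<close>
      assume "N = {}"
      then show False using lnN Qx by simp
    qed
    have cN: "0 < card N" using N(1) Nne by (simp add: packing_set_def card_gt_0_iff)
    have risk_lower: "ennreal (\<eta>\<^sup>2 / 8) \<le> minimax_risk D f U S H n"
    proof (rule cover[of "e n"])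
      fix V NS
      assume V: "finite V" "V \<subseteq> U" "\<And>\<mu>. \<mu> \<in> U \<Longrightarrow> \<exists>\<nu>\<in>V. sq_L2_dist D h0 \<mu> \<nu> \<le> ennreal ((e n)\<^sup>2)"
        "ln (real (card V)) \<le> A * M (e n)"
      have "V \<noteq> {}" using V(3) U_nonempty by auto
      then have cV: "0 < card V" using V by (simp add: card_gt_0_iff)
      \<comment> \<open>Chosen so that the Markov term equals 1 / 4, because \<open>n\<close> times
        the squared radius is \<open>x\<close>; the other quarter is left for the
        cardinalities.\<close>
      define t where "t = 4 * (K * x + 1)"
      have t: "0 < t" unfolding t_def using KL(1) x by (intro mult_pos_pos add_nonneg_pos mult_nonneg_nonneg) auto
      have "(real n * (K * (e n)\<^sup>2) + 1) / t = 1 / 4"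
        using t n by (simp add: t_def x_def field_simps)
      moreover have "exp t * real (card V) / real (card N) \<le> 1 / 4"
      proof -
        have "t + ln (real (card V)) + 2 \<le> t + A * x + 2" using V(4) by (simp add: x_def)
        also have "\<dots> \<le> Q * x" using x by (simp add: t_def Q_def algebra_simps)
        finally have "exp (t + ln (real (card V)) + 2) \<le> exp (ln (real (card N)))"
          using lnN by (subst exp_le_cancel_iff) linarith
        then have "exp t * real (card V) * exp 2 \<le> real (card N)" using cV cN by (simp add: exp_add)
        \<comment> \<open>The margin of 2 in the exponent supplies the factor 4 that brings the
          cardinality term below 1 / 4.\<close>
        moreover have "4 \<le> exp (2 :: real)"
        proof -
          have "(2 :: real)\<^sup>2 \<le> (exp 1)\<^sup>2" using exp_ge_add_one_self[of 1] by (intro power_mono) auto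
          then show ?thesis by (simp flip: exp_double)
        qed
        then have "exp t * real (card V) * 4 \<le> exp t * real (card V) * exp 2" by (intro mult_left_mono) auto
        ultimately have "exp t * real (card V) * 4 \<le> real (card N)" by linarith
        then show ?thesis using cN by (simp add: field_simps)
      qed
      ultimately have "(real n * (K * (e n)\<^sup>2) + 1) / t + exp t * real (card V) / real (card N) \<le> 1 / 2" by linarith
      then show ?thesis
        by (intro minimax_risk_lower[OF KL H h0 \<sigma> adm N(1) Nne V(1-3) t]) auto
    qed (use n in auto)
    have "ennreal ((e n)\<^sup>2) = ennreal (8 / (\<alpha> ^ j)\<^sup>2) * ennreal (\<eta>\<^sup>2 / 8)"
      using \<alpha> by (simp add: \<eta>_def power_mult_distrib flip: ennreal_mult)
    also have "\<dots> \<le> ennreal (8 / (\<alpha> ^ j)\<^sup>2) * minimax_risk D f U S H n"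
      using risk_lower by (intro mult_left_mono) auto
    finally show "ennreal ((e n)\<^sup>2) \<le> ennreal (8 / (\<alpha> ^ j)\<^sup>2) * minimax_risk D f U S H n" .
  qed
  show ?thesis using upper lower by (simp add: same_order_def)
qed

text \<open>The error density enters only through the measure it defines. This permits exchanging a
  density that vanishes at a point for an everywhere positive version.\<close>

lemma minimax_risk_cong_AE:
  assumes "f \<in> borel_measurable borel" "g \<in> borel_measurable borel" "AE y in lborel. f y = g y"
  shows "minimax_risk D f = minimax_risk D g"
proof -
  have "density lborel (\<lambda>y. ennreal (f y)) = density lborel (\<lambda>y. ennreal (g y))"
    using assms by (intro density_cong) auto
  then have "observation_law D f = observation_law D g"
    by (simp add: observation_law_def fun_eq_iff)
  then show ?thesis
    by (simp add: minimax_risk_def risk_def sample_law_def fun_eq_iff)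
qed

theorem corollary1:
  fixes D :: "'a measure"
    and H U S :: "('a \<Rightarrow> real) set"
    and h0 :: "'a \<Rightarrow> real"
    and f M :: "real \<Rightarrow> real"
    and B C \<sigma>bar :: real
    and e :: "nat \<Rightarrow> real"
  assumes H: "H \<subseteq> prob_densities D"
    and U_measurable: "U \<subseteq> borel_measurable D"
    and U_bounded: "\<forall>\<mu>\<in>U. \<forall>x\<in>space D. \<bar>\<mu> x\<bar> \<le> B"
    and U_totally_bounded: "L2_totally_bounded D h0 U"
    and S_nonempty: "S \<noteq> {}"
    and S_measurable: "S \<subseteq> borel_measurable D"
    and \<sigma>bar: "1 < \<sigma>bar"
    and S_bounded: "\<forall>\<sigma>\<in>S. \<forall>x\<in>space D. inverse \<sigma>bar \<le> \<sigma> x \<and> \<sigma> x \<le> \<sigma>bar"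
    and error_density:
      "(\<exists>\<tau>. 0 < \<tau> \<and> \<tau> < 1 \<and> f = asymmetric_laplace_density \<tau>) \<or>
       (\<exists>\<tau> a. 0 < \<tau> \<and> \<tau> < 1 \<and> 0 \<le> a \<and> f = truncated_gamma_density \<tau> a) \<or>
       (\<exists>\<tau> \<beta>. 0 < \<tau> \<and> \<tau> < 1 \<and> 0 < \<beta> \<and> (1 - \<tau>) / \<beta> = 2 * \<tau> / sqrt (2 * pi) \<and>
          f = normal_laplace_density \<tau> \<beta>) \<or>
       f = cauchy_density"
    and h0: "h0 \<in> H"
    and ratio_bounded: "\<forall>h\<in>H. \<forall>x\<in>space D. h x \<le> C * h0 x"
    and M_nonneg: "\<forall>\<epsilon>>0. 0 \<le> M \<epsilon>"
    and M_order: "same_order (at_right 0) (metric_entropy D h0 U) (\<lambda>\<epsilon>. ennreal (M \<epsilon>))"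
    and M_rich: "rich M"
    and M_regular: "order_regular M"
    and S_entropy: "ennreal_bigo (at_right 0) (metric_entropy D h0 S) (metric_entropy D h0 U)"
    and e: "critical_radius M e"
  shows "same_order sequentially (minimax_risk D f U S H) (\<lambda>n. ennreal ((e n)\<^sup>2))"
proof -
  have rate: "same_order sequentially (minimax_risk D g U S H) (\<lambda>n. ennreal ((e n)\<^sup>2))"
    if "regular_error g" for g
  proof -
    interpret regression_family D g B \<sigma>bar using that \<sigma>bar by unfold_locales
    show ?thesis
      by (rule minimax_rate[OF H U_measurable U_bounded S_nonempty S_measurable S_bounded h0
            ratio_bounded M_nonneg M_order M_rich S_entropy e])
  qed
  from error_density consider
      (laplace) \<tau> where "0 < \<tau>" "\<tau> < 1" "f = asymmetric_laplace_density \<tau>"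
    | (gamma) \<tau> a where "0 < \<tau>" "\<tau> < 1" "0 \<le> a" "f = truncated_gamma_density \<tau> a"
    | (normal_laplace) \<tau> \<beta> where "0 < \<tau>" "\<tau> < 1" "0 < \<beta>" "(1 - \<tau>) / \<beta> = 2 * \<tau> / sqrt (2 * pi)"
        "f = normal_laplace_density \<tau> \<beta>"
    | (cauchy) "f = cauchy_density"
    by blast
  then show ?thesis
  proof cases
    case laplace
    then show ?thesis using rate regular_error_check_gamma[of \<tau> 0] by (simp add: asymmetric_laplace_density_eq)
  next
    case gamma
    \<comment> \<open>For \<open>a = 0\<close> the stated density vanishes at 0 by the convention on
      \<open>powr\<close>, so regularity is shown for the positive version and the risk is
      transferred.\<close>
    have reg: "regular_error (check_gamma_density \<tau> a)" by (rule regular_error_check_gamma) fact+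
    have "truncated_gamma_density \<tau> a \<in> borel_measurable borel"
      unfolding truncated_gamma_density_def[abs_def] by measurable
    then have "minimax_risk D f = minimax_risk D (check_gamma_density \<tau> a)"
      unfolding gamma(4) using truncated_gamma_density_AE[OF gamma(1-3)] reg
      by (intro minimax_risk_cong_AE) (auto simp: regular_error_def)
    then show ?thesis using rate[OF reg] by simp
  next
    case normal_laplace
    then show ?thesis using rate regular_error_normal_laplace by blast
  next
    case cauchy
    then show ?thesis using rate regular_error_cauchy by blast
  qed
qed

end
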